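(* Let $m,n,p,q$ be integers with $0\le m\le q$, $0\le n\le p$, let $a_i,b_j\in\mathbb{C}$ and $\alpha_i,\beta_j>0$ ($1\le i\le p$, $1\le j\le q$), and let $\mathcal H(s)$, $\Delta$, $\delta$ and $H^{m,n}_{p,q}(z)$ be as defined in the context. Assume $$\beta_j(a_i-1-k)\ne\alpha_i(b_j+l)\qquad(i=1,\dots,n;\ j=1,\dots,m;\ k,l\in\mathbb N_0).$$ (A) If either $\Delta>0$ and $z\ne0$, or $\Delta=0$ and $0<|z|<\delta$, then $H^{m,n}_{p,q}(z)$ (with contour $\mathfrak L_{-\infty}$) is an analytic function of $z$ in the corresponding domain ($z\neq 0$, respectively $0<|z|<\delta$), and $$H^{m,n}_{p,q}(z)=\sum_{j=1}^m\sum_{l=0}^\infty\operatorname*{Res}_{s=b_{jl}}\left[\mathcal H(s)z^{-s}\right],\qquad b_{jl}=-\frac{b_j+l}{\beta_j},$$ where points $b_{jl}$ that coincide for different pairs $(j,l)$ are counted only once. (B) If either $\Delta<0$ and $z\ne0$, or $\Delta=0$ and $|z|>\delta$, then $H^{m,n}_{p,q}(z)$ (with contour $\mathfrak L_{+\infty}$) is an analytic function of $z$ in the corresponding domain ($z\neq 0$, respectively $|z|>\delta$), and $$H^{m,n}_{p,q}(z)=-\sum_{i=1}^n\sum_{k=0}^\infty\operatorname*{Res}_{s=a_{ik}}\left[\mathcal H(s)z^{-s}\right],\qquad a_{ik}=\frac{1-a_i+k}{\alpha_i},$$ where points $a_{ik}$ that coincide for different pairs $(i,k)$ are counted only once.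
   Context: $\mathbb N_0=\{0,1,2,\dots\}$. Definitions (empty products equal $1$, and $1/\Gamma$ is entire): $$\mathcal H(s)=\frac{\prod_{j=1}^m\Gamma(b_j+\beta_js)\ \prod_{i=1}^n\Gamma(1-a_i-\alpha_is)}{\prod_{i=n+1}^p\Gamma(a_i+\alpha_is)\ \prod_{j=m+1}^q\Gamma(1-b_j-\beta_js)},\qquad \Delta=\sum_{j=1}^q\beta_j-\sum_{i=1}^p\alpha_i,\qquad \delta=\prod_{i=1}^p\alpha_i^{-\alpha_i}\prod_{j=1}^q\beta_j^{\beta_j},$$ $$H^{m,n}_{p,q}(z)=\frac1{2\pi i}\int_{\mathfrak L}\mathcal H(s)z^{-s}\,ds .$$ $\mathfrak L_{-\infty}$ is a loop running from $-\infty+i\varphi_1$ to $-\infty+i\varphi_2$, $\varphi_1<\varphi_2$ (consisting of the half-lines $\operatorname{Im}s=\varphi_1,\varphi_2$ for $\operatorname{Re}s$ sufficiently negative), with all poles of $\Gamma(b_j+\beta_js)$ ($1\le j\le m$) to its left (inside) and all poles of $\Gamma(1-a_i-\alpha_is)$ ($1\le i\le n$) to its right (outside). $\mathfrak L_{+\infty}$ is a loop running from $+\infty+i\varphi_1$ to $+\infty+i\varphi_2$, $\varphi_1<\varphi_2$ (consisting of the half-lines $\operatorname{Im}s=\varphi_1,\varphi_2$ for $\operatorname{Re}s$ sufficiently large), with all poles of $\Gamma(b_j+\beta_js)$ ($1\le j\le m$) to its left (outside) and all poles of $\Gamma(1-a_i-\alpha_is)$ ($1\le i\le n$) to its right (inside).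 Here $z^{-s}=\exp(-s\log z)$; "analytic in $z$" is understood for a (generally multivalued) function, i.e. on the Riemann surface of $\log z$ over the stated domain, equivalently locally for each analytic branch of $\log z$.
   Formalization: The inner residue series can diverge (e.g. Γ(s)Γ(rs), r Liouville). Proved: H is the limit of partial sums with upper limits along suitable sequences; the double-series formula holds whenever the inner series converge, which is proved if the distinct poles are uniformly separated. *)

theory Defs
  imports "HOL-Complex_Analysis.Complex_Analysis"
begin

text \<open>
  Parameters are families indexed from 1: \<open>a, \<alpha>\<close> are read on \<open>{1..p}\<close> and \<open>b, \<beta>\<close> on \<open>{1..q}\<close>.
  The entire function \<open>1/\<Gamma>\<close> is \<^const>\<open>rGamma\<close>.
\<close>

definition fox_kernel ::
  "nat \<Rightarrow> nat \<Rightarrow> nat \<Rightarrow> nat \<Rightarrow> (nat \<Rightarrow> complex) \<Rightarrow> (nat \<Rightarrow> real) \<Rightarrow> (nat \<Rightarrow> complex) \<Rightarrow> (nat \<Rightarrow> real)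
    \<Rightarrow> complex \<Rightarrow> complex" where
  "fox_kernel m n p q a \<alpha> b \<beta> s =
     (\<Prod>j=1..m. Gamma (b j + of_real (\<beta> j) * s)) *
     (\<Prod>i=1..n. Gamma (1 - a i - of_real (\<alpha> i) * s)) *
     (\<Prod>i=n+1..p. rGamma (a i + of_real (\<alpha> i) * s)) *
     (\<Prod>j=m+1..q. rGamma (1 - b j - of_real (\<beta> j) * s))"

definition fox_Delta :: "nat \<Rightarrow> nat \<Rightarrow> (nat \<Rightarrow> real) \<Rightarrow> (nat \<Rightarrow> real) \<Rightarrow> real" where
  "fox_Delta p q \<alpha> \<beta> = (\<Sum>j=1..q. \<beta> j) - (\<Sum>i=1..p. \<alpha> i)"

definition fox_delta :: "nat \<Rightarrow> nat \<Rightarrow> (nat \<Rightarrow> real) \<Rightarrow> (nat \<Rightarrow> real) \<Rightarrow> real" where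
  "fox_delta p q \<alpha> \<beta> = (\<Prod>i=1..p. \<alpha> i powr (- \<alpha> i)) * (\<Prod>j=1..q. \<beta> j powr \<beta> j)"

text \<open>
  The integrand \<open>\<H>(s) z\<^sup>-\<^sup>s\<close>, where \<open>z\<^sup>-\<^sup>s = exp (- s log z)\<close> is formed with the value \<open>w\<close> of \<open>log z\<close>.
\<close>

definition fox_integrand ::
  "nat \<Rightarrow> nat \<Rightarrow> nat \<Rightarrow> nat \<Rightarrow> (nat \<Rightarrow> complex) \<Rightarrow> (nat \<Rightarrow> real) \<Rightarrow> (nat \<Rightarrow> complex) \<Rightarrow> (nat \<Rightarrow> real)
    \<Rightarrow> complex \<Rightarrow> complex \<Rightarrow> complex" where
  "fox_integrand m n p q a \<alpha> b \<beta> w = (\<lambda>s. fox_kernel m n p q a \<alpha> b \<beta> s * exp (- (s * w)))"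

definition log_branch_on :: "complex set \<Rightarrow> (complex \<Rightarrow> complex) \<Rightarrow> bool" where
  "log_branch_on U L \<longleftrightarrow> L holomorphic_on U \<and> (\<forall>z\<in>U. exp (L z) = z)"

definition fox_pole_b :: "(nat \<Rightarrow> complex) \<Rightarrow> (nat \<Rightarrow> real) \<Rightarrow> nat \<Rightarrow> nat \<Rightarrow> complex" where
  "fox_pole_b b \<beta> j l = - ((b j + of_nat l) / of_real (\<beta> j))"

definition fox_pole_a :: "(nat \<Rightarrow> complex) \<Rightarrow> (nat \<Rightarrow> real) \<Rightarrow> nat \<Rightarrow> nat \<Rightarrow> complex" where
  "fox_pole_a a \<alpha> i k = (1 - a i + of_nat k) / of_real (\<alpha> i)"

text \<open>
  A loop consists of two horizontal half-lines at heights \<open>\<phi>1 < \<phi>2\<close>, which end (respectively start)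
  at real part \<open>c\<close>, and a piecewise \<open>C\<^sup>1\<close> path \<open>g\<close> from \<open>c + i \<phi>1\<close> to \<open>c + i \<phi>2\<close>. The half-lines go
  to \<open>-\<infinity>\<close> for a left loop and to \<open>+\<infinity>\<close> for a right loop. The path \<open>g\<close> need not be simple, since the two
  sides of a loop are defined below as connected components of its complement.
\<close>

definition loop_link :: "real \<Rightarrow> real \<Rightarrow> real \<Rightarrow> (real \<Rightarrow> complex) \<Rightarrow> bool" where
  "loop_link \<phi>1 \<phi>2 c g \<longleftrightarrow>
     \<phi>1 < \<phi>2 \<and> valid_path g \<and> pathstart g = Complex c \<phi>1 \<and> pathfinish g = Complex c \<phi>2"

definition left_loop_image :: "real \<Rightarrow> real \<Rightarrow> real \<Rightarrow> (real \<Rightarrow> complex) \<Rightarrow> complex set" where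
  "left_loop_image \<phi>1 \<phi>2 c g =
     {s. Im s \<in> {\<phi>1, \<phi>2} \<and> Re s \<le> c} \<union> path_image g"

definition right_loop_image :: "real \<Rightarrow> real \<Rightarrow> real \<Rightarrow> (real \<Rightarrow> complex) \<Rightarrow> complex set" where
  "right_loop_image \<phi>1 \<phi>2 c g =
     {s. Im s \<in> {\<phi>1, \<phi>2} \<and> c \<le> Re s} \<union> path_image g"

text \<open>
  The inside is the component of the complement that contains the end of the strip between the
  half-lines; the outside is the component that contains a half-plane on the opposite side.
\<close>

definition left_loop_inside :: "real \<Rightarrow> real \<Rightarrow> real \<Rightarrow> (real \<Rightarrow> complex) \<Rightarrow> complex set" where
  "left_loop_inside \<phi>1 \<phi>2 c g =
     {s. \<exists>X. \<forall>t. Re t < X \<and> \<phi>1 < Im t \<and> Im t < \<phi>2 \<longrightarrow>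
           connected_component (- left_loop_image \<phi>1 \<phi>2 c g) s t}"

definition left_loop_outside :: "real \<Rightarrow> real \<Rightarrow> real \<Rightarrow> (real \<Rightarrow> complex) \<Rightarrow> complex set" where
  "left_loop_outside \<phi>1 \<phi>2 c g =
     {s. \<exists>X. \<forall>t. X < Re t \<longrightarrow> connected_component (- left_loop_image \<phi>1 \<phi>2 c g) s t}"

definition right_loop_inside :: "real \<Rightarrow> real \<Rightarrow> real \<Rightarrow> (real \<Rightarrow> complex) \<Rightarrow> complex set" where
  "right_loop_inside \<phi>1 \<phi>2 c g =
     {s. \<exists>X. \<forall>t. X < Re t \<and> \<phi>1 < Im t \<and> Im t < \<phi>2 \<longrightarrow>
           connected_component (- right_loop_image \<phi>1 \<phi>2 c g) s t}"

definition right_loop_outside :: "real \<Rightarrow> real \<Rightarrow> real \<Rightarrow> (real \<Rightarrow> complex) \<Rightarrow> complex set" where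
  "right_loop_outside \<phi>1 \<phi>2 c g =
     {s. \<exists>X. \<forall>t. Re t < X \<longrightarrow> connected_component (- right_loop_image \<phi>1 \<phi>2 c g) s t}"

definition fox_left_loop ::
  "nat \<Rightarrow> nat \<Rightarrow> (nat \<Rightarrow> complex) \<Rightarrow> (nat \<Rightarrow> real) \<Rightarrow> (nat \<Rightarrow> complex) \<Rightarrow> (nat \<Rightarrow> real)
    \<Rightarrow> real \<Rightarrow> real \<Rightarrow> real \<Rightarrow> (real \<Rightarrow> complex) \<Rightarrow> bool" where
  "fox_left_loop m n a \<alpha> b \<beta> \<phi>1 \<phi>2 c g \<longleftrightarrow> loop_link \<phi>1 \<phi>2 c g \<and>
     (\<forall>j\<in>{1..m}. \<forall>s. is_pole (\<lambda>s. Gamma (b j + of_real (\<beta> j) * s)) s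
        \<longrightarrow> s \<in> left_loop_inside \<phi>1 \<phi>2 c g) \<and>
     (\<forall>i\<in>{1..n}. \<forall>s. is_pole (\<lambda>s. Gamma (1 - a i - of_real (\<alpha> i) * s)) s
        \<longrightarrow> s \<in> left_loop_outside \<phi>1 \<phi>2 c g)"

definition fox_right_loop ::
  "nat \<Rightarrow> nat \<Rightarrow> (nat \<Rightarrow> complex) \<Rightarrow> (nat \<Rightarrow> real) \<Rightarrow> (nat \<Rightarrow> complex) \<Rightarrow> (nat \<Rightarrow> real)
    \<Rightarrow> real \<Rightarrow> real \<Rightarrow> real \<Rightarrow> (real \<Rightarrow> complex) \<Rightarrow> bool" where
  "fox_right_loop m n a \<alpha> b \<beta> \<phi>1 \<phi>2 c g \<longleftrightarrow> loop_link \<phi>1 \<phi>2 c g \<and>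
     (\<forall>j\<in>{1..m}. \<forall>s. is_pole (\<lambda>s. Gamma (b j + of_real (\<beta> j) * s)) s
        \<longrightarrow> s \<in> right_loop_outside \<phi>1 \<phi>2 c g) \<and>
     (\<forall>i\<in>{1..n}. \<forall>s. is_pole (\<lambda>s. Gamma (1 - a i - of_real (\<alpha> i) * s)) s
        \<longrightarrow> s \<in> right_loop_inside \<phi>1 \<phi>2 c g)"

text \<open>
  Both loops are traversed from height \<open>\<phi>1\<close> to height \<open>\<phi>2\<close>. On an unbounded interval the
  Henstock--Kurzweil integral of a continuous function is its improper integral.
\<close>

definition left_loop_integrable ::
  "real \<Rightarrow> real \<Rightarrow> real \<Rightarrow> (real \<Rightarrow> complex) \<Rightarrow> (complex \<Rightarrow> complex) \<Rightarrow> bool" where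
  "left_loop_integrable \<phi>1 \<phi>2 c g f \<longleftrightarrow>
     (\<lambda>x. f (Complex x \<phi>1)) integrable_on {..c} \<and> f contour_integrable_on g \<and>
     (\<lambda>x. f (Complex x \<phi>2)) integrable_on {..c}"

definition left_loop_integral ::
  "real \<Rightarrow> real \<Rightarrow> real \<Rightarrow> (real \<Rightarrow> complex) \<Rightarrow> (complex \<Rightarrow> complex) \<Rightarrow> complex" where
  "left_loop_integral \<phi>1 \<phi>2 c g f =
     integral {..c} (\<lambda>x. f (Complex x \<phi>1)) + contour_integral g f
       - integral {..c} (\<lambda>x. f (Complex x \<phi>2))"

definition right_loop_integrable ::
  "real \<Rightarrow> real \<Rightarrow> real \<Rightarrow> (real \<Rightarrow> complex) \<Rightarrow> (complex \<Rightarrow> complex) \<Rightarrow> bool" where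
  "right_loop_integrable \<phi>1 \<phi>2 c g f \<longleftrightarrow>
     (\<lambda>x. f (Complex x \<phi>1)) integrable_on {c..} \<and> f contour_integrable_on g \<and>
     (\<lambda>x. f (Complex x \<phi>2)) integrable_on {c..}"

definition right_loop_integral ::
  "real \<Rightarrow> real \<Rightarrow> real \<Rightarrow> (real \<Rightarrow> complex) \<Rightarrow> (complex \<Rightarrow> complex) \<Rightarrow> complex" where
  "right_loop_integral \<phi>1 \<phi>2 c g f =
     - integral {c..} (\<lambda>x. f (Complex x \<phi>1)) + contour_integral g f
       + integral {c..} (\<lambda>x. f (Complex x \<phi>2))"

definition fox_H_left ::
  "nat \<Rightarrow> nat \<Rightarrow> nat \<Rightarrow> nat \<Rightarrow> (nat \<Rightarrow> complex) \<Rightarrow> (nat \<Rightarrow> real) \<Rightarrow> (nat \<Rightarrow> complex) \<Rightarrow> (nat \<Rightarrow> real)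
    \<Rightarrow> real \<Rightarrow> real \<Rightarrow> real \<Rightarrow> (real \<Rightarrow> complex) \<Rightarrow> (complex \<Rightarrow> complex) \<Rightarrow> complex \<Rightarrow> complex" where
  "fox_H_left m n p q a \<alpha> b \<beta> \<phi>1 \<phi>2 c g L z =
     1 / (2 * of_real pi * \<i>) *
       left_loop_integral \<phi>1 \<phi>2 c g (fox_integrand m n p q a \<alpha> b \<beta> (L z))"

definition fox_H_right ::
  "nat \<Rightarrow> nat \<Rightarrow> nat \<Rightarrow> nat \<Rightarrow> (nat \<Rightarrow> complex) \<Rightarrow> (nat \<Rightarrow> real) \<Rightarrow> (nat \<Rightarrow> complex) \<Rightarrow> (nat \<Rightarrow> real)
    \<Rightarrow> real \<Rightarrow> real \<Rightarrow> real \<Rightarrow> (real \<Rightarrow> complex) \<Rightarrow> (complex \<Rightarrow> complex) \<Rightarrow> complex \<Rightarrow> complex" where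
  "fox_H_right m n p q a \<alpha> b \<beta> \<phi>1 \<phi>2 c g L z =
     1 / (2 * of_real pi * \<i>) *
       right_loop_integral \<phi>1 \<phi>2 c g (fox_integrand m n p q a \<alpha> b \<beta> (L z))"

text \<open>
  Term \<open>(j, l)\<close>, \<open>j \<ge> 1\<close>, of a residue series over the points \<open>pt j l\<close>. A point that occurs for several
  pairs contributes only at the smallest such \<open>j\<close>; for fixed \<open>j\<close> the points of both families above
  are pairwise distinct.
\<close>

definition residue_term ::
  "(complex \<Rightarrow> complex) \<Rightarrow> (nat \<Rightarrow> nat \<Rightarrow> complex) \<Rightarrow> nat \<Rightarrow> nat \<Rightarrow> complex" where
  "residue_term f pt j l =
     (if \<exists>j'\<in>{1..<j}. \<exists>l'. pt j' l' = pt j l then 0 else residue f (pt j l))"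

text \<open>
  Meaning of \<open>S = (\<Sum>j=1..m. \<Sum>l. residue_term f pt j l)\<close>. If a ratio \<open>\<beta>\<^sub>i / \<beta>\<^sub>j\<close> is extremely well
  approximable by rationals (a Liouville-type number), points of different rows come so close
  together that the inner series can diverge, and only groups of residues at neighbouring points
  form a convergent series. So the upper limits of the inner sums run along
  sequences \<open>K j\<close>. Moreover the double series, taken literally, has the value \<open>S\<close> whenever its inner
  series converge, and they do converge if the distinct points keep a positive distance.
\<close>

definition residue_double_series ::
  "(nat \<Rightarrow> nat \<Rightarrow> nat) \<Rightarrow> (complex \<Rightarrow> complex) \<Rightarrow> (nat \<Rightarrow> nat \<Rightarrow> complex) \<Rightarrow> nat \<Rightarrow> complex \<Rightarrow> bool" where
  "residue_double_series K f pt m S \<longleftrightarrow>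
     (\<lambda>N. \<Sum>j=1..m. \<Sum>l<K j N. residue_term f pt j l) \<longlonglongrightarrow> S \<and>
     ((\<forall>j\<in>{1..m}. summable (residue_term f pt j)) \<longrightarrow>
        S = (\<Sum>j=1..m. \<Sum>l. residue_term f pt j l)) \<and>
     (uniform_discrete {pt j l | j l. j \<in> {1..m}} \<longrightarrow>
        (\<forall>j\<in>{1..m}. summable (residue_term f pt j)))"

end

theory Submission
  imports Defs "HOL-Real_Asymp.Real_Asymp"
begin

text \<open>
  Writing \<open>w\<close> for the value of \<open>log z\<close>, one works with the integrand \<open>\<H>(s) exp(-sw)\<close>. The reflection formula
  turns \<open>\<H>\<close> for \<open>Re s \<rightarrow> -\<infinity>\<close> into a product of trigonometric factors, which are bounded in a horizontal strip
  at a positive distance from the poles, and of Gamma factors in the right half-plane. Stirling-type bounds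
  for the latter combine to \<open>exp (- \<Delta> (x ln x - x) - x ln \<delta> + O(ln x))\<close> with \<open>x = - Re s\<close>, so that the
  integrand decays exponentially. Hence the integrals over the half-lines converge locally uniformly in
  \<open>w\<close>, and the loop, cut off by vertical segments whose distance to the poles is bounded below,
  has in the limit the integral given by the residue theorem. The number of terms taken from each row
  of poles is determined by the abscissa of the vertical segment. The winding numbers follow from comparing two
  truncations, which differ by a rectangle. The substitution \<open>s \<mapsto> -s\<close> exchanges \<open>(m, n)\<close>, \<open>(p, q)\<close>,
  \<open>(a, 1 - b)\<close> and \<open>(\<alpha>, \<beta>)\<close>, and reduces right loops to left loops.
\<close>

section \<open>Stirling bounds for the Gamma function\<close>

text \<open>A crude form of Stirling's formula suffices. An error \<open>O(ln x)\<close> in the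
  exponent is only a power of x, and the main terms leave room for it: for \<Delta> > 0 the term
  \<Delta> x ln x beats everything linear, and for \<Delta> = 0 the positive gap ln \<delta> - ln
  |z| remains. So factorials and compactness replace an asymptotic expansion. The delicate point is
  where to cut the loop. The real parts of different rows of poles form progressions whose steps may
  be incommensurable, yet the clearance of the cut must not shrink as it moves to the left. As there
  are only finitely many rows, every window of fixed length contains an abscissa with a fixed
  clearance. These abscissae depend on b and \<beta> alone, hence so do the numbers of terms, which
  then serve all loops and all z. Since g need not be simple and the sides of the loop are given as
  connected components, no Jordan curve argument is available. Winding numbers are instead
  transported along a path off the loop to a point where they can be computed.\<close>

definition stirling_exponent :: "real \<Rightarrow> real" where
  "stirling_exponent y = y * ln y - y"

lemma stirling_exponent_mono:
  assumes "1 \<le> x" "x \<le> y"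
  shows "stirling_exponent x \<le> stirling_exponent y"
proof -
  have "x * ln x - x \<le> y * ln y - y"
  proof (rule DERIV_nonneg_imp_nondecreasing[OF \<open>x \<le> y\<close>])
    fix t assume t: "x \<le> t" "t \<le> y"
    then have "((\<lambda>t. t * ln t - t) has_real_derivative ln t) (at t)"
      using assms by (auto intro!: derivative_eq_intros)
    moreover have "0 \<le> ln t" using t assms by simp
    ultimately show "\<exists>d. ((\<lambda>t. t * ln t - t) has_real_derivative d) (at t) \<and> 0 \<le> d" by blast
  qed
  then show ?thesis by (simp add: stirling_exponent_def)
qed

text \<open>Both bounds telescope from \<open>1/(x+1) \<le> ln (x+1) - ln x \<le> 1/x\<close>. The
  final 1 makes the upper bound an equality at n = 1.\<close>

lemma ln_fact_bounds:
  assumes "n \<ge> 1"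
  shows "stirling_exponent (real n) \<le> ln (fact n)"
    and "ln (fact n) \<le> stirling_exponent (real n) + ln (real n) + 1"
proof -
  have incr: "stirling_exponent (real (Suc n)) - stirling_exponent (real n) \<le> ln (real (Suc n))"
      "ln (real (Suc n)) \<le> stirling_exponent (real (Suc n)) + ln (real (Suc n))
         - stirling_exponent (real n) - ln (real n)" if "n \<ge> 1" for n
  proof -
    define x where "x = real n"
    define d where "d = ln (x + 1) - ln x"
    have x: "x > 0" using that by (simp add: x_def)
    have eq: "d = ln (1 + 1/x)"
    proof -
      have "1 + 1/x = (x + 1) / x" using x by (simp add: field_simps)
      then show ?thesis using x by (simp add: d_def ln_div)
    qed
    have "d \<le> 1/x" unfolding eq using x by (intro ln_add_one_self_le_self) auto
    then have a: "x * d \<le> 1" using x by (simp add: field_simps)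
    have "- d = ln (x / (x+1))" using x by (simp add: d_def ln_div)
    also have "\<dots> \<le> x / (x+1) - 1" using x by (intro ln_le_minus_one) auto
    also have "\<dots> = - (1 / (x+1))" using x by (simp add: field_simps)
    finally have b: "1 \<le> (x+1) * d" using x by (simp add: field_simps)
    have l: "ln (x+1) = ln x + d" by (simp add: d_def)
    have S: "real (Suc n) = x + 1" by (simp add: x_def)
    show "stirling_exponent (real (Suc n)) - stirling_exponent (real n) \<le> ln (real (Suc n))"
      unfolding S x_def[symmetric] stirling_exponent_def l using a by (simp add: algebra_simps)
    show "ln (real (Suc n)) \<le> stirling_exponent (real (Suc n)) + ln (real (Suc n))
         - stirling_exponent (real n) - ln (real n)"
      unfolding S x_def[symmetric] stirling_exponent_def l using b by (simp add: algebra_simps)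
  qed
  have fact_Suc': "ln (fact (Suc n) :: real) = ln (real (Suc n)) + ln (fact n)" for n
    by (simp add: ln_mult del: of_nat_Suc)
  show "stirling_exponent (real n) \<le> ln (fact n)" using assms
  proof (induction n rule: dec_induct)
    case base show ?case by (simp add: stirling_exponent_def)
  next
    case (step n) then show ?case using incr(1)[of n] fact_Suc'[of n] by simp
  qed
  show "ln (fact n) \<le> stirling_exponent (real n) + ln (real n) + 1" using assms
  proof (induction n rule: dec_induct)
    case base show ?case by (simp add: stirling_exponent_def)
  next
    case (step n) then show ?case using incr(2)[of n] fact_Suc'[of n] by simp
  qed
qed

text \<open>The factor \<open>v + k\<close> has modulus between k + 1 and M + k. The product of the
  upper bounds is a quotient of factorials, which exceeds n! by at most a power of fixed degree
  M.\<close>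

lemma norm_pochhammer_bounds:
  fixes v :: complex
  assumes v: "1 \<le> Re v" and M: "norm v \<le> real M" and "M \<ge> 1"
  shows "fact n \<le> norm (pochhammer v n)"
    and "norm (pochhammer v n) \<le> fact n * (real n + real M) ^ M"
proof -
  have "norm (pochhammer v n) = (\<Prod>k<n. norm (v + of_nat k))"
    by (simp add: pochhammer_prod prod_norm lessThan_atLeast0)
  note eq = this
  have f: "fact n = (\<Prod>k<n. real (Suc k))" 
    by (simp add: fact_prod_Suc lessThan_atLeast0)
  show "fact n \<le> norm (pochhammer v n)" unfolding eq f
  proof (rule prod_mono)
    fix k assume "k \<in> {..<n}"
    have "real (Suc k) \<le> Re (v + of_nat k)" using v by simp
    also have "\<dots> \<le> norm (v + of_nat k)" by (rule complex_Re_le_cmod)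
    finally show "0 \<le> real (Suc k) \<and> real (Suc k) \<le> norm (v + of_nat k)" by simp
  qed
  have "norm (pochhammer v n) \<le> (\<Prod>k<n. real (M + k))" unfolding eq
    by (intro prod_mono) (auto intro!: order_trans[OF norm_triangle_ineq] M)
  also have "\<dots> = fact (n + M - 1) / fact (M - 1)"
  proof -
    have "(\<Prod>k<n. real (M + k)) = pochhammer (real M) n"
      by (simp add: pochhammer_prod lessThan_atLeast0)
    also have "pochhammer (real M) n * fact (M - 1) = fact (n + M - 1)"
      using \<open>M \<ge> 1\<close>
    proof (induction n)
      case (Suc n)
      have "Suc n + M - 1 = Suc (n + M - 1)" "Suc (n + M - 1) = n + M" using Suc.prems by auto
      then have "(fact (Suc n + M - 1) :: real) = real (n + M) * fact (n + M - 1)"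
        by (metis fact_Suc of_nat_fact of_nat_mult)
      then show ?case using Suc by (simp add: pochhammer_Suc algebra_simps)
    qed auto
    ultimately show ?thesis by (simp add: field_simps)
  qed
  also have "\<dots> \<le> fact (n + M - 1)" by (simp add: field_simps fact_ge_1)
  also have "\<dots> \<le> fact (n + M)" by (intro fact_mono) auto
  also have "\<dots> \<le> fact n * (real n + real M) ^ M"
  proof -
    have "fact (n + k) \<le> fact n * (real n + real M) ^ k" if "k \<le> M" for k using that
    proof (induction k)
      case (Suc k)
      have "fact (n + Suc k) = real (n + Suc k) * fact (n + k)" by simp
      also have "\<dots> \<le> (real n + real M) * (fact n * (real n + real M) ^ k)"
        using Suc by (intro mult_mono) auto
      finally show ?case by (simp add: mult_ac)
    qed auto
    then show ?thesis by simp
  qed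
  finally show "norm (pochhammer v n) \<le> fact n * (real n + real M) ^ M" .
qed

text \<open>On this compact rectangle \<open>Gamma\<close> has no pole, and the lower bound comes
  from the continuity of \<open>rGamma\<close>.\<close>

lemma Gamma_strip_compact_bounds:
  fixes Y :: real
  obtains B where "B \<ge> 1"
    "\<And>v. 1 \<le> Re v \<Longrightarrow> Re v \<le> 2 \<Longrightarrow> \<bar>Im v\<bar> \<le> Y \<Longrightarrow> norm (Gamma v) \<le> B \<and> 1 / B \<le> norm (Gamma v)"
proof -
  define S where "S = cbox (Complex 1 (-Y)) (Complex 2 Y)"
  have S: "v \<in> S \<longleftrightarrow> 1 \<le> Re v \<and> Re v \<le> 2 \<and> \<bar>Im v\<bar> \<le> Y" for v
    by (auto simp: S_def in_cbox_complex_iff)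
  have nz: "v \<notin> \<int>\<^sub>\<le>\<^sub>0" if "v \<in> S" for v
    using that S by (auto elim!: nonpos_Ints_cases)
  have "compact S" by (simp add: S_def)
  have "Gamma holomorphic_on S" using nz by (intro holomorphic_Gamma) auto
  then have "bounded (Gamma ` S)"
    by (intro compact_imp_bounded compact_continuous_image holomorphic_on_imp_continuous_on \<open>compact S\<close>)
  then obtain B1 where B1: "\<And>v. v \<in> S \<Longrightarrow> norm (Gamma v) \<le> B1"
    by (auto simp: bounded_iff)
  have "bounded (rGamma ` S)"
    by (intro compact_imp_bounded compact_continuous_image holomorphic_on_imp_continuous_on
         holomorphic_rGamma \<open>compact S\<close>)
  then obtain B2 where B2: "\<And>v. v \<in> S \<Longrightarrow> norm (rGamma v) \<le> B2"
    by (auto simp: bounded_iff)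
  define B where "B = max 1 (max B1 B2)"
  show ?thesis
  proof (rule that[of B])
    fix v assume "1 \<le> Re v" "Re v \<le> 2" "\<bar>Im v\<bar> \<le> Y"
    then have v: "v \<in> S" by (simp add: S)
    then have "Gamma v \<noteq> 0" using nz by (simp add: Gamma_eq_zero_iff)
    moreover have "inverse (norm (Gamma v)) \<le> B"
      using B2[OF v] by (simp add: rGamma_inverse_Gamma norm_inverse B_def)
    moreover have "B \<ge> 1" by (simp add: B_def)
    ultimately have "1 / B \<le> norm (Gamma v)" 
      by (simp add: field_simps)
    then show "norm (Gamma v) \<le> B \<and> 1 / B \<le> norm (Gamma v)"
      using B1[OF v] by (auto simp: B_def)
  qed (simp add: B_def)
qed

text \<open>The functional equation moves u by an integer N into the rectangle with real part
  between 1 and 2. The Pochhammer factor that splits off is N! up to a power of \<open>Re u\<close>,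
  and the rest is bounded above and below.\<close>

lemma Gamma_vertical_strip_bounds:
  fixes Y :: real
  obtains K X where "K \<ge> 0" "X \<ge> 1"
    "\<And>u. X \<le> Re u \<Longrightarrow> \<bar>Im u\<bar> \<le> Y \<Longrightarrow>
       norm (Gamma u) \<le> exp (stirling_exponent (Re u) + K * ln (Re u)) \<and>
       exp (stirling_exponent (Re u) - K * ln (Re u)) \<le> norm (Gamma u)"
proof -
  obtain B where B: "B \<ge> 1" "\<And>v. 1 \<le> Re v \<Longrightarrow> Re v \<le> 2 \<Longrightarrow> \<bar>Im v\<bar> \<le> Y \<Longrightarrow>
      norm (Gamma v) \<le> B \<and> 1 / B \<le> norm (Gamma v)"
    using Gamma_strip_compact_bounds[of Y] by metis
  obtain M0 :: nat where M0: "2 + \<bar>Y\<bar> \<le> real M0" using real_arch_simple by blast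
  define M where "M = Suc M0"
  have M: "M \<ge> 1" "2 + \<bar>Y\<bar> \<le> real M" using M0 by (auto simp: M_def)
  \<comment> \<open>The upper estimate needs a coefficient above M + 1. The lower one needs more
    than 2, because \<open>stirling_exponent r - stirling_exponent (r - 2)\<close> grows like 2 ln
    r.\<close>
  define K where "K = real M + 4"
  have e1: "eventually (\<lambda>r. ln B + ln r + 1 + real M * ln (r + real M) \<le> K * ln r) at_top"
    unfolding K_def by real_asymp
  have e2: "eventually (\<lambda>r. stirling_exponent r - K * ln r \<le> stirling_exponent (r - 2) - ln B) at_top"
    unfolding K_def stirling_exponent_def by real_asymp
  have "eventually (\<lambda>r::real. r \<ge> 4) at_top" by real_asymp
  with e1 e2 have "eventually (\<lambda>r. ln B + ln r + 1 + real M * ln (r + real M) \<le> K * ln r \<and>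
      stirling_exponent r - K * ln r \<le> stirling_exponent (r - 2) - ln B \<and> r \<ge> 4) at_top"
    by eventually_elim auto
  then obtain X where X: "\<And>r. r \<ge> X \<Longrightarrow> ln B + ln r + 1 + real M * ln (r + real M) \<le> K * ln r \<and>
      stirling_exponent r - K * ln r \<le> stirling_exponent (r - 2) - ln B \<and> r \<ge> 4"
    by (auto simp: eventually_at_top_linorder)
  show ?thesis
  proof (rule that[of K "max 1 X"])
    fix u assume u: "max 1 X \<le> Re u" "\<bar>Im u\<bar> \<le> Y"
    define r where "r = Re u"
    note X = X[of r]
    have r: "r \<ge> 4" using X u by (simp add: r_def)
    \<comment> \<open>One less than the floor, so that \<open>u - N\<close> has real part between 1
      and 2 and stays away from the pole at 0.\<close>
    define N where "N = nat \<lfloor>r\<rfloor> - 1"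
    have N: "r - 2 \<le> real N" "real N \<le> r - 1"
      using r unfolding N_def by linarith+
    have N1: "N \<ge> 1" using N r by linarith
    define v where "v = u - of_nat N"
    have v: "1 \<le> Re v" "Re v \<le> 2" "\<bar>Im v\<bar> \<le> Y"
      using N u by (auto simp: v_def r_def)
    have "v \<notin> \<int>\<^sub>\<le>\<^sub>0" using v by (auto elim!: nonpos_Ints_cases)
    then have "pochhammer v N = Gamma u / Gamma v" "Gamma v \<noteq> 0"
      using pochhammer_Gamma[of v N] by (auto simp: v_def Gamma_eq_zero_iff)
    then have Gu: "norm (Gamma u) = norm (pochhammer v N) * norm (Gamma v)"
      by (simp add: norm_divide)
    have nv: "norm v \<le> real M" using cmod_le[of v] v M by linarith
    note P = norm_pochhammer_bounds[OF v(1) nv M(1), of N]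
    note Bv = B(2)[OF v]
    have "norm (Gamma u) \<le> (fact N * (real N + real M) ^ M) * B"
      unfolding Gu using P Bv B by (intro mult_mono) auto
    also have "\<dots> = exp (ln (fact N) + real M * ln (real N + real M) + ln B)"
      using B N1 by (simp add: exp_add exp_of_nat_mult)
    also have "ln (fact N) + real M * ln (real N + real M) + ln B
        \<le> (stirling_exponent r + ln r + 1) + real M * ln (r + real M) + ln B"
    proof -
      have "ln (fact N) \<le> stirling_exponent (real N) + ln (real N) + 1" by (rule ln_fact_bounds[OF N1])
      moreover have "stirling_exponent (real N) \<le> stirling_exponent r"
        using N N1 by (intro stirling_exponent_mono) auto
      moreover have "ln (real N) \<le> ln r" using N N1 by simp
      moreover have "real M * ln (real N + real M) \<le> real M * ln (r + real M)"
        using N N1 by (intro mult_left_mono) auto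
      ultimately show ?thesis by linarith
    qed
    also have "\<dots> \<le> stirling_exponent r + K * ln r" using X u by (simp add: r_def)
    finally have upper: "norm (Gamma u) \<le> exp (stirling_exponent r + K * ln r)" by simp
    have "exp (stirling_exponent r - K * ln r) \<le> exp (stirling_exponent (r - 2) - ln B)"
      using X u by (simp add: r_def)
    also have "\<dots> \<le> exp (ln (fact N) - ln B)"
      using ln_fact_bounds(1)[OF N1] stirling_exponent_mono[of "r - 2" "real N"] N r by simp
    also have "\<dots> = fact N * (1 / B)" using B by (simp add: exp_diff)
    also have "\<dots> \<le> norm (Gamma u)" unfolding Gu using P Bv B by (intro mult_mono) auto
    finally show "norm (Gamma u) \<le> exp (stirling_exponent (Re u) + K * ln (Re u)) \<and>
       exp (stirling_exponent (Re u) - K * ln (Re u)) \<le> norm (Gamma u)"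
      using upper by (simp add: r_def)
  qed (auto simp: K_def)
qed

section \<open>Decay of the kernel\<close>

text \<open>A filter allows the bounds for the single Gamma factors, each valid beyond its own
  abscissa, to be combined without tracking the thresholds.\<close>

definition left_end :: "complex set \<Rightarrow> complex filter" where
  "left_end S = inf (filtercomap Re at_bot) (principal S)"

lemma eventually_left_end:
  "eventually P (left_end S) \<longleftrightarrow> (\<exists>X. \<forall>s\<in>S. Re s \<le> X \<longrightarrow> P s)"
  unfolding left_end_def eventually_inf_principal eventually_filtercomap_at_bot_linorder by blast

lemma eventually_left_end_at_top:
  assumes "eventually Q at_top"
  shows "eventually (\<lambda>s. Q (- Re s)) (left_end S)"
proof -
  obtain X where "\<And>x. x \<ge> X \<Longrightarrow> Q x" using assms by (auto simp: eventually_at_top_linorder)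
  then show ?thesis unfolding eventually_left_end by (intro exI[of _ "-X"]) auto
qed

lemma eventually_left_end_mem: "eventually (\<lambda>s. s \<in> S) (left_end S)"
  by (auto simp: eventually_left_end)

text \<open>The free coefficient K absorbs constants and powers of \<open>- Re s\<close>. This makes
  the notion multiplicative in f and additive in h, so that only the exponents h have to be followed
  through the product.\<close>

definition stirling_bound :: "complex set \<Rightarrow> (real \<Rightarrow> real) \<Rightarrow> (complex \<Rightarrow> complex) \<Rightarrow> bool" where
  "stirling_bound S h f \<longleftrightarrow>
     (\<exists>K. eventually (\<lambda>s. norm (f s) \<le> exp (h (- Re s) + K * ln (- Re s))) (left_end S))"

lemma stirling_bound_mult:
  assumes "stirling_bound S h f" "stirling_bound S k g"
  shows "stirling_bound S (\<lambda>x. h x + k x) (\<lambda>s. f s * g s)"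
proof -
  obtain K L where "eventually (\<lambda>s. norm (f s) \<le> exp (h (- Re s) + K * ln (- Re s))) (left_end S)"
    "eventually (\<lambda>s. norm (g s) \<le> exp (k (- Re s) + L * ln (- Re s))) (left_end S)"
    using assms unfolding stirling_bound_def by blast
  then have "eventually (\<lambda>s. norm (f s * g s) \<le> exp ((h (- Re s) + k (- Re s)) + (K + L) * ln (- Re s))) (left_end S)"
  proof eventually_elim
    case (elim s)
    then have "norm (f s) * norm (g s) \<le> exp (h (- Re s) + K * ln (- Re s)) * exp (k (- Re s) + L * ln (- Re s))"
      by (intro mult_mono) auto
    then show ?case by (simp add: norm_mult exp_add[symmetric] algebra_simps)
  qed
  then show ?thesis unfolding stirling_bound_def by blast
qed

lemma stirling_bound_bounded:
  assumes "eventually (\<lambda>s. norm (f s) \<le> B) (left_end S)"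
  shows "stirling_bound S (\<lambda>_. 0) f"
proof -
  have "eventually (\<lambda>s. ln (max 1 B) \<le> 1 * ln (- Re s)) (left_end S)"
    by (rule eventually_left_end_at_top) real_asymp
  with assms have "eventually (\<lambda>s. norm (f s) \<le> exp (0 + 1 * ln (- Re s))) (left_end S)"
  proof eventually_elim
    case (elim s)
    have "norm (f s) \<le> max 1 B" using elim by simp
    also have "max 1 B = exp (ln (max 1 B))" by simp
    also have "\<dots> \<le> exp (0 + 1 * ln (- Re s))" using elim by (intro exp_le_cancel_iff[THEN iffD2]) simp
    finally show ?case .
  qed
  then show ?thesis unfolding stirling_bound_def by blast
qed

lemma stirling_bound_prod:
  assumes "finite I" "\<And>i. i \<in> I \<Longrightarrow> stirling_bound S (h i) (f i)"
  shows "stirling_bound S (\<lambda>x. \<Sum>i\<in>I. h i x) (\<lambda>s. \<Prod>i\<in>I. f i s)"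
  using assms
proof (induction I rule: finite_induct)
  case empty
  show ?case using stirling_bound_bounded[of "\<lambda>_. 1" 1 S] by simp
next
  case (insert i I)
  then show ?case using stirling_bound_mult[of S "h i" "f i"] by simp
qed

text \<open>Shifting the argument by \<open>Re c\<close> changes \<open>stirling_exponent\<close> by
  about \<open>Re c * ln x\<close>, which is again only a power of x. Hence the exponent depends on
  the slope \<alpha> alone.\<close>

lemma Gamma_strip_bounds:
  assumes \<alpha>: "\<alpha> > 0" and S: "\<And>s. s \<in> S \<Longrightarrow> \<bar>Im s\<bar> \<le> Y"
  obtains K where
    "eventually (\<lambda>s. norm (Gamma (c - of_real \<alpha> * s)) \<le> exp (stirling_exponent (\<alpha> * (- Re s)) + K * ln (- Re s)) \<and>
       exp (stirling_exponent (\<alpha> * (- Re s)) - K * ln (- Re s)) \<le> norm (Gamma (c - of_real \<alpha> * s))) (left_end S)"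
proof -
  obtain K X where K: "K \<ge> 0" and X:
    "\<And>u. X \<le> Re u \<Longrightarrow> \<bar>Im u\<bar> \<le> \<bar>Im c\<bar> + \<alpha> * Y \<Longrightarrow>
       norm (Gamma u) \<le> exp (stirling_exponent (Re u) + K * ln (Re u)) \<and>
       exp (stirling_exponent (Re u) - K * ln (Re u)) \<le> norm (Gamma u)"
    using Gamma_vertical_strip_bounds by metis
  define r where "r = Re c"
  define C where "C = \<bar>r\<bar> + 1"
  have C: "C > r" "- C < r" by (auto simp: C_def)
  have "eventually (\<lambda>x. stirling_exponent (r + \<alpha> * x) \<le> stirling_exponent (\<alpha> * x) + C * ln x) at_top"
    unfolding stirling_exponent_def using C \<alpha> by real_asymp
  moreover have "eventually (\<lambda>x. stirling_exponent (\<alpha> * x) - C * ln x \<le> stirling_exponent (r + \<alpha> * x)) at_top"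
    unfolding stirling_exponent_def using C \<alpha> by real_asymp
  moreover have "eventually (\<lambda>x. ln (r + \<alpha> * x) \<le> 2 * ln x) at_top"
    using \<alpha> by real_asymp
  moreover have "eventually (\<lambda>x. r + \<alpha> * x \<ge> X) at_top"
    using \<alpha> by real_asymp
  ultimately have "eventually (\<lambda>x. stirling_exponent (r + \<alpha> * x) \<le> stirling_exponent (\<alpha> * x) + C * ln x \<and>
     stirling_exponent (\<alpha> * x) - C * ln x \<le> stirling_exponent (r + \<alpha> * x) \<and>
     ln (r + \<alpha> * x) \<le> 2 * ln x \<and> r + \<alpha> * x \<ge> X) at_top" (is "eventually ?Q at_top")
    by (auto simp: eventually_conj_iff)
  from eventually_left_end_at_top[OF this, of S] eventually_left_end_mem[of S]
  have "eventually (\<lambda>s. norm (Gamma (c - of_real \<alpha> * s)) \<le> exp (stirling_exponent (\<alpha> * (- Re s)) + (C + 2*K) * ln (- Re s)) \<and>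
       exp (stirling_exponent (\<alpha> * (- Re s)) - (C + 2*K) * ln (- Re s)) \<le> norm (Gamma (c - of_real \<alpha> * s))) (left_end S)"
  proof eventually_elim
    case (elim s)
    define u where "u = c - of_real \<alpha> * s"
    have Re: "Re u = r + \<alpha> * (- Re s)" by (simp add: u_def r_def)
    have "\<bar>Im u\<bar> \<le> \<bar>Im c\<bar> + \<bar>\<alpha> * Im s\<bar>" by (simp add: u_def)
    also have "\<bar>\<alpha> * Im s\<bar> \<le> \<alpha> * Y" using \<alpha> S[OF elim(2)] by (simp add: abs_mult)
    finally have Im: "\<bar>Im u\<bar> \<le> \<bar>Im c\<bar> + \<alpha> * Y" by simp
    have "K * ln (Re u) \<le> K * (2 * ln (- Re s))"
      using elim K unfolding Re by (intro mult_left_mono) auto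
    then have *: "stirling_exponent (Re u) + K * ln (Re u) \<le> stirling_exponent (\<alpha> * (- Re s)) + (C + 2*K) * ln (- Re s)"
       "stirling_exponent (\<alpha> * (- Re s)) - (C + 2*K) * ln (- Re s) \<le> stirling_exponent (Re u) - K * ln (Re u)"
      using elim unfolding Re by (auto simp: algebra_simps)
    have "X \<le> Re u" using elim Re by simp
    note ** = X[OF this Im]
    show ?case unfolding u_def[symmetric]
      using ** * by (meson exp_le_cancel_iff order_trans)
  qed
  then show ?thesis by (rule that)
qed

lemma stirling_bound_Gamma:
  assumes "\<alpha> > 0" "\<And>s. s \<in> S \<Longrightarrow> \<bar>Im s\<bar> \<le> Y"
  shows "stirling_bound S (\<lambda>x. stirling_exponent (\<alpha> * x)) (\<lambda>s. Gamma (c - of_real \<alpha> * s))"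
proof -
  obtain K where "eventually (\<lambda>s. norm (Gamma (c - of_real \<alpha> * s)) \<le> exp (stirling_exponent (\<alpha> * (- Re s)) + K * ln (- Re s)) \<and>
       exp (stirling_exponent (\<alpha> * (- Re s)) - K * ln (- Re s)) \<le> norm (Gamma (c - of_real \<alpha> * s))) (left_end S)"
    using Gamma_strip_bounds[OF assms] by blast
  then show ?thesis unfolding stirling_bound_def
    by (intro exI[of _ K]) (auto elim: eventually_mono)
qed

lemma stirling_bound_rGamma:
  assumes "\<alpha> > 0" "\<And>s. s \<in> S \<Longrightarrow> \<bar>Im s\<bar> \<le> Y"
  shows "stirling_bound S (\<lambda>x. - stirling_exponent (\<alpha> * x)) (\<lambda>s. rGamma (c - of_real \<alpha> * s))"
proof -
  obtain K where "eventually (\<lambda>s. norm (Gamma (c - of_real \<alpha> * s)) \<le> exp (stirling_exponent (\<alpha> * (- Re s)) + K * ln (- Re s)) \<and>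
       exp (stirling_exponent (\<alpha> * (- Re s)) - K * ln (- Re s)) \<le> norm (Gamma (c - of_real \<alpha> * s))) (left_end S)"
    using Gamma_strip_bounds[OF assms] by blast
  then have "eventually (\<lambda>s. norm (rGamma (c - of_real \<alpha> * s)) \<le> exp (- stirling_exponent (\<alpha> * (- Re s)) + K * ln (- Re s))) (left_end S)"
  proof eventually_elim
    case (elim s)
    have "norm (rGamma (c - of_real \<alpha> * s)) = inverse (norm (Gamma (c - of_real \<alpha> * s)))"
      by (simp add: rGamma_inverse_Gamma norm_inverse)
    also have "\<dots> \<le> inverse (exp (stirling_exponent (\<alpha> * (- Re s)) - K * ln (- Re s)))"
      using elim by (intro le_imp_inverse_le) auto
    also have "\<dots> = exp (- stirling_exponent (\<alpha> * (- Re s)) + K * ln (- Re s))"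
      by (simp add: exp_minus[symmetric])
    finally show ?case .
  qed
  then show ?thesis unfolding stirling_bound_def by blast
qed

section \<open>Trigonometric factors of the reflection formula\<close>

lemma norm_sin_le:
  fixes z :: complex
  shows "norm (sin z) \<le> exp \<bar>Im z\<bar>"
proof -
  have "norm (sin z) = norm (exp (\<i> * z) - exp (- (\<i> * z))) / 2"
    by (simp add: sin_exp_eq norm_divide norm_mult)
  also have "\<dots> \<le> (exp (- Im z) + exp (Im z)) / 2"
    using norm_triangle_ineq4[of "exp (\<i> * z)" "exp (- (\<i> * z))"] by simp
  also have "\<dots> \<le> (exp \<bar>Im z\<bar> + exp \<bar>Im z\<bar>) / 2"
    by (intro divide_right_mono add_mono) auto
  finally show ?thesis by simp
qed

text \<open>An integer shift of u changes \<open>sin (pi * u)\<close> by a sign at most. It is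
  therefore enough to bound the reciprocal over one period, on a compact rectangle from which discs
  about the zeros 0 and 1 are removed.\<close>

lemma inverse_sin_pi_bounded:
  fixes Y \<epsilon> :: real
  assumes "\<epsilon> > 0"
  obtains B where "\<And>u::complex. \<bar>Im u\<bar> \<le> Y \<Longrightarrow> (\<And>k::int. \<epsilon> \<le> norm (u - of_int k)) \<Longrightarrow>
    norm (inverse (sin (of_real pi * u))) \<le> B"
proof -
  define S where "S = cbox (Complex 0 (-Y)) (Complex 1 Y) \<inter> - ball 0 \<epsilon> \<inter> - ball 1 \<epsilon>"
  have "compact S" unfolding S_def by (intro compact_Int_closed) (auto simp: closed_Compl)
  have nz: "sin (of_real pi * u) \<noteq> 0" if "u \<in> S" for u :: complex
  proof
    assume "sin (of_real pi * u) = 0"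
    then obtain k :: int where "of_real pi * u = of_int k * of_real pi"
      by (auto simp: Complex_Transcendental.sin_eq_0)
    then have k: "u = of_int k" by simp
    then have "k = 0 \<or> k = 1" using that by (auto simp: S_def in_cbox_complex_iff)
    then show False using that k \<open>\<epsilon> > 0\<close> by (auto simp: S_def)
  qed
  have "continuous_on S (\<lambda>u::complex. inverse (sin (of_real pi * u)))"
    using nz by (intro continuous_intros) auto
  then have "bounded ((\<lambda>u::complex. inverse (sin (of_real pi * u))) ` S)"
    by (intro compact_imp_bounded compact_continuous_image \<open>compact S\<close>)
  then obtain B where B: "\<And>u. u \<in> S \<Longrightarrow> norm (inverse (sin (of_real pi * u))) \<le> B"
    by (auto simp: bounded_iff)
  show ?thesis
  proof (rule that[of B])
    fix u :: complex
    assume u: "\<bar>Im u\<bar> \<le> Y" "\<And>k::int. \<epsilon> \<le> norm (u - of_int k)"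
    define k where "k = \<lfloor>Re u\<rfloor>"
    define v where "v = u - of_int k"
    have "0 \<le> Re v" "Re v \<le> 1" unfolding v_def k_def by (simp_all, linarith+)
    moreover have "\<bar>Im v\<bar> \<le> Y" using u(1) by (simp add: v_def)
    moreover have "\<epsilon> \<le> norm (v - 0)" "\<epsilon> \<le> norm (v - 1)"
      using u(2)[of k] u(2)[of "k+1"] by (auto simp: v_def algebra_simps)
    ultimately have "v \<in> S"
      by (auto simp: S_def in_cbox_complex_iff dist_norm norm_minus_commute)
    have "sin (of_real pi * u) = sin (of_real pi * v + of_int k * of_real pi)"
      by (simp add: v_def algebra_simps)
    also have "\<dots> = sin (of_real pi * v) * cos (of_int k * of_real pi)"
    proof -
      have "sin (of_int k * of_real pi :: complex) = 0"
        unfolding Complex_Transcendental.sin_eq_0 by (intro exI[of _ k]) simp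
      then show ?thesis by (simp add: sin_add)
    qed
    finally have "norm (sin (of_real pi * u)) = norm (sin (of_real pi * v)) * norm (cos (of_int k * of_real pi :: complex))"
      by (simp add: norm_mult)
    moreover have "norm (cos (of_int k * of_real pi :: complex)) = 1"
    proof -
      have "sin (of_int k * of_real pi :: complex) = 0"
        unfolding Complex_Transcendental.sin_eq_0 by (intro exI[of _ k]) simp
      then have "cos (of_int k * of_real pi :: complex) ^ 2 = 1"
        using sin_cos_squared_add[of "of_int k * of_real pi :: complex"] by simp
      then have "norm (cos (of_int k * of_real pi :: complex)) ^ 2 = 1"
        by (metis norm_one norm_power)
      then show ?thesis
        using norm_ge_zero[of "cos (of_int k * of_real pi :: complex)"]
        unfolding power2_eq_1_iff by linarith
    qed
    ultimately have "norm (inverse (sin (of_real pi * u))) = norm (inverse (sin (of_real pi * v)))"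
      by (simp add: norm_inverse)
    also have "\<dots> \<le> B" by (rule B[OF \<open>v \<in> S\<close>])
    finally show "norm (inverse (sin (of_real pi * u))) \<le> B" .
  qed
qed


lemma Re_pos_not_nonpos_Ints: "0 < Re z \<Longrightarrow> z \<notin> \<int>\<^sub>\<le>\<^sub>0"
  by (auto elim!: nonpos_Ints_cases)

lemma stirling_bound_cong:
  assumes "stirling_bound S h g" "eventually (\<lambda>s. f s = g s) (left_end S)"
  shows "stirling_bound S h f"
proof -
  obtain K where "eventually (\<lambda>s. norm (g s) \<le> exp (h (- Re s) + K * ln (- Re s))) (left_end S)"
    using assms(1) unfolding stirling_bound_def by blast
  with assms(2) have "eventually (\<lambda>s. norm (f s) \<le> exp (h (- Re s) + K * ln (- Re s))) (left_end S)"
    by eventually_elim simp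
  then show ?thesis unfolding stirling_bound_def by blast
qed

section \<open>Estimates for the factors of the kernel\<close>

locale fox =
  fixes m n p q :: nat and a b :: "nat \<Rightarrow> complex" and \<alpha> \<beta> :: "nat \<Rightarrow> real"
  assumes m_le: "m \<le> q" and n_le: "n \<le> p"
    and alpha_pos: "\<And>i. i \<in> {1..p} \<Longrightarrow> \<alpha> i > 0"
    and beta_pos: "\<And>j. j \<in> {1..q} \<Longrightarrow> \<beta> j > 0"
begin

abbreviation kernel :: "complex \<Rightarrow> complex" where
  "kernel \<equiv> fox_kernel m n p q a \<alpha> b \<beta>"

abbreviation pole :: "nat \<Rightarrow> nat \<Rightarrow> complex" where
  "pole \<equiv> fox_pole_b b \<beta>"

text \<open>Only the rows of poles that run to the left are cut out. The poles of the factors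
  \<open>Gamma (1 - a i - \<alpha> i * s)\<close> run to the right and are left behind as
  \<open>Re s\<close> tends to minus infinity.\<close>

definition strip_off_poles :: "real \<Rightarrow> real \<Rightarrow> complex set" where
  "strip_off_poles Y \<epsilon> =
     {s. \<bar>Im s\<bar> \<le> Y \<and> (\<forall>j\<in>{1..m}. \<forall>l. \<epsilon> \<le> dist s (pole j l))}"

text \<open>The condition of part (A) on z in terms of \<rho> = ln |z|. In this form it also applies
  to a \<rho> slightly above ln |z|, and that excess becomes the rate of decay.\<close>

definition admissible :: "real \<Rightarrow> bool" where
  "admissible \<rho> \<longleftrightarrow> fox_Delta p q \<alpha> \<beta> > 0 \<or>
     fox_Delta p q \<alpha> \<beta> = 0 \<and> \<rho> < ln (fox_delta p q \<alpha> \<beta>)"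

lemma strip_Im: "s \<in> strip_off_poles Y \<epsilon> \<Longrightarrow> \<bar>Im s\<bar> \<le> Y"
  by (simp add: strip_off_poles_def)

lemma pole_affine:
  assumes "j \<in> {1..m}"
  shows "b j + of_real (\<beta> j) * s + of_nat l = of_real (\<beta> j) * (s - pole j l)"
proof -
  have "\<beta> j > 0" using assms m_le by (intro beta_pos) auto
  then show ?thesis by (simp add: fox_pole_b_def field_simps)
qed

text \<open>This factor has poles arbitrarily far to the left. It is replaced by
  \<open>pi / sin (pi * u) * rGamma (1 - u)\<close>, where the sine is bounded away from 0 because u
  keeps away from all integers.\<close>

lemma stirling_bound_Gamma_b:
  assumes j: "j \<in> {1..m}" and \<epsilon>: "\<epsilon> > 0"
  shows "stirling_bound (strip_off_poles Y \<epsilon>) (\<lambda>x. - stirling_exponent (\<beta> j * x))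
    (\<lambda>s. Gamma (b j + of_real (\<beta> j) * s))"
proof -
  define S where "S = strip_off_poles Y \<epsilon>"
  have \<beta>: "\<beta> j > 0" using j m_le by (intro beta_pos) auto
  define u where "u s = b j + of_real (\<beta> j) * s" for s :: complex
  \<comment> \<open>The distance from s to a pole is scaled by \<open>\<beta> j\<close> when passing
    to u, which handles the integers up to 0. The positive integers are at distance at least 1 once
    \<open>Re u \<le> 0\<close>.\<close>
  define \<eta> where "\<eta> = min 1 (\<beta> j * \<epsilon>)"
  have \<eta>: "\<eta> > 0" using \<beta> \<epsilon> by (simp add: \<eta>_def)
  obtain B where B: "\<And>u::complex. \<bar>Im u\<bar> \<le> \<bar>Im (b j)\<bar> + \<beta> j * Y \<Longrightarrow>
      (\<And>k::int. \<eta> \<le> norm (u - of_int k)) \<Longrightarrow> norm (inverse (sin (of_real pi * u))) \<le> B"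
    using inverse_sin_pi_bounded[OF \<eta>] by blast
  have "eventually (\<lambda>x. Re (b j) - \<beta> j * x \<le> 0) at_top" using \<beta> by real_asymp
  from eventually_left_end_at_top[OF this, of S] eventually_left_end_mem[of S]
  have far: "eventually (\<lambda>s. s \<in> S \<and> (\<forall>k::int. \<eta> \<le> norm (u s - of_int k))) (left_end S)"
  proof eventually_elim
    case (elim s)
    have "\<eta> \<le> norm (u s - of_int k)" for k :: int
    proof (cases "k \<ge> 1")
      case True
      have "1 \<le> \<bar>Re (u s - of_int k)\<bar>" using elim(1) True by (simp add: u_def)
      also have "\<dots> \<le> norm (u s - of_int k)" by (rule abs_Re_le_cmod)
      finally show ?thesis by (simp add: \<eta>_def)
    next
      case False
      define l where "l = nat (- k)"
      have "u s - of_int k = u s + of_nat l" using False by (simp add: l_def)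
      also have "\<dots> = of_real (\<beta> j) * (s - pole j l)" unfolding u_def by (rule pole_affine[OF j])
      finally have "norm (u s - of_int k) = \<beta> j * dist s (pole j l)"
        using \<beta> by (simp add: norm_mult dist_norm)
      moreover have "\<beta> j * \<epsilon> \<le> \<beta> j * dist s (pole j l)"
        using elim(2) j \<beta> by (intro mult_left_mono) (auto simp: S_def strip_off_poles_def)
      ultimately show ?thesis by (simp add: \<eta>_def)
    qed
    then show ?case using elim(2) by simp
  qed
  have "eventually (\<lambda>s. norm (of_real pi * inverse (sin (of_real pi * u s))) \<le> pi * B) (left_end S)"
    using far
  proof eventually_elim
    case (elim s)
    have "\<bar>Im (u s)\<bar> \<le> \<bar>Im (b j)\<bar> + \<bar>\<beta> j * Im s\<bar>" by (simp add: u_def)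
    also have "\<bar>\<beta> j * Im s\<bar> \<le> \<beta> j * Y"
      using elim \<beta> strip_Im by (auto simp: S_def abs_mult)
    finally have "norm (inverse (sin (of_real pi * u s))) \<le> B" using elim by (intro B) auto
    then show ?case by (simp add: norm_mult)
  qed
  then have "stirling_bound S (\<lambda>x. 0) (\<lambda>s. of_real pi * inverse (sin (of_real pi * u s)))"
    by (rule stirling_bound_bounded)
  moreover have "stirling_bound S (\<lambda>x. - stirling_exponent (\<beta> j * x)) (\<lambda>s. rGamma ((1 - b j) - of_real (\<beta> j) * s))"
    by (rule stirling_bound_rGamma[OF \<beta>, where Y = Y]) (auto simp: S_def strip_Im)
  ultimately have bound: "stirling_bound S (\<lambda>x. 0 + - stirling_exponent (\<beta> j * x))
     (\<lambda>s. of_real pi * inverse (sin (of_real pi * u s)) * rGamma ((1 - b j) - of_real (\<beta> j) * s))"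
    by (rule stirling_bound_mult)
  have reflect: "eventually (\<lambda>s. Gamma (u s) =
     of_real pi * inverse (sin (of_real pi * u s)) * rGamma ((1 - b j) - of_real (\<beta> j) * s)) (left_end S)"
    using far
  proof eventually_elim
    case (elim s)
    have eq: "1 - u s = (1 - b j) - of_real (\<beta> j) * s" by (simp add: u_def)
    have "1 - u s \<notin> \<int>\<^sub>\<le>\<^sub>0"
    proof
      assume "1 - u s \<in> \<int>\<^sub>\<le>\<^sub>0"
      then obtain k :: int where "1 - u s = of_int k" by (auto elim!: nonpos_Ints_cases)
      then have "u s = of_int (1 - k)" by (simp add: algebra_simps)
      then show False using elim \<eta> by (metis diff_self leD norm_zero)
    qed
    then have "Gamma (1 - u s) \<noteq> 0" by (simp add: Gamma_eq_zero_iff)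
    then have "Gamma (u s) = Gamma (u s) * Gamma (1 - u s) * rGamma (1 - u s)"
      by (simp add: rGamma_inverse_Gamma)
    also have "\<dots> = of_real pi / sin (of_real pi * u s) * rGamma (1 - u s)"
      by (simp only: Gamma_reflection_complex)
    finally show ?case unfolding eq by (simp only: divide_inverse)
  qed
  show ?thesis using stirling_bound_cong[OF bound reflect] by (simp add: S_def u_def)
qed

text \<open>To the left there are zeros instead of poles, so reflection puts the sine into the
  numerator, where the bounded height of the strip is enough.\<close>

lemma stirling_bound_rGamma_a:
  assumes i: "i \<in> {1..p}"
  shows "stirling_bound (strip_off_poles Y \<epsilon>) (\<lambda>x. stirling_exponent (\<alpha> i * x))
    (\<lambda>s. rGamma (a i + of_real (\<alpha> i) * s))"
proof -
  define S where "S = strip_off_poles Y \<epsilon>"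
  have \<alpha>: "\<alpha> i > 0" using i by (rule alpha_pos)
  define u where "u s = a i + of_real (\<alpha> i) * s" for s :: complex
  have "eventually (\<lambda>s. norm (sin (of_real pi * u s) / of_real pi) \<le> exp (pi * (\<bar>Im (a i)\<bar> + \<alpha> i * Y)) / pi) (left_end S)"
    using eventually_left_end_mem[of S]
  proof eventually_elim
    case (elim s)
    have "\<bar>Im (u s)\<bar> \<le> \<bar>Im (a i)\<bar> + \<bar>\<alpha> i * Im s\<bar>" by (simp add: u_def)
    also have "\<bar>\<alpha> i * Im s\<bar> \<le> \<alpha> i * Y"
      using elim \<alpha> strip_Im by (auto simp: S_def abs_mult)
    finally have "norm (sin (of_real pi * u s)) \<le> exp (pi * (\<bar>Im (a i)\<bar> + \<alpha> i * Y))"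
      by (intro order_trans[OF norm_sin_le]) (simp add: abs_mult)
    then show ?case by (simp add: norm_divide divide_right_mono)
  qed
  then have "stirling_bound S (\<lambda>x. 0) (\<lambda>s. sin (of_real pi * u s) / of_real pi)"
    by (rule stirling_bound_bounded)
  moreover have "stirling_bound S (\<lambda>x. stirling_exponent (\<alpha> i * x)) (\<lambda>s. Gamma ((1 - a i) - of_real (\<alpha> i) * s))"
    by (rule stirling_bound_Gamma[OF \<alpha>, where Y = Y]) (auto simp: S_def strip_Im)
  ultimately have bound: "stirling_bound S (\<lambda>x. 0 + stirling_exponent (\<alpha> i * x))
     (\<lambda>s. sin (of_real pi * u s) / of_real pi * Gamma ((1 - a i) - of_real (\<alpha> i) * s))"
    by (rule stirling_bound_mult)
  have reflect: "eventually (\<lambda>s. rGamma (u s) =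
     sin (of_real pi * u s) / of_real pi * Gamma ((1 - a i) - of_real (\<alpha> i) * s)) (left_end S)"
  proof -
    have "eventually (\<lambda>x. 1 - Re (a i) + \<alpha> i * x > 0) at_top" using \<alpha> by real_asymp
    from eventually_left_end_at_top[OF this, of S] show ?thesis
    proof eventually_elim
      case (elim s)
      have eq: "1 - u s = (1 - a i) - of_real (\<alpha> i) * s" by (simp add: u_def)
      have "Re (1 - u s) > 0" using elim by (simp add: u_def)
      then have "1 - u s \<notin> \<int>\<^sub>\<le>\<^sub>0" by (rule Re_pos_not_nonpos_Ints)
      then have "Gamma (1 - u s) \<noteq> 0" by (simp add: Gamma_eq_zero_iff)
      then have "rGamma (u s) = rGamma (u s) * rGamma (1 - u s) * Gamma (1 - u s)"
        by (simp add: rGamma_inverse_Gamma)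
      also have "\<dots> = sin (of_real pi * u s) / of_real pi * Gamma (1 - u s)"
        by (simp only: rGamma_reflection_complex)
      finally show ?case unfolding eq .
    qed
  qed
  show ?thesis using stirling_bound_cong[OF bound reflect] by (simp add: S_def u_def)
qed

text \<open>This is where \<Delta> and \<delta> enter: \<open>ln (c * x) = ln c + ln x\<close>
  splits each exponent into c times \<open>x * ln x - x\<close>, and the coefficients c add up to
  \<Delta>, and \<open>c * ln c\<close> times x, which adds up to ln \<delta>.\<close>

lemma stirling_exponent_total:
  assumes "x > 0"
  shows "(\<Sum>i=1..p. stirling_exponent (\<alpha> i * x)) - (\<Sum>j=1..q. stirling_exponent (\<beta> j * x)) =
    - fox_Delta p q \<alpha> \<beta> * (x * ln x - x) - x * ln (fox_delta p q \<alpha> \<beta>)"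
proof -
  have E: "stirling_exponent (c * x) = c * (x * ln x - x) + x * (c * ln c)" if "c > 0" for c
    using that assms by (simp add: stirling_exponent_def ln_mult algebra_simps)
  have sum_\<alpha>: "(\<Sum>i=1..p. stirling_exponent (\<alpha> i * x)) = (\<Sum>i=1..p. \<alpha> i) * (x * ln x - x) + x * (\<Sum>i=1..p. \<alpha> i * ln (\<alpha> i))"
    unfolding sum_distrib_left sum_distrib_right sum.distrib[symmetric]
    by (intro sum.cong refl E alpha_pos)
  have sum_\<beta>: "(\<Sum>j=1..q. stirling_exponent (\<beta> j * x)) = (\<Sum>j=1..q. \<beta> j) * (x * ln x - x) + x * (\<Sum>j=1..q. \<beta> j * ln (\<beta> j))"
    unfolding sum_distrib_left sum_distrib_right sum.distrib[symmetric]
    by (intro sum.cong refl E beta_pos)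
  have ln_\<delta>: "ln (fox_delta p q \<alpha> \<beta>) = - (\<Sum>i=1..p. \<alpha> i * ln (\<alpha> i)) + (\<Sum>j=1..q. \<beta> j * ln (\<beta> j))"
  proof -
    have "0 < (\<Prod>i=1..p. \<alpha> i powr (- \<alpha> i))" "0 < (\<Prod>j=1..q. \<beta> j powr \<beta> j)"
      using alpha_pos beta_pos by (auto intro!: prod_pos simp: less_imp_neq[symmetric])
    moreover have "ln (\<Prod>i=1..p. \<alpha> i powr (- \<alpha> i)) = (\<Sum>i=1..p. - (\<alpha> i * ln (\<alpha> i)))"
      using alpha_pos by (subst ln_prod) (auto simp: less_imp_neq[symmetric] ln_powr intro!: sum.cong)
    moreover have "ln (\<Prod>j=1..q. \<beta> j powr \<beta> j) = (\<Sum>j=1..q. \<beta> j * ln (\<beta> j))"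
      using beta_pos by (subst ln_prod) (auto simp: less_imp_neq[symmetric] ln_powr intro!: sum.cong)
    ultimately show ?thesis unfolding fox_delta_def by (subst ln_mult_pos) (simp_all only: sum_negf)
  qed
  show ?thesis
    unfolding fox_Delta_def sum_\<alpha> sum_\<beta> ln_\<delta>
    by (simp add: algebra_simps)
qed

text \<open>Far to the left every \<alpha> contributes with a plus sign and every \<beta> with a
  minus sign, whether its Gamma factor stands in the numerator or in the denominator. The cuts at n
  and m thus disappear from the total exponent.\<close>

proposition kernel_bound:
  assumes "admissible \<rho>" "\<epsilon> > 0"
  shows "eventually (\<lambda>s. norm (kernel s) \<le> exp (\<rho> * Re s)) (left_end (strip_off_poles Y \<epsilon>))"
proof -
  define S where "S = strip_off_poles Y \<epsilon>"
  define \<Delta> where "\<Delta> = fox_Delta p q \<alpha> \<beta>"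
  define L where "L = ln (fox_delta p q \<alpha> \<beta>)"
  have "stirling_bound S (\<lambda>x. (\<Sum>j=1..m. - stirling_exponent (\<beta> j * x)) +
     (\<Sum>i=1..n. stirling_exponent (\<alpha> i * x)) + (\<Sum>i=n+1..p. stirling_exponent (\<alpha> i * x)) +
     (\<Sum>j=m+1..q. - stirling_exponent (\<beta> j * x))) kernel"
    unfolding fox_kernel_def
    using m_le n_le alpha_pos beta_pos \<open>\<epsilon> > 0\<close>
    by (intro stirling_bound_mult stirling_bound_prod stirling_bound_Gamma_b stirling_bound_rGamma_a
          stirling_bound_Gamma stirling_bound_rGamma[where Y = Y] stirling_bound_Gamma[where Y = Y])
       (auto simp: S_def strip_Im intro!: stirling_bound_Gamma_b stirling_bound_rGamma_a)
  then obtain K where K: "eventually (\<lambda>s. norm (kernel s) \<le> exp ((\<Sum>j=1..m. - stirling_exponent (\<beta> j * (- Re s))) +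
     (\<Sum>i=1..n. stirling_exponent (\<alpha> i * (- Re s))) + (\<Sum>i=n+1..p. stirling_exponent (\<alpha> i * (- Re s))) +
     (\<Sum>j=m+1..q. - stirling_exponent (\<beta> j * (- Re s))) + K * ln (- Re s))) (left_end S)"
    unfolding stirling_bound_def by blast
  have split: "(\<Sum>i=1..n. f i) + (\<Sum>i=n+1..p. f i) = (\<Sum>i=1..p. f i)"
     "(\<Sum>j=1..m. f j) + (\<Sum>j=m+1..q. f j) = (\<Sum>j=1..q. f j)" for f :: "nat \<Rightarrow> real"
    using m_le n_le sum.ub_add_nat[of 1 n f "p - n"] sum.ub_add_nat[of 1 m f "q - m"] by auto
  have "eventually (\<lambda>x. - \<Delta> * (x * ln x - x) - x * L + K * ln x \<le> - \<rho> * x) at_top"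
  proof (cases "\<Delta> > 0")
    case True
    then show ?thesis by real_asymp
  next
    case False
    then have "\<Delta> = 0" "\<rho> < L" using assms by (auto simp: admissible_def \<Delta>_def L_def)
    then have "eventually (\<lambda>x. - x * L + K * ln x \<le> - \<rho> * x) at_top" by real_asymp
    then show ?thesis using \<open>\<Delta> = 0\<close> by simp
  qed
  from eventually_left_end_at_top[OF this, of S] eventually_left_end_at_top[OF eventually_gt_at_top[of 0], of S] K
  show ?thesis unfolding S_def[symmetric]
  proof eventually_elim
    case (elim s)
    have "(\<Sum>j=1..m. - stirling_exponent (\<beta> j * (- Re s))) +
     (\<Sum>i=1..n. stirling_exponent (\<alpha> i * (- Re s))) + (\<Sum>i=n+1..p. stirling_exponent (\<alpha> i * (- Re s))) +
     (\<Sum>j=m+1..q. - stirling_exponent (\<beta> j * (- Re s))) + K * ln (- Re s)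
     = (\<Sum>i=1..p. stirling_exponent (\<alpha> i * (- Re s))) - (\<Sum>j=1..q. stirling_exponent (\<beta> j * (- Re s))) + K * ln (- Re s)"
      unfolding split[symmetric] sum_negf by linarith
    also have "\<dots> \<le> \<rho> * Re s"
      using elim(1) unfolding stirling_exponent_total[OF elim(2)] \<Delta>_def L_def by simp
    finally show ?case using elim(3) by (meson exp_le_cancel_iff order_trans)
  qed
qed

end

section \<open>Loops and their winding numbers\<close>

lemma has_integral_reflect_UNIV:
  fixes f :: "real \<Rightarrow> 'a::banach"
  assumes "(f has_integral I) UNIV"
  shows "((\<lambda>x. f (- x)) has_integral I) UNIV"
proof -
  have A: "\<And>a b. f integrable_on cbox a b"
    and lim: "\<And>e. e > 0 \<Longrightarrow> \<exists>B>0. \<forall>a b. ball 0 B \<subseteq> cbox a b \<longrightarrow> norm (integral (cbox a b) f - I) < e"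
    using assms unfolding has_integral_alt'[of f] by auto
  have "(\<lambda>x. f (- x)) integrable_on cbox a b" for a b :: real
    using integrable_reflect[of f "-a" "-b"] A[of "-b" "-a"] by (simp del: integrable_reflect integrable_reflect_real)
  moreover have "\<exists>B>0. \<forall>a b. ball 0 B \<subseteq> cbox a b \<longrightarrow> norm (integral (cbox a b) (\<lambda>x. f (- x)) - I) < e"
    if "e > 0" for e
  proof -
    obtain B where B: "B > 0" "\<And>a b. ball 0 B \<subseteq> cbox a b \<Longrightarrow> norm (integral (cbox a b) f - I) < e"
      using lim[OF \<open>e > 0\<close>] by blast
    have "norm (integral (cbox a b) (\<lambda>x. f (- x)) - I) < e" if ab: "ball 0 B \<subseteq> cbox a b" for a b :: real
    proof -
      have "ball 0 B \<subseteq> cbox (-b) (-a)"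
      proof
        fix x :: real assume "x \<in> ball 0 B"
        then have "- x \<in> ball 0 B" by simp
        then have "- x \<in> cbox a b" using ab by blast
        then show "x \<in> cbox (-b) (-a)" by auto
      qed
      moreover have "integral (cbox a b) (\<lambda>x. f (- x)) = integral (cbox (-b) (-a)) f"
        using integral_reflect[of "-a" "-b" f] by (simp only: minus_minus)
      ultimately show ?thesis using B(2)[of "-b" "-a"] by simp
    qed
    then show ?thesis using B(1) by blast
  qed
  ultimately show ?thesis unfolding has_integral_alt'[of "\<lambda>x. f (- x)"] by auto
qed

lemma has_integral_reflect_set:
  fixes f :: "real \<Rightarrow> 'a::banach"
  assumes "(f has_integral I) S"
  shows "((\<lambda>x. f (- x)) has_integral I) {x. - x \<in> S}"
proof -
  have "((\<lambda>x. if x \<in> S then f x else 0) has_integral I) UNIV"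
    using assms by (simp add: has_integral_restrict_UNIV)
  from has_integral_reflect_UNIV[OF this]
  have "((\<lambda>x. if x \<in> {x. - x \<in> S} then f (- x) else 0) has_integral I) UNIV" by simp
  then show ?thesis by (simp only: has_integral_restrict_UNIV)
qed

lemma has_integral_exp_to_minus_infinity:
  assumes "\<kappa> > (0::real)"
  shows "((\<lambda>x. exp (\<kappa> * x)) has_integral exp (\<kappa> * X) / \<kappa>) {..X}"
proof -
  have "((\<lambda>x. exp (- \<kappa> * (- x))) has_integral exp (- \<kappa> * (- X)) / \<kappa>) {x. - x \<in> {- X..}}"
    by (rule has_integral_reflect_set[OF has_integral_exp_minus_to_infinity[OF assms]])
  moreover have "{x. - x \<in> {- X..}} = {..X}" by auto
  ultimately show ?thesis by simp
qed

text \<open>The error of the truncation depends on f only through C and \<kappa>. Integrands with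
  common constants are therefore approximated uniformly, as is needed for holomorphy in w.\<close>

lemma exp_dominated_tail:
  fixes f :: "real \<Rightarrow> complex"
  assumes f: "continuous_on {..c} f" and \<kappa>: "\<kappa> > 0" and X: "X \<le> c"
    and bound: "\<And>x. x \<le> X \<Longrightarrow> norm (f x) \<le> C * exp (\<kappa> * x)"
  shows "f integrable_on {..c}"
    and "\<And>R. - R \<le> X \<Longrightarrow> norm (integral {..c} f - integral {-R..c} f) \<le> C * exp (- \<kappa> * R) / \<kappa>"
proof -
  have g: "((\<lambda>x. C * exp (\<kappa> * x)) has_integral C * (exp (\<kappa> * y) / \<kappa>)) {..y}" for y
    by (intro has_integral_mult_right has_integral_exp_to_minus_infinity \<kappa>)
  have tail: "f integrable_on {..y}" if "y \<le> X" for y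
  proof (rule measurable_bounded_by_integrable_imp_integrable)
    show "f \<in> borel_measurable (lebesgue_on {..y})"
      using f that X by (intro continuous_imp_measurable_on_sets_lebesgue) (auto intro: continuous_on_subset)
    show "(\<lambda>x. C * exp (\<kappa> * x)) integrable_on {..y}" using g by blast
  qed (use bound that in auto)
  have mid: "f integrable_on {y..c}" if "y \<le> X" for y
    using f by (intro integrable_continuous_real) (auto intro: continuous_on_subset)
  have joined: "(f has_integral integral {..y} f + integral {y..c} f) {..c}" if "y \<le> X" for y
  proof -
    have "{..y} \<inter> {y..c} = {y}" using that X by auto
    then have "(f has_integral integral {..y} f + integral {y..c} f) ({..y} \<union> {y..c})"
      using tail[OF that] mid[OF that] by (intro has_integral_Un) (simp_all only: integrable_integral negligible_sing)
    moreover have "{..y} \<union> {y..c} = {..c}" using that X by auto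
    ultimately show ?thesis by simp
  qed
  then show "f integrable_on {..c}" by blast
  fix R assume R: "- R \<le> X"
  have "integral {..c} f - integral {-R..c} f = integral {..-R} f"
    using joined[OF R] by (simp add: integral_unique)
  also have "norm \<dots> \<le> integral {..-R} (\<lambda>x. C * exp (\<kappa> * x))"
    using g by (intro integral_norm_bound_integral tail[OF R]) (use R bound in auto)
  also have "\<dots> = C * exp (- \<kappa> * R) / \<kappa>" using integral_unique[OF g[of "-R"]] by simp
  finally show "norm (integral {..c} f - integral {-R..c} f) \<le> C * exp (- \<kappa> * R) / \<kappa>" .
qed

lemma contour_integral_linepath_horizontal:
  assumes "a < b"
  shows "contour_integral (linepath (Complex a y) (Complex b y)) f = integral {a..b} (\<lambda>x. f (Complex x y))"
proof -
  have eq: "contour_integral (linepath (Complex a y) (Complex b y)) f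
      = contour_integral (linepath (of_real a) (of_real b)) (\<lambda>s. f (s + \<i> * of_real y))"
  proof -
    have "linepath (Complex a y) (Complex b y) x = linepath (of_real a) (of_real b) x + \<i> * of_real y" for x
      by (simp add: linepath_def complex_eq_iff algebra_simps)
    moreover have "Complex b y - Complex a y = of_real b - of_real a"
      by (simp add: complex_eq_iff)
    ultimately show ?thesis by (simp add: contour_integral_integral)
  qed
  also have "\<dots> = integral {a..b} (\<lambda>x. f (of_real x + \<i> * of_real y))"
    using assms by (subst contour_integral_linepath_Reals_eq) auto
  also have "(\<lambda>x. f (of_real x + \<i> * of_real y)) = (\<lambda>x. f (Complex x y))"
    by (simp add: Complex_eq)
  finally show ?thesis .
qed

section \<open>Truncated loops and winding numbers\<close>

locale left_loop =
  fixes \<phi>1 \<phi>2 c :: real and g :: "real \<Rightarrow> complex"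
  assumes link: "loop_link \<phi>1 \<phi>2 c g"
begin

lemma heights: "\<phi>1 < \<phi>2"
  and valid_g: "valid_path g"
  and start_g [simp]: "pathstart g = Complex c \<phi>1"
  and finish_g [simp]: "pathfinish g = Complex c \<phi>2"
  using link by (auto simp: loop_link_def)

definition truncated_loop :: "real \<Rightarrow> real \<Rightarrow> complex" where
  "truncated_loop R = linepath (Complex (- R) \<phi>1) (Complex c \<phi>1) +++ g +++ linepath (Complex c \<phi>2) (Complex (- R) \<phi>2)"

definition closed_loop :: "real \<Rightarrow> real \<Rightarrow> complex" where
  "closed_loop R = truncated_loop R +++ linepath (Complex (- R) \<phi>2) (Complex (- R) \<phi>1)"

abbreviation L :: "complex set" where
  "L \<equiv> left_loop_image \<phi>1 \<phi>2 c g"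

lemma ends_truncated [simp]: "pathstart (truncated_loop R) = Complex (- R) \<phi>1"
    "pathfinish (truncated_loop R) = Complex (- R) \<phi>2"
  by (simp_all add: truncated_loop_def)

lemma valid_truncated [simp]: "valid_path (truncated_loop R)"
  using valid_g by (auto simp: truncated_loop_def intro!: valid_path_join)

lemma valid_closed [simp]: "valid_path (closed_loop R)"
  by (auto simp: closed_loop_def intro!: valid_path_join)

lemma ends_closed [simp]: "pathstart (closed_loop R) = Complex (- R) \<phi>1"
    "pathfinish (closed_loop R) = Complex (- R) \<phi>1"
  by (simp_all add: closed_loop_def)

lemma path_image_truncated:
  assumes "- R \<le> c"
  shows "path_image (truncated_loop R) = {s. Im s \<in> {\<phi>1, \<phi>2} \<and> - R \<le> Re s \<and> Re s \<le> c} \<union> path_image g"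
  using assms
  by (auto simp: truncated_loop_def path_image_join closed_segment_same_Im closed_segment_eq_real_ivl)

lemma path_image_closed:
  assumes "- R \<le> c"
  shows "path_image (closed_loop R) = {s. Im s \<in> {\<phi>1, \<phi>2} \<and> - R \<le> Re s \<and> Re s \<le> c} \<union> path_image g \<union>
     {s. Re s = - R \<and> \<phi>1 \<le> Im s \<and> Im s \<le> \<phi>2}"
  using path_image_truncated[OF assms] heights
  by (auto simp: closed_loop_def path_image_join closed_segment_same_Re closed_segment_eq_real_ivl)

lemma path_image_truncated_subset: "- R \<le> c \<Longrightarrow> path_image (truncated_loop R) \<subseteq> L"
  by (auto simp: path_image_truncated left_loop_image_def)

lemma closed_L: "closed L"
proof -
  have "{s. Im s \<in> {\<phi>1, \<phi>2} \<and> Re s \<le> c} = ({s. Im s = \<phi>1} \<union> {s. Im s = \<phi>2}) \<inter> {s. Re s \<le> c}"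
    by auto
  also have "closed \<dots>"
    by (intro closed_Int closed_Un closed_halfspace_Im_eq closed_halfspace_Re_le)
  finally show ?thesis unfolding left_loop_image_def
    using valid_g by (intro closed_Un) (auto simp: closed_path_image valid_path_imp_path)
qed

text \<open>The vertical side at - R occurs in the shorter loop and in the rectangle with opposite
  orientations and cancels. What remains of the rectangle prolongs the half-lines. The computation
  uses that winding numbers of open pieces are additive under joining.\<close>

lemma winding_closed_loop_extend:
  assumes R: "R \<le> R'" "- R \<le> c" and z: "z \<notin> L" "Re z \<noteq> - R" "Re z \<noteq> - R'"
  shows "winding_number (closed_loop R') z = winding_number (closed_loop R) z +
     winding_number (rectpath (Complex (- R') \<phi>1) (Complex (- R) \<phi>2)) z"
proof -
  define l1 l2 v where "l1 r = linepath (Complex (- r) \<phi>1) (Complex c \<phi>1)"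
    and "l2 r = linepath (Complex c \<phi>2) (Complex (- r) \<phi>2)"
    and "v r = linepath (Complex (- r) \<phi>2) (Complex (- r) \<phi>1)" for r
  have seg: "z \<notin> closed_segment (Complex x y) (Complex x' y)"
    if "y = \<phi>1 \<or> y = \<phi>2" "x \<le> c" "x' \<le> c" for x x' y
    using z(1) that by (auto simp: left_loop_image_def closed_segment_same_Im closed_segment_eq_real_ivl)
  have vert: "z \<notin> closed_segment (Complex (-r) y) (Complex (-r) y')" if "r = R \<or> r = R'" for r y y'
    using z(2,3) that by (auto simp: closed_segment_same_Re)
  have zg: "z \<notin> path_image g" using z(1) by (simp add: left_loop_image_def)
  have W: "winding_number (closed_loop r) z = winding_number (l1 r) z + winding_number g z +
      winding_number (l2 r) z + winding_number (v r) z" if "r = R \<or> r = R'" for r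
  proof -
    have c: "- r \<le> c" using that R by auto
    have *: "z \<notin> path_image (l1 r)" "z \<notin> path_image (l2 r)" "z \<notin> path_image (v r)"
      using seg vert that c by (auto simp: l1_def l2_def v_def)
    then show ?thesis using zg valid_g
      by (simp add: closed_loop_def truncated_loop_def l1_def[symmetric] l2_def[symmetric] v_def[symmetric]
           winding_number_join not_in_path_image_join valid_path_imp_path)
         (simp add: winding_number_join not_in_path_image_join valid_path_imp_path l1_def l2_def v_def)
  qed
  have rect: "winding_number (rectpath (Complex (- R') \<phi>1) (Complex (- R) \<phi>2)) z =
     winding_number (linepath (Complex (- R') \<phi>1) (Complex (- R) \<phi>1)) z +
     winding_number (linepath (Complex (- R) \<phi>1) (Complex (- R) \<phi>2)) z +
     winding_number (linepath (Complex (- R) \<phi>2) (Complex (- R') \<phi>2)) z + winding_number (v R') z"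
    using seg[of \<phi>1 "-R'" "-R"] seg[of \<phi>2 "-R" "-R'"] vert[of R \<phi>1 \<phi>2] vert[of R' \<phi>2 \<phi>1] R
    by (simp add: rectpath_def v_def Let_def winding_number_join not_in_path_image_join)
  have s1: "winding_number (l1 R') z = winding_number (linepath (Complex (- R') \<phi>1) (Complex (- R) \<phi>1)) z + winding_number (l1 R) z"
    unfolding l1_def using R seg[of \<phi>1 "-R'" c]
    by (intro winding_number_split_linepath)
       (simp_all add: closed_segment_same_Im closed_segment_eq_real_ivl)
  have s2: "winding_number (l2 R') z = winding_number (l2 R) z + winding_number (linepath (Complex (- R) \<phi>2) (Complex (- R') \<phi>2)) z"
    unfolding l2_def using R seg[of \<phi>2 c "-R'"]
    by (intro winding_number_split_linepath)
       (simp_all add: closed_segment_same_Im closed_segment_eq_real_ivl)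
  have s3: "winding_number (linepath (Complex (- R) \<phi>1) (Complex (- R) \<phi>2)) z = - winding_number (v R) z"
    using winding_number_reversepath[of "v R" z] vert[of R \<phi>2 \<phi>1] by (simp add: v_def)
  show ?thesis using W[of R] W[of R'] rect s1 s2 s3 by simp
qed

lemma winding_closed_loop_left:
  assumes g: "path_image g \<subseteq> {s. - R < Re s}" and z: "Re z < - R"
  shows "winding_number (closed_loop R) z = 0"
proof (rule winding_number_zero_outside[of _ "{s. - R \<le> Re s}"])
  have "Complex c \<phi>1 \<in> path_image g" by (metis pathstart_in_path_image start_g)
  then have c: "- R \<le> c" using g by fastforce
  show "path_image (closed_loop R) \<subseteq> {s. - R \<le> Re s}"
    using g unfolding path_image_closed[OF c] by fastforce
  show "convex {s. - R \<le> Re s}" by (rule convex_halfspace_Re_ge)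
qed (use z in \<open>auto simp: valid_path_imp_path\<close>)

text \<open>A path off the loop may cross the vertical side at - R. Being compact, it misses the
  vertical side of a sufficiently long truncation, and along it the winding number is
  constant.\<close>

lemma winding_closed_loop_connected:
  assumes g: "path_image g \<subseteq> {s. - R < Re s}" and conn: "connected_component (- L) p t"
  obtains R' where "R' > R" "- R' < Re p" "- R' < Re t"
    "winding_number (closed_loop R') p = winding_number (closed_loop R') t"
proof -
  have "path_component (- L) p t"
    using conn closed_L open_path_connected_component[of "- L"] by (auto simp: open_Compl)
  then obtain h where h: "path h" "path_image h \<subseteq> - L" "pathstart h = p" "pathfinish h = t"
    by (auto simp: path_component_def)
  have "bounded (path_image h)" using h by (simp add: bounded_path_image)
  then obtain B where B: "\<And>s. s \<in> path_image h \<Longrightarrow> norm s \<le> B" by (auto simp: bounded_iff)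
  define R' where "R' = max R B + 1"
  have R': "- R' < Re s" if "s \<in> path_image h" for s
    using B[OF that] abs_Re_le_cmod[of s] by (simp add: R'_def)
  have "Complex c \<phi>1 \<in> path_image g" by (metis pathstart_in_path_image start_g)
  then have c: "- R' \<le> c" using g by (fastforce simp: R'_def)
  have pt: "p \<in> path_image h" "t \<in> path_image h" using h by (metis pathstart_in_path_image pathfinish_in_path_image)+
  have "winding_number (closed_loop R') p = winding_number (closed_loop R') t"
  proof (rule winding_number_eq[of _ _ "path_image h"])
    show "path_image h \<inter> path_image (closed_loop R') = {}"
      using h(2) R' unfolding path_image_closed[OF c] left_loop_image_def by fastforce
  qed (use pt h in \<open>auto simp: valid_path_imp_path connected_path_image\<close>)
  then show ?thesis using R' pt by (intro that[of R']) (auto simp: R'_def)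
qed

text \<open>Far to the left between the half-lines the winding number is known: the shorter loop
  contributes 0 and the rectangle 1. This value is carried to p along a path. Going back from R' to
  R changes nothing, as p lies to the right of the rectangle.\<close>

lemma winding_closed_loop_inside:
  assumes g: "path_image g \<subseteq> {s. - R < Re s}" and p: "p \<in> left_loop_inside \<phi>1 \<phi>2 c g" "- R < Re p"
  shows "winding_number (closed_loop R) p = 1"
proof -
  have "Complex c \<phi>1 \<in> path_image g" by (metis pathstart_in_path_image start_g)
  then have c: "- R \<le> c" using g by fastforce
  obtain X where X: "\<And>t. Re t < X \<Longrightarrow> \<phi>1 < Im t \<Longrightarrow> Im t < \<phi>2 \<Longrightarrow> connected_component (- L) p t"
    using p(1) unfolding left_loop_inside_def by blast
  \<comment> \<open>Left of - R, where the shorter loop has winding number 0, and at half height,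
    hence in the interior of the rectangle that reaches to - R'.\<close>
  define t where "t = Complex (min X (- R) - 1) ((\<phi>1 + \<phi>2) / 2)"
  have t: "Re t < X" "Re t < - R" "\<phi>1 < Im t" "Im t < \<phi>2" using heights by (auto simp: t_def)
  have conn: "connected_component (- L) p t" using X t by blast
  then have pL: "p \<notin> L" and tL: "t \<notin> L" using connected_component_in by fastforce+
  obtain R' where R': "R' > R" "- R' < Re p" "- R' < Re t"
    "winding_number (closed_loop R') p = winding_number (closed_loop R') t"
    using winding_closed_loop_connected[OF g conn] by blast
  have "winding_number (closed_loop R') t = winding_number (closed_loop R) t +
      winding_number (rectpath (Complex (- R') \<phi>1) (Complex (- R) \<phi>2)) t"
    using R' t c tL by (intro winding_closed_loop_extend) auto
  also have "\<dots> = 1" using winding_closed_loop_left[OF g t(2)] R' t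
    by (subst winding_number_rectpath) (auto simp: in_box_complex_iff)
  finally have 1: "winding_number (closed_loop R') p = 1" using R' by simp
  have "winding_number (closed_loop R') p = winding_number (closed_loop R) p +
      winding_number (rectpath (Complex (- R') \<phi>1) (Complex (- R) \<phi>2)) p"
    using R' p c pL by (intro winding_closed_loop_extend) auto
  also have "\<dots> = winding_number (closed_loop R) p"
    using R' p heights by (subst winding_number_rectpath_outside) (auto simp: in_cbox_complex_iff)
  finally show ?thesis using 1 by simp
qed

text \<open>The comparison point now lies to the right of the whole loop, where the winding number
  of every truncation vanishes.\<close>

lemma winding_closed_loop_outside:
  assumes g: "path_image g \<subseteq> {s. - R < Re s}" and p: "p \<in> left_loop_outside \<phi>1 \<phi>2 c g" "- R < Re p"
  shows "winding_number (closed_loop R) p = 0"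
proof -
  have cg: "Complex c \<phi>1 \<in> path_image g" by (metis pathstart_in_path_image start_g)
  then have c: "- R \<le> c" using g by fastforce
  obtain X where X: "\<And>t. X < Re t \<Longrightarrow> connected_component (- L) p t"
    using p(1) unfolding left_loop_outside_def by blast
  have "bounded (path_image g)" using valid_g by (simp add: bounded_path_image valid_path_imp_path)
  then obtain B where B: "\<And>s. s \<in> path_image g \<Longrightarrow> norm s \<le> B" by (auto simp: bounded_iff)
  have B': "Re s \<le> B" if "s \<in> path_image g" for s using B[OF that] complex_Re_le_cmod[of s] by linarith
  define t where "t = Complex (max X B + 1) 0"
  have t: "X < Re t" "B < Re t" by (auto simp: t_def)
  have conn: "connected_component (- L) p t" using X t by blast
  then have pL: "p \<notin> L" using connected_component_in by fastforce
  obtain R' where R': "R' > R" "- R' < Re p" "- R' < Re t"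
    "winding_number (closed_loop R') p = winding_number (closed_loop R') t"
    using winding_closed_loop_connected[OF g conn] by blast
  have "winding_number (closed_loop R') t = 0"
  proof (rule winding_number_zero_outside[of _ "{s. Re s \<le> B}"])
    have c': "- R' \<le> c" using c R' by simp
    have "c \<le> B" using B'[OF cg] by simp
    then show "path_image (closed_loop R') \<subseteq> {s. Re s \<le> B}"
      using B' c' unfolding path_image_closed[OF c'] by auto
    show "convex {s. Re s \<le> B}" by (rule convex_halfspace_Re_le)
  qed (use t in \<open>auto simp: valid_path_imp_path\<close>)
  then have 0: "winding_number (closed_loop R') p = 0" using R' by simp
  have "winding_number (closed_loop R') p = winding_number (closed_loop R) p +
      winding_number (rectpath (Complex (- R') \<phi>1) (Complex (- R) \<phi>2)) p"
    using R' p c pL by (intro winding_closed_loop_extend) auto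
  also have "\<dots> = winding_number (closed_loop R) p"
    using R' p heights by (subst winding_number_rectpath_outside) (auto simp: in_cbox_complex_iff)
  finally show ?thesis using 0 by simp
qed

end

lemma closed_finite_in_balls:
  fixes P :: "complex set"
  assumes "\<And>M. finite (P \<inter> cball 0 M)"
  shows "closed P"
  unfolding closed_limpt
proof (intro allI impI)
  fix x assume "x islimpt P"
  then have "infinite (P \<inter> ball x 1)" by (simp add: islimpt_eq_infinite_ball)
  moreover have "P \<inter> ball x 1 \<subseteq> P \<inter> cball 0 (norm x + 1)"
  proof
    fix y assume "y \<in> P \<inter> ball x 1"
    then show "y \<in> P \<inter> cball 0 (norm x + 1)"
      using norm_triangle_ineq2[of y x] by (auto simp: dist_norm norm_minus_commute)
  qed
  ultimately show "x \<in> P" using assms finite_subset by blast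
qed

section \<open>Integrals over loops and sums of residues\<close>

context left_loop
begin

lemma contour_integral_truncated:
  assumes R: "- R < c" and \<Omega>: "open \<Omega>" "f holomorphic_on \<Omega>" "L \<subseteq> \<Omega>"
  shows "contour_integral (truncated_loop R) f = integral {-R..c} (\<lambda>x. f (Complex x \<phi>1)) +
     contour_integral g f - integral {-R..c} (\<lambda>x. f (Complex x \<phi>2))"
proof -
  define l1 l2 where "l1 = linepath (Complex (- R) \<phi>1) (Complex c \<phi>1)"
    and "l2 = linepath (Complex c \<phi>2) (Complex (- R) \<phi>2)"
  have sub: "path_image g \<subseteq> \<Omega>" "closed_segment (Complex (-R) \<phi>1) (Complex c \<phi>1) \<subseteq> \<Omega>"
     "closed_segment (Complex c \<phi>2) (Complex (-R) \<phi>2) \<subseteq> \<Omega>"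
    using \<Omega>(3) R by (auto simp: left_loop_image_def closed_segment_same_Im closed_segment_eq_real_ivl)
  have int: "f contour_integrable_on g" "f contour_integrable_on l1" "f contour_integrable_on l2"
    using sub valid_g unfolding l1_def l2_def
    by (auto intro!: contour_integrable_holomorphic_simple[OF \<Omega>(2,1)])
  have "contour_integral (truncated_loop R) f = contour_integral l1 f + (contour_integral g f + contour_integral l2 f)"
    using int valid_g by (simp add: truncated_loop_def l1_def l2_def)
  moreover have "contour_integral l1 f = integral {-R..c} (\<lambda>x. f (Complex x \<phi>1))"
    unfolding l1_def by (rule contour_integral_linepath_horizontal[OF R])
  moreover have "contour_integral l2 f = - integral {-R..c} (\<lambda>x. f (Complex x \<phi>2))"
  proof -
    have "continuous_on (closed_segment (Complex c \<phi>2) (Complex (-R) \<phi>2)) f"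
      using sub(3) \<Omega>(2) by (meson continuous_on_subset holomorphic_on_imp_continuous_on)
    then show ?thesis unfolding l2_def
      by (simp add: contour_integral_reverse_linepath contour_integral_linepath_horizontal[OF R])
  qed
  ultimately show ?thesis by simp
qed

lemma left_loop_integral_approx:
  assumes X: "X \<le> c" and \<Omega>: "open \<Omega>" "f holomorphic_on \<Omega>" "L \<subseteq> \<Omega>" and \<kappa>: "\<kappa> > 0"
    and bound: "\<And>s. Im s = \<phi>1 \<or> Im s = \<phi>2 \<Longrightarrow> Re s \<le> X \<Longrightarrow> norm (f s) \<le> C * exp (\<kappa> * Re s)"
  shows "left_loop_integrable \<phi>1 \<phi>2 c g f"
    and "\<And>R. - R \<le> X \<Longrightarrow> - R < c \<Longrightarrow>
       norm (left_loop_integral \<phi>1 \<phi>2 c g f - contour_integral (truncated_loop R) f) \<le> 2 * (C * exp (- \<kappa> * R) / \<kappa>)"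
proof -
  have "continuous_on {..c} (\<lambda>x. f (Complex x y))" if "y = \<phi>1 \<or> y = \<phi>2" for y
  proof -
    have "continuous_on L f" using \<Omega> by (meson continuous_on_subset holomorphic_on_imp_continuous_on)
    moreover have "continuous_on {..c} (\<lambda>x. Complex x y)"
      unfolding Complex_eq by (intro continuous_intros)
    ultimately show ?thesis
      by (rule continuous_on_compose2) (use that in \<open>auto simp: left_loop_image_def\<close>)
  qed
  then have cont: "continuous_on {..c} (\<lambda>x. f (Complex x \<phi>1))" "continuous_on {..c} (\<lambda>x. f (Complex x \<phi>2))"
    by auto
  have bd: "\<And>x. x \<le> X \<Longrightarrow> norm (f (Complex x \<phi>1)) \<le> C * exp (\<kappa> * x)"
    "\<And>x. x \<le> X \<Longrightarrow> norm (f (Complex x \<phi>2)) \<le> C * exp (\<kappa> * x)"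
    using bound[of "Complex x \<phi>1" for x] bound[of "Complex x \<phi>2" for x] by simp_all
  note t1 = exp_dominated_tail[OF cont(1) \<kappa> X bd(1)] and t2 = exp_dominated_tail[OF cont(2) \<kappa> X bd(2)]
  have "path_image g \<subseteq> \<Omega>" using \<Omega>(3) by (auto simp: left_loop_image_def)
  then have "f contour_integrable_on g"
    using valid_g by (intro contour_integrable_holomorphic_simple[OF \<Omega>(2,1)])
  then show "left_loop_integrable \<phi>1 \<phi>2 c g f"
    using t1(1) t2(1) by (simp add: left_loop_integrable_def)
  fix R assume R: "- R \<le> X" "- R < c"
  have "left_loop_integral \<phi>1 \<phi>2 c g f - contour_integral (truncated_loop R) f =
     (integral {..c} (\<lambda>x. f (Complex x \<phi>1)) - integral {-R..c} (\<lambda>x. f (Complex x \<phi>1))) -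
     (integral {..c} (\<lambda>x. f (Complex x \<phi>2)) - integral {-R..c} (\<lambda>x. f (Complex x \<phi>2)))"
    unfolding left_loop_integral_def contour_integral_truncated[OF R(2) \<Omega>] by simp
  also have "norm \<dots> \<le> C * exp (- \<kappa> * R) / \<kappa> + C * exp (- \<kappa> * R) / \<kappa>"
    by (intro order_trans[OF norm_triangle_ineq4] add_mono t1(2) t2(2) R(1))
  finally show "norm (left_loop_integral \<phi>1 \<phi>2 c g f - contour_integral (truncated_loop R) f) \<le> 2 * (C * exp (- \<kappa> * R) / \<kappa>)"
    by simp
qed

text \<open>\<open>connected_component\<close> relates only points of the set. Placing the poles
  inside or outside therefore also keeps them off the loop itself.\<close>

lemma left_loop_inside_subset: "left_loop_inside \<phi>1 \<phi>2 c g \<subseteq> - L"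
proof
  fix p assume "p \<in> left_loop_inside \<phi>1 \<phi>2 c g"
  then obtain X where "\<And>t. Re t < X \<Longrightarrow> \<phi>1 < Im t \<Longrightarrow> Im t < \<phi>2 \<Longrightarrow> connected_component (- L) p t"
    unfolding left_loop_inside_def by blast
  then have "connected_component (- L) p (Complex (X - 1) ((\<phi>1 + \<phi>2) / 2))" using heights by auto
  then show "p \<in> - L" using connected_component_in by fastforce
qed

lemma left_loop_outside_subset: "left_loop_outside \<phi>1 \<phi>2 c g \<subseteq> - L"
proof
  fix p assume "p \<in> left_loop_outside \<phi>1 \<phi>2 c g"
  then obtain X where "\<And>t. X < Re t \<Longrightarrow> connected_component (- L) p t"
    unfolding left_loop_outside_def by blast
  then have "connected_component (- L) p (Complex (X + 1) 0)" by auto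
  then show "p \<in> - L" using connected_component_in by fastforce
qed

text \<open>P contains all singularities and A those to be collected. The members of A beyond the
  cut have winding number 0 because the closed loop lies in the half-plane to their right, so an
  infinite P yields a finite sum.\<close>

lemma residues_truncated_loop:
  assumes f: "f holomorphic_on - P" and P: "\<And>M. finite (P \<inter> cball 0 M)"
    and A: "A \<subseteq> P" "A \<subseteq> left_loop_inside \<phi>1 \<phi>2 c g" "finite {p \<in> A. - R < Re p}"
    and B: "P - A \<subseteq> left_loop_outside \<phi>1 \<phi>2 c g" "\<And>p. p \<in> P - A \<Longrightarrow> - R < Re p"
    and g: "path_image g \<subseteq> {s. - R < Re s}" and R: "\<And>p. p \<in> P \<Longrightarrow> Re p \<noteq> - R"
  shows "contour_integral (truncated_loop R) f +
      contour_integral (linepath (Complex (- R) \<phi>2) (Complex (- R) \<phi>1)) f =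
    2 * pi * \<i> * (\<Sum>p | p \<in> A \<and> - R < Re p. residue f p)"
proof -
  have "Complex c \<phi>1 \<in> path_image g" by (metis pathstart_in_path_image start_g)
  then have c: "- R < c" using g by fastforce
  have PL: "P \<inter> L = {}"
  proof -
    have "P \<subseteq> left_loop_inside \<phi>1 \<phi>2 c g \<union> left_loop_outside \<phi>1 \<phi>2 c g" using A B by auto
    then show ?thesis using left_loop_inside_subset left_loop_outside_subset by blast
  qed
  have op: "open (- P)" using closed_finite_in_balls[OF P] by (simp add: open_Compl)
  have im: "path_image (closed_loop R) \<subseteq> - P"
    using PL R c unfolding path_image_closed[OF less_imp_le[OF c]] left_loop_image_def by auto
  obtain M0 where M0: "\<And>s. s \<in> path_image (closed_loop R) \<Longrightarrow> norm s \<le> M0"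
    using bounded_path_image[OF valid_path_imp_path[OF valid_closed[of R]]] by (auto simp: bounded_iff)
  have "bounded {p \<in> A. - R < Re p}" using A(3) by (rule finite_imp_bounded)
  then obtain M1 where M1: "\<And>p. p \<in> A \<Longrightarrow> - R < Re p \<Longrightarrow> norm p \<le> M1" by (auto simp: bounded_iff)
  \<comment> \<open>The residue theorem needs finitely many singularities. A ball that contains the
    closed loop and the poles of A to the right of the cut provides this.\<close>
  define M where "M = max M0 M1 + 1"
  define Q where "Q = P \<inter> ball 0 M"
  have Q: "finite Q" using P[of M] by (rule finite_subset[rotated]) (auto simp: Q_def)
  have AQ: "{p. p \<in> A \<and> - R < Re p} \<subseteq> Q"
    using M1 A(1) by (fastforce simp: Q_def M_def)
  have "contour_integral (closed_loop R) f = 2 * pi * \<i> * (\<Sum>p\<in>Q. winding_number (closed_loop R) p * residue f p)"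
  proof (rule Residue_theorem[of "ball 0 M"])
    show "f holomorphic_on ball 0 M - Q" using f by (rule holomorphic_on_subset) (auto simp: Q_def)
    show "path_image (closed_loop R) \<subseteq> ball 0 M - Q"
      using im M0 by (fastforce simp: Q_def M_def)
    then show "\<forall>z. z \<notin> ball 0 M \<longrightarrow> winding_number (closed_loop R) z = 0"
      by (intro allI impI winding_number_zero_outside[of _ "ball 0 M"]) (auto simp: valid_path_imp_path)
  qed (auto simp: Q)
  also have "(\<Sum>p\<in>Q. winding_number (closed_loop R) p * residue f p) =
      (\<Sum>p | p \<in> A \<and> - R < Re p. winding_number (closed_loop R) p * residue f p)"
  proof (rule sum.mono_neutral_right[OF Q AQ], intro ballI)
    fix p assume p: "p \<in> Q - {p. p \<in> A \<and> - R < Re p}"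
    show "winding_number (closed_loop R) p * residue f p = 0"
    proof (cases "p \<in> A")
      case True
      then have "Re p < - R" using p R[of p] by (auto simp: Q_def)
      then show ?thesis using winding_closed_loop_left[OF g] by simp
    next
      case False
      then have "p \<in> P - A" using p by (auto simp: Q_def)
      then show ?thesis using winding_closed_loop_outside[OF g] B by auto
    qed
  qed
  also have "\<dots> = (\<Sum>p | p \<in> A \<and> - R < Re p. residue f p)"
    using winding_closed_loop_inside[OF g] A(2) by (intro sum.cong) auto
  finally have "contour_integral (closed_loop R) f = 2 * pi * \<i> * (\<Sum>p | p \<in> A \<and> - R < Re p. residue f p)" .
  moreover have "contour_integral (closed_loop R) f = contour_integral (truncated_loop R) f +
      contour_integral (linepath (Complex (- R) \<phi>2) (Complex (- R) \<phi>1)) f"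
  proof -
    have "path_image (truncated_loop R) \<subseteq> - P" "closed_segment (Complex (- R) \<phi>2) (Complex (- R) \<phi>1) \<subseteq> - P"
      using im by (auto simp: closed_loop_def path_image_join)
    then have "f contour_integrable_on truncated_loop R"
       "f contour_integrable_on linepath (Complex (- R) \<phi>2) (Complex (- R) \<phi>1)"
      by (auto intro!: contour_integrable_holomorphic_simple[OF f op])
    then show ?thesis by (simp add: closed_loop_def)
  qed
  ultimately show ?thesis by simp
qed

end

section \<open>Contour integrals as entire functions of w\<close>

lemma exp_partial_sum_error:
  fixes u :: complex
  assumes "norm u \<le> r"
  shows "norm (exp u - (\<Sum>k<N. u ^ k / fact k)) \<le> exp r - (\<Sum>k<N. r ^ k / fact k)"
proof -
  have S: "summable (\<lambda>k. u ^ k / fact k)" and Sr: "summable (\<lambda>k. r ^ k / fact k)"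
    using summable_exp_generic[of u] summable_exp_generic[of r]
    by (simp_all add: scaleR_conv_of_real divide_inverse mult.commute)
  have E: "exp u = (\<Sum>k. u ^ k / fact k)" and Er: "exp r = (\<Sum>k. r ^ k / fact k)"
    by (simp_all add: exp_def scaleR_conv_of_real divide_inverse mult.commute)
  have "exp u - (\<Sum>k<N. u ^ k / fact k) = (\<Sum>k. u ^ (k + N) / fact (k + N))"
    unfolding E using suminf_minus_initial_segment[OF S, of N] by simp
  also have "norm \<dots> \<le> (\<Sum>k. r ^ (k + N) / fact (k + N))"
  proof (rule norm_suminf_le)
    fix k
    show "norm (u ^ (k + N) / fact (k + N)) \<le> r ^ (k + N) / fact (k + N)"
      using assms by (auto simp: norm_divide norm_power intro!: divide_right_mono power_mono)
    show "summable (\<lambda>k. r ^ (k + N) / fact (k + N))"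
      using Sr summable_iff_shift[of "\<lambda>k. r ^ k / fact k" N] by simp
  qed
  also have "\<dots> = exp r - (\<Sum>k<N. r ^ k / fact k)"
    unfolding Er using suminf_minus_initial_segment[OF Sr, of N] by simp
  finally show ?thesis .
qed

text \<open>
  The derivative of a valid path may be unbounded near its break points, so integrals along it are
  estimated through \<open>contour_integral_bound_exists\<close> and not through its length.
\<close>

lemma contour_integral_exp_entire:
  assumes \<Omega>: "open \<Omega>" "h holomorphic_on \<Omega>" and \<gamma>: "valid_path \<gamma>" "path_image \<gamma> \<subseteq> \<Omega>"
  shows "(\<lambda>w. contour_integral \<gamma> (\<lambda>s. h s * exp (- (s * w)))) holomorphic_on UNIV"
proof -
  have cont: "continuous_on \<Omega> h" using \<Omega> by (simp add: holomorphic_on_imp_continuous_on)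
  have comp: "compact (path_image \<gamma>)" using \<gamma> by (simp add: compact_path_image valid_path_imp_path)
  obtain M1 where M1: "\<And>s. s \<in> path_image \<gamma> \<Longrightarrow> norm s \<le> M1"
    using compact_imp_bounded[OF comp] by (auto simp: bounded_iff)
  have "bounded (h ` path_image \<gamma>)"
    using cont \<gamma>(2) by (intro compact_imp_bounded compact_continuous_image comp) (rule continuous_on_subset)
  then obtain M2 where M2: "\<And>s. s \<in> path_image \<gamma> \<Longrightarrow> norm (h s) \<le> M2" by (auto simp: bounded_iff)
  define M where "M = max M1 M2 + 1"
  \<comment> \<open>The bounds on the path must hold on an open neighbourhood, since
    \<open>contour_integral_bound_exists\<close> estimates the integral by the supremum over an open
    set. The 1 added in M turns them into strict inequalities.\<close>
  define S where "S = {s \<in> \<Omega>. norm (h s) < M} \<inter> ball 0 M"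
  have "{s \<in> \<Omega>. norm (h s) < M} = \<Omega> \<inter> h -` ball 0 M" by auto
  then have "open {s \<in> \<Omega>. norm (h s) < M}"
    using continuous_open_preimage[OF cont \<Omega>(1) open_ball] by simp
  then have S: "open S" unfolding S_def by auto
  have \<gamma>S: "path_image \<gamma> \<subseteq> S" using M1 M2 \<gamma>(2) by (fastforce simp: S_def M_def)
  have hS: "h holomorphic_on S" using \<Omega>(2) by (rule holomorphic_on_subset) (auto simp: S_def)
  obtain L where L: "L > 0" "\<And>f B. f holomorphic_on S \<Longrightarrow> (\<And>z. z \<in> S \<Longrightarrow> norm (f z) \<le> B) \<Longrightarrow>
      norm (contour_integral \<gamma> f) \<le> L * B"
    using contour_integral_bound_exists[OF S \<gamma>(1) \<gamma>S] by blast
  \<comment> \<open>The coefficients obtained by integrating the exponential series in w term by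
    term.\<close>
  define a where "a k = contour_integral \<gamma> (\<lambda>s. h s * ((- s) ^ k / fact k))" for k
  have int: "f contour_integrable_on \<gamma>" if "f holomorphic_on S" for f
    by (rule contour_integrable_holomorphic_simple[OF that S \<gamma>(1) \<gamma>S])
  have series: "(\<lambda>k. a k * (w - 0) ^ k) sums contour_integral \<gamma> (\<lambda>s. h s * exp (- (s * w)))" for w
  proof -
    define r where "r = M * norm w"
    have part: "(\<Sum>k<N. a k * (w - 0) ^ k) = contour_integral \<gamma> (\<lambda>s. h s * (\<Sum>k<N. (- (s * w)) ^ k / fact k))" for N
    proof -
      have "(\<Sum>k<N. a k * (w - 0) ^ k) = (\<Sum>k<N. contour_integral \<gamma> (\<lambda>s. h s * ((- s) ^ k / fact k) * w ^ k))"
      proof (intro sum.cong refl)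
        fix k
        have "contour_integral \<gamma> (\<lambda>s. h s * ((- s) ^ k / fact k) * w ^ k) =
            contour_integral \<gamma> (\<lambda>s. h s * ((- s) ^ k / fact k)) * w ^ k"
          using hS by (intro contour_integral_rmul int holomorphic_intros) auto
        then show "a k * (w - 0) ^ k = contour_integral \<gamma> (\<lambda>s. h s * ((- s) ^ k / fact k) * w ^ k)"
          by (simp only: a_def diff_0_right)
      qed
      also have "\<dots> = contour_integral \<gamma> (\<lambda>s. \<Sum>k<N. h s * ((- s) ^ k / fact k) * w ^ k)"
        using hS by (intro contour_integral_sum[symmetric] int holomorphic_intros) auto
      also have "(\<lambda>s. \<Sum>k<N. h s * ((- s) ^ k / fact k) * w ^ k) = (\<lambda>s. h s * (\<Sum>k<N. (- (s * w)) ^ k / fact k))"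
      proof -
        have "(- (s * w)) ^ k = (- s) ^ k * w ^ k" for s k
          by (metis mult_minus_left power_mult_distrib)
        then show ?thesis by (simp add: sum_distrib_left mult_ac)
      qed
      finally show ?thesis .
    qed
    have bound: "norm ((\<Sum>k<N. a k * (w - 0) ^ k) - contour_integral \<gamma> (\<lambda>s. h s * exp (- (s * w))))
        \<le> L * (M * (exp r - (\<Sum>k<N. r ^ k / fact k)))" for N
    proof -
      have "(\<Sum>k<N. a k * (w - 0) ^ k) - contour_integral \<gamma> (\<lambda>s. h s * exp (- (s * w))) =
         contour_integral \<gamma> (\<lambda>s. h s * (\<Sum>k<N. (- (s * w)) ^ k / fact k) - h s * exp (- (s * w)))"
        unfolding part using hS by (intro contour_integral_diff[symmetric] int holomorphic_intros) auto
      also have "norm \<dots> \<le> L * (M * (exp r - (\<Sum>k<N. r ^ k / fact k)))"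
      proof (rule L(2))
        show "(\<lambda>s. h s * (\<Sum>k<N. (- (s * w)) ^ k / fact k) - h s * exp (- (s * w))) holomorphic_on S"
          using hS by (intro holomorphic_intros) auto
        fix s assume s: "s \<in> S"
        have "norm (- (s * w)) \<le> r" using s by (auto simp: S_def r_def norm_mult intro!: mult_right_mono)
        from exp_partial_sum_error[OF this, of N]
        have e: "norm ((\<Sum>k<N. (- (s * w)) ^ k / fact k) - exp (- (s * w))) \<le> exp r - (\<Sum>k<N. r ^ k / fact k)"
          by (simp add: norm_minus_commute)
        have "norm (h s * (\<Sum>k<N. (- (s * w)) ^ k / fact k) - h s * exp (- (s * w))) =
           norm (h s) * norm ((\<Sum>k<N. (- (s * w)) ^ k / fact k) - exp (- (s * w)))"
          by (simp add: norm_mult[symmetric] right_diff_distrib)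
        also have "\<dots> \<le> M * (exp r - (\<Sum>k<N. r ^ k / fact k))"
          using s e by (intro mult_mono) (auto simp: S_def intro: order_trans[OF norm_ge_zero less_imp_le])
        finally show "norm (h s * (\<Sum>k<N. (- (s * w)) ^ k / fact k) - h s * exp (- (s * w))) \<le> M * (exp r - (\<Sum>k<N. r ^ k / fact k))" .
      qed
      finally show ?thesis .
    qed
    have "(\<lambda>k. r ^ k / fact k) sums exp r"
      using exp_converges[of r] by (simp add: scaleR_conv_of_real divide_inverse mult.commute)
    then have "(\<lambda>N. \<Sum>k<N. r ^ k / fact k) \<longlonglongrightarrow> exp r" by (simp add: sums_def)
    then have "(\<lambda>N. L * (M * (exp r - (\<Sum>k<N. r ^ k / fact k)))) \<longlonglongrightarrow> L * (M * (exp r - exp r))"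
      by (intro tendsto_intros)
    then have "(\<lambda>N. L * (M * (exp r - (\<Sum>k<N. r ^ k / fact k)))) \<longlonglongrightarrow> 0"
      by (simp only: diff_self mult_zero_right)
    then have "(\<lambda>N. (\<Sum>k<N. a k * (w - 0) ^ k) - contour_integral \<gamma> (\<lambda>s. h s * exp (- (s * w)))) \<longlonglongrightarrow> 0"
      by (rule Lim_null_comparison[OF eventuallyI[OF bound]])
    then show ?thesis unfolding sums_def by (rule LIM_zero_cancel)
  qed
  have "(\<lambda>w. contour_integral \<gamma> (\<lambda>s. h s * exp (- (s * w)))) holomorphic_on ball 0 r" for r
    by (rule power_series_holomorphic[where a = a]) (rule series)
  then have "(\<lambda>w. contour_integral \<gamma> (\<lambda>s. h s * exp (- (s * w)))) field_differentiable at z" for z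
    by (rule holomorphic_on_imp_differentiable_at[of _ "ball 0 (norm z + 1)"]) auto
  then show ?thesis by (simp add: holomorphic_on_def)
qed

text \<open>Each affine function is cleared of the integers in turn, inside the subinterval left by
  the previous ones. For this the induction has to provide an interval and not just a point, and its
  length and \<epsilon> must not depend on the position x of the window.\<close>

lemma far_from_integers_subinterval:
  fixes \<beta> r :: "'i \<Rightarrow> real"
  assumes "finite J" "\<And>j. j \<in> J \<Longrightarrow> \<beta> j > 0" "W > 0"
  shows "\<exists>\<epsilon>>0. \<exists>W'>0. \<forall>x. \<exists>y. x \<le> y \<and> y + W' \<le> x + W \<and>
     (\<forall>R\<in>{y..y+W'}. \<forall>j\<in>J. \<forall>k::int. \<epsilon> \<le> \<bar>\<beta> j * R - r j - of_int k\<bar>)"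
  using assms
proof (induction J rule: finite_induct)
  case empty
  then show ?case by (intro exI[of _ 1]) (simp, rule exI[of _ W], auto)
next
  case (insert i J)
  then obtain \<epsilon> W1 where IH: "\<epsilon> > 0" "W1 > 0" "\<And>x. \<exists>y. x \<le> y \<and> y + W1 \<le> x + W \<and>
     (\<forall>R\<in>{y..y+W1}. \<forall>j\<in>J. \<forall>k::int. \<epsilon> \<le> \<bar>\<beta> j * R - r j - of_int k\<bar>)" by auto
  have \<beta>: "\<beta> i > 0" using insert by auto
  \<comment> \<open>The growth of the new function over three intervals of length W'. Being at most
    1/2, it leaves no room for two integers close to its values. The clearance d / 6 is half the
    growth over one of the three.\<close>
  define d where "d = min (\<beta> i * W1) (1/2)"
  define W' where "W' = d / \<beta> i / 3"
  define \<epsilon>' where "\<epsilon>' = min \<epsilon> (d / 6)"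
  have d: "d > 0" "d \<le> 1/2" "d / \<beta> i \<le> W1" using \<beta> IH by (auto simp: d_def field_simps min_def)
  have W': "W' > 0" "3 * W' \<le> W1" "\<beta> i * W' = d / 3" using d \<beta> by (auto simp: W'_def)
  have pos: "\<epsilon>' > 0" "W' > 0" using IH d W' by (auto simp: \<epsilon>'_def)
  have sub: "\<exists>y. x \<le> y \<and> y + W' \<le> x + W \<and>
       (\<forall>R\<in>{y..y+W'}. \<forall>j\<in>insert i J. \<forall>k::int. \<epsilon>' \<le> \<bar>\<beta> j * R - r j - of_int k\<bar>)" for x
  proof -
    obtain y where y0: "x \<le> y \<and> y + W1 \<le> x + W \<and>
       (\<forall>R\<in>{y..y+W1}. \<forall>j\<in>J. \<forall>k::int. \<epsilon> \<le> \<bar>\<beta> j * R - r j - of_int k\<bar>)"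
      using IH(3) by blast
    then have y: "x \<le> y" "y + W1 \<le> x + W"
      "\<And>R j k. R \<in> {y..y+W1} \<Longrightarrow> j \<in> J \<Longrightarrow> \<epsilon> \<le> \<bar>\<beta> j * R - r j - of_int k\<bar>"
      by auto
    define u where "u = \<beta> i * y - r i"
    \<comment> \<open>One of the two outer thirds is suitable. Otherwise the first third comes near
      an integer below \<open>u + d/2\<close> and the last third near one above it, and these two
      integers differ by less than 4 d / 3 < 1.\<close>
    have ex: "\<exists>z. y \<le> z \<and> z + W' \<le> y + W1 \<and> (\<forall>R\<in>{z..z+W'}. \<forall>k::int. \<epsilon>' \<le> \<bar>\<beta> i * R - r i - of_int k\<bar>)"
    proof (rule ccontr)
      assume neg: "\<not> ?thesis"
      have "\<not> (\<forall>R\<in>{y..y+W'}. \<forall>k::int. \<epsilon>' \<le> \<bar>\<beta> i * R - r i - of_int k\<bar>)"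
        using neg W' by (auto dest!: spec[of _ y])
      then obtain R1 and k1 :: int where 1: "y \<le> R1" "R1 \<le> y + W'" "\<bar>\<beta> i * R1 - r i - of_int k1\<bar> < \<epsilon>'"
        by (auto simp: not_le)
      have "\<not> (\<forall>R\<in>{y+2*W'..y+2*W'+W'}. \<forall>k::int. \<epsilon>' \<le> \<bar>\<beta> i * R - r i - of_int k\<bar>)"
        using neg W' by (auto dest!: spec[of _ "y+2*W'"])
      then obtain R2 and k2 :: int where 2: "y + 2 * W' \<le> R2" "R2 \<le> y + 3 * W'" "\<bar>\<beta> i * R2 - r i - of_int k2\<bar> < \<epsilon>'"
        by (auto simp: not_le)
      have a: "\<beta> i * y \<le> \<beta> i * R1" "\<beta> i * R1 \<le> \<beta> i * y + d / 3"
        "\<beta> i * y + 2 * (d / 3) \<le> \<beta> i * R2" "\<beta> i * R2 \<le> \<beta> i * y + 3 * (d / 3)"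
        using mult_left_mono[OF 1(1), of "\<beta> i"] mult_left_mono[OF 1(2), of "\<beta> i"]
          mult_left_mono[OF 2(1), of "\<beta> i"] mult_left_mono[OF 2(2), of "\<beta> i"] \<beta> W'(3)
        by (auto simp: algebra_simps)
      have e: "\<epsilon>' \<le> d / 6" by (simp add: \<epsilon>'_def)
      have "real_of_int k2 < of_int k1 + 1" "real_of_int k1 < of_int k2"
        using a e 1(3) 2(3) d unfolding abs_less_iff by linarith+
      then have "k2 < k1 + 1" "k1 < k2" by linarith+
      then show False by simp
    qed
    then obtain z where "y \<le> z \<and> z + W' \<le> y + W1 \<and>
       (\<forall>R\<in>{z..z+W'}. \<forall>k::int. \<epsilon>' \<le> \<bar>\<beta> i * R - r i - of_int k\<bar>)" by blast
    then have z: "y \<le> z" "z + W' \<le> y + W1"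
       "\<And>R k. R \<in> {z..z+W'} \<Longrightarrow> \<epsilon>' \<le> \<bar>\<beta> i * R - r i - of_int k\<bar>" by auto
    show ?thesis
    proof (intro exI[of _ z] conjI ballI allI)
      show "x \<le> z" "z + W' \<le> x + W" using y z by auto
      fix R j and k :: int assume R: "R \<in> {z..z+W'}" and j: "j \<in> insert i J"
      show "\<epsilon>' \<le> \<bar>\<beta> j * R - r j - of_int k\<bar>"
      proof (cases "j = i")
        case True then show ?thesis using z(3)[OF R] by simp
      next
        case False
        then have "\<epsilon> \<le> \<bar>\<beta> j * R - r j - of_int k\<bar>" using j R z by (intro y(3)) auto
        then show ?thesis by (simp add: \<epsilon>'_def)
      qed
    qed
  qed
  show ?case
    by (rule exI[of _ \<epsilon>'], rule conjI[OF pos(1)], rule exI[of _ W'], rule conjI[OF pos(2)], rule allI, rule sub)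
qed

text \<open>The condition on K says that the truncation keeps or drops all representations of a
  point together. Then suppressing all but the smallest row index counts each retained point exactly
  once.\<close>

lemma sum_residue_term:
  assumes inj: "\<And>j. j \<in> {1..m} \<Longrightarrow> inj (pt j)"
    and K: "\<And>j j' l l'. j \<in> {1..m} \<Longrightarrow> j' \<in> {1..m} \<Longrightarrow> pt j l = pt j' l' \<Longrightarrow> l < K j \<Longrightarrow> l' < K j'"
  shows "(\<Sum>j=1..m. \<Sum>l<K j. residue_term f pt j l) =
    (\<Sum>p\<in>(\<Union>j\<in>{1..m}. pt j ` {..<K j}). residue f p)"
  using assms
proof (induction m)
  case (Suc m)
  define U where "U = (\<Union>j\<in>{1..m}. pt j ` {..<K j})"
  define V where "V = pt (Suc m) ` {..<K (Suc m)}"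
  have UV: "(\<Union>j\<in>{1..Suc m}. pt j ` {..<K j}) = U \<union> (V - U)"
    unfolding U_def V_def by (auto simp: atLeastAtMostSuc_conv)
  have fin: "finite U" "finite V" by (auto simp: U_def V_def)
  have IH: "(\<Sum>j=1..m. \<Sum>l<K j. residue_term f pt j l) = (\<Sum>p\<in>U. residue f p)"
    unfolding U_def
  proof (rule Suc.IH)
    show "inj (pt j)" if "j \<in> {1..m}" for j using Suc.prems(1)[of j] that by simp
    show "l' < K j'" if "j \<in> {1..m}" "j' \<in> {1..m}" "pt j l = pt j' l'" "l < K j" for j j' l l'
      using Suc.prems(2)[of j j' l l'] that by simp
  qed
  \<comment> \<open>\<open>residue_term\<close> searches the earlier rows without any limit on l'.
    The condition on K puts the l' found there below \<open>K j'\<close>, so the point is already in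
    U.\<close>
  have dup: "(\<exists>j'\<in>{1..<Suc m}. \<exists>l'. pt j' l' = pt (Suc m) l) \<longleftrightarrow> pt (Suc m) l \<in> U" if "l < K (Suc m)" for l
  proof
    assume "\<exists>j'\<in>{1..<Suc m}. \<exists>l'. pt j' l' = pt (Suc m) l"
    then obtain j' l' where *: "j' \<in> {1..m}" "pt j' l' = pt (Suc m) l" by (auto simp: less_Suc_eq_le)
    then have "l' < K j'" using Suc.prems(2)[of "Suc m" j' l l'] that by auto
    then show "pt (Suc m) l \<in> U" using * unfolding U_def by (metis UN_I imageI lessThan_iff)
  next
    assume "pt (Suc m) l \<in> U"
    then obtain j' l' where "j' \<in> {1..m}" "pt (Suc m) l = pt j' l'" by (auto simp: U_def)
    then show "\<exists>j'\<in>{1..<Suc m}. \<exists>l'. pt j' l' = pt (Suc m) l"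
      by (intro bexI[of _ j'] exI[of _ l']) auto
  qed
  have "(\<Sum>l<K (Suc m). residue_term f pt (Suc m) l) =
     (\<Sum>l<K (Suc m). if pt (Suc m) l \<in> U then 0 else residue f (pt (Suc m) l))"
    unfolding residue_term_def using dup by (intro sum.cong) auto
  also have "\<dots> = (\<Sum>p\<in>V. if p \<in> U then 0 else residue f p)"
    unfolding V_def using Suc.prems(1)[of "Suc m"]
    by (subst sum.reindex) (auto intro: inj_on_subset)
  also have "\<dots> = (\<Sum>p\<in>V - U. residue f p)"
    using fin by (intro sum.mono_neutral_cong_right) auto
  finally have "(\<Sum>j=1..Suc m. \<Sum>l<K j. residue_term f pt j l) = (\<Sum>p\<in>U. residue f p) + (\<Sum>p\<in>V - U. residue f p)"
    using IH by simp
  also have "\<dots> = (\<Sum>p\<in>U \<union> (V - U). residue f p)"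
    using fin by (intro sum.union_disjoint[symmetric]) auto
  finally show ?case unfolding UV .
qed simp

section \<open>Poles of the integrand\<close>

lemma finite_arithmetic_progression_bounded:
  fixes x y :: complex
  assumes "y \<noteq> 0"
  shows "finite {l::nat. norm (x + of_nat l * y) \<le> M}"
proof (rule finite_subset)
  show "{l::nat. norm (x + of_nat l * y) \<le> M} \<subseteq> {l. real l \<le> (M + norm x) / norm y}"
  proof clarify
    fix l :: nat assume "norm (x + of_nat l * y) \<le> M"
    moreover have "norm (of_nat l * y) \<le> norm (x + of_nat l * y) + norm x"
      using norm_triangle_ineq4[of "x + of_nat l * y" x] by simp
    ultimately show "real l \<le> (M + norm x) / norm y"
      using assms by (simp add: norm_mult field_simps)
  qed
  show "finite {l. real l \<le> (M + norm x) / norm y}"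
    by (rule finite_subset[of _ "{..nat \<lfloor>(M + norm x) / norm y\<rfloor>}"]) (auto simp: le_nat_floor)
qed

lemma is_pole_Gamma_affine:
  fixes x y :: complex
  assumes "y \<noteq> 0"
  shows "is_pole (\<lambda>s. Gamma (x + y * s)) ((- of_nat l - x) / y)"
proof -
  define s0 where "s0 = (- of_nat l - x) / y"
  have s0: "x + y * s0 = - of_nat l" using assms by (simp add: s0_def)
  have "filterlim (\<lambda>s. x + y * s) (at (- of_nat l)) (at s0)"
  proof (rule filterlim_atI)
    show "((\<lambda>s. x + y * s) \<longlongrightarrow> - of_nat l) (at s0)"
      by (rule tendsto_eq_intros refl | simp add: s0)+
    show "\<forall>\<^sub>F s in at s0. x + y * s \<noteq> - of_nat l"
    proof (rule eventually_mono[OF eventually_at_filter[THEN iffD2, OF always_eventually]])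
      fix s assume "s \<noteq> s0"
      then show "x + y * s \<noteq> - of_nat l" using s0 assms by (metis add_left_cancel mult_cancel_left)
    qed auto
  qed
  then show ?thesis unfolding is_pole_def s0_def[symmetric]
    by (rule filterlim_compose[OF Gamma_poles])
qed

context fox
begin

abbreviation integrand :: "complex \<Rightarrow> complex \<Rightarrow> complex" where
  "integrand \<equiv> fox_integrand m n p q a \<alpha> b \<beta>"

text \<open>Together with \<open>poles_a\<close> this contains all singularities of the kernel. A
  zero of a reciprocal Gamma factor may make one of them removable, and its residue is then
  0.\<close>

definition poles_b :: "complex set" where
  "poles_b = {pole j l | j l. j \<in> {1..m}}"

definition poles_a :: "complex set" where
  "poles_a = {fox_pole_a a \<alpha> i k | i k. i \<in> {1..n}}"

lemma beta_pos': "j \<in> {1..m} \<Longrightarrow> \<beta> j > 0" using m_le by (intro beta_pos) auto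
lemma alpha_pos': "i \<in> {1..n} \<Longrightarrow> \<alpha> i > 0" using n_le by (intro alpha_pos) auto

lemma Re_pole: "Re (pole j l) = - ((Re (b j) + real l) / \<beta> j)"
  and Im_pole: "Im (pole j l) = - (Im (b j) / \<beta> j)"
  by (simp_all add: fox_pole_b_def Re_divide_of_real Im_divide_of_real)

lemma inj_pole: "j \<in> {1..m} \<Longrightarrow> inj (pole j)"
  using beta_pos'[of j] by (auto simp: inj_def fox_pole_b_def)

lemma finite_poles: "finite ((poles_a \<union> poles_b) \<inter> cball 0 M)"
proof (rule finite_subset)
  let ?Ra = "\<lambda>i. fox_pole_a a \<alpha> i ` {k. norm (fox_pole_a a \<alpha> i k) \<le> M}"
  let ?Rb = "\<lambda>j. pole j ` {l. norm (pole j l) \<le> M}"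
  show "(poles_a \<union> poles_b) \<inter> cball 0 M \<subseteq> (\<Union>i\<in>{1..n}. ?Ra i) \<union> (\<Union>j\<in>{1..m}. ?Rb j)"
    by (auto simp: poles_a_def poles_b_def)
  have "finite {k. norm (fox_pole_a a \<alpha> i k) \<le> M}" if "i \<in> {1..n}" for i
    using finite_arithmetic_progression_bounded[of "1 / of_real (\<alpha> i)" "(1 - a i) / of_real (\<alpha> i)" M] alpha_pos'[OF that]
    by (simp add: fox_pole_a_def add_divide_distrib)
  moreover have "finite {l. norm (pole j l) \<le> M}" if "j \<in> {1..m}" for j
  proof -
    have "pole j l = - b j / of_real (\<beta> j) + of_nat l * (- 1 / of_real (\<beta> j))" for l
      by (simp add: fox_pole_b_def add_divide_distrib)
    then show ?thesis
      using finite_arithmetic_progression_bounded[of "- 1 / of_real (\<beta> j)" "- b j / of_real (\<beta> j)" M] beta_pos'[OF that]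
      by simp
  qed
  ultimately show "finite ((\<Union>i\<in>{1..n}. ?Ra i) \<union> (\<Union>j\<in>{1..m}. ?Rb j))" by blast
qed

lemma open_off_poles: "open (- (poles_a \<union> poles_b))"
  by (rule open_Compl[OF closed_finite_in_balls[OF finite_poles]])

lemma kernel_holomorphic: "kernel holomorphic_on - (poles_a \<union> poles_b)"
proof -
  have "b j + of_real (\<beta> j) * s \<notin> \<int>\<^sub>\<le>\<^sub>0" if "s \<notin> poles_b" "j \<in> {1..m}" for s j
  proof
    assume "b j + of_real (\<beta> j) * s \<in> \<int>\<^sub>\<le>\<^sub>0"
    then obtain l where "b j + of_real (\<beta> j) * s = - of_nat l" by (elim nonpos_Ints_cases') 
    then have "of_real (\<beta> j) * (s - pole j l) = 0" using pole_affine[OF that(2), of s l] by simp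
    then have "s = pole j l" using beta_pos'[OF that(2)] by simp
    then show False using that by (auto simp: poles_b_def)
  qed
  moreover have "1 - a i - of_real (\<alpha> i) * s \<notin> \<int>\<^sub>\<le>\<^sub>0" if "s \<notin> poles_a" "i \<in> {1..n}" for s i
  proof
    assume "1 - a i - of_real (\<alpha> i) * s \<in> \<int>\<^sub>\<le>\<^sub>0"
    then obtain k where "1 - a i - of_real (\<alpha> i) * s = - of_nat k" by (elim nonpos_Ints_cases')
    then have "s = fox_pole_a a \<alpha> i k" using alpha_pos'[OF that(2)]
      by (simp add: fox_pole_a_def field_simps)
    then show False using that by (auto simp: poles_a_def)
  qed
  ultimately show ?thesis unfolding fox_kernel_def
    by (intro holomorphic_intros) auto
qed

lemma integrand_holomorphic: "integrand w holomorphic_on - (poles_a \<union> poles_b)"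
  unfolding fox_integrand_def by (intro holomorphic_intros kernel_holomorphic)

lemma poles_a_bounded_below:
  obtains B where "\<And>s. s \<in> poles_a \<Longrightarrow> B < Re s"
proof -
  define f where "f i = (1 - Re (a i)) / \<alpha> i" for i
  \<comment> \<open>The inserted 0 keeps the set nonempty for n = 0, and subtracting 1 makes the
    bound strict.\<close>
  define B where "B = Min (insert 0 (f ` {1..n})) - 1"
  show ?thesis
  proof (rule that[of B])
    fix s assume "s \<in> poles_a"
    then obtain i k where i: "i \<in> {1..n}" and s: "s = fox_pole_a a \<alpha> i k" by (auto simp: poles_a_def)
    have "Min (insert 0 (f ` {1..n})) \<le> f i" using i by (intro Min_le) auto
    then have "B + 1 \<le> f i" by (simp add: B_def)
    also have "f i \<le> Re s" using alpha_pos'[OF i]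
      by (simp add: s f_def fox_pole_a_def Re_divide_of_real divide_right_mono)
    finally show "B < Re s" by simp
  qed
qed

lemma admissible_mono: "admissible x \<Longrightarrow> y \<le> x \<Longrightarrow> admissible y"
  by (auto simp: admissible_def)

text \<open>One \<eta> is spent on letting w vary in a disc of radius \<eta>, the other remains as
  the rate of exponential decay.\<close>

lemma admissible_room:
  assumes "admissible x"
  obtains \<eta> where "\<eta> > 0" "admissible (x + 2 * \<eta>)"
proof (cases "fox_Delta p q \<alpha> \<beta> > 0")
  case True
  then show ?thesis using that[of 1] by (simp add: admissible_def)
next
  case False
  then have *: "fox_Delta p q \<alpha> \<beta> = 0" "x < ln (fox_delta p q \<alpha> \<beta>)" using assms by (auto simp: admissible_def)
  define \<eta> where "\<eta> = (ln (fox_delta p q \<alpha> \<beta>) - x) / 4"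
  have "\<eta> > 0" "x + 2 * \<eta> < ln (fox_delta p q \<alpha> \<beta>)" using *(2) by (auto simp: \<eta>_def field_simps)
  then show ?thesis using that[of \<eta>] *(1) by (auto simp: admissible_def)
qed

lemma cball_admissible:
  assumes "admissible (Re w0 + 2 * \<eta>)" "w \<in> cball w0 \<eta>"
  shows "admissible (Re w)"
proof (rule admissible_mono[OF assms(1)])
  have "\<bar>Re w - Re w0\<bar> \<le> \<eta>" using assms(2) abs_Re_le_cmod[of "w - w0"] by (auto simp: dist_norm norm_minus_commute)
  then show "Re w \<le> Re w0 + 2 * \<eta>" by linarith
qed

lemma integrand_bound:
  assumes "admissible (Re w0 + 2 * \<eta>)" "\<eta> > 0" "\<epsilon> > 0"
  obtains C X where "C > 0" "\<And>w s. w \<in> cball w0 \<eta> \<Longrightarrow> s \<in> strip_off_poles Y \<epsilon> \<Longrightarrow> Re s \<le> X \<Longrightarrow>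
     norm (integrand w s) \<le> C * exp (\<eta> * Re s)"
proof -
  define \<rho> where "\<rho> = Re w0 + 2 * \<eta>"
  obtain X0 where X0: "\<And>s. s \<in> strip_off_poles Y \<epsilon> \<Longrightarrow> Re s \<le> X0 \<Longrightarrow> norm (kernel s) \<le> exp (\<rho> * Re s)"
    using kernel_bound[OF assms(1,3)] unfolding eventually_left_end \<rho>_def by blast
  define V where "V = \<bar>Im w0\<bar> + \<eta>"
  show ?thesis
  \<comment> \<open>The constant bounds the contribution of \<open>Im s * Im w\<close>. Cutting at 0
    makes \<open>Re s\<close> nonpositive, so that \<open>\<eta> \<le> \<rho> - Re w\<close> is
    reversed upon multiplication by \<open>Re s\<close>.\<close>
  proof (rule that[of "exp (\<bar>Y\<bar> * V)" "min X0 0"])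
    fix w s assume w: "w \<in> cball w0 \<eta>" and s: "s \<in> strip_off_poles Y \<epsilon>" "Re s \<le> min X0 0"
    have "\<bar>Re w - Re w0\<bar> \<le> \<eta>" "\<bar>Im w - Im w0\<bar> \<le> \<eta>"
      using w abs_Re_le_cmod[of "w - w0"] abs_Im_le_cmod[of "w - w0"]
      by (auto simp: dist_norm norm_minus_commute)
    then have Rew: "\<eta> \<le> \<rho> - Re w" and Imw: "\<bar>Im w\<bar> \<le> V" by (auto simp: \<rho>_def V_def)
    have "\<bar>Im s * Im w\<bar> \<le> \<bar>Y\<bar> * V" unfolding abs_mult
      using strip_Im[OF s(1)] Imw by (intro mult_mono) auto
    then have 1: "Im s * Im w \<le> \<bar>Y\<bar> * V" by linarith
    have 2: "(\<rho> - Re w) * Re s \<le> \<eta> * Re s"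
      using Rew s by (intro mult_right_mono_neg) auto
    have "norm (integrand w s) = norm (kernel s) * exp (- (Re s * Re w) + Im s * Im w)"
      by (simp add: fox_integrand_def norm_mult)
    also have "\<dots> \<le> exp (\<rho> * Re s) * exp (- (Re s * Re w) + Im s * Im w)"
      using X0[OF s(1)] s(2) by (intro mult_right_mono) auto
    also have "\<dots> = exp ((\<rho> - Re w) * Re s + Im s * Im w)"
      by (simp add: exp_add[symmetric] algebra_simps)
    also have "\<dots> \<le> exp (\<eta> * Re s + \<bar>Y\<bar> * V)" using 1 2 by simp
    also have "\<dots> = exp (\<bar>Y\<bar> * V) * exp (\<eta> * Re s)" by (simp add: exp_add[symmetric] algebra_simps)
    finally show "norm (integrand w s) \<le> exp (\<bar>Y\<bar> * V) * exp (\<eta> * Re s)" .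
  qed simp
qed

text \<open>If the poles keep a positive distance, each residue is an integral over a circle of
  fixed radius that avoids the other poles. The decay of the integrand then gives a geometric
  majorant of ratio \<open>exp (- (\<eta> / \<beta> j))\<close> along row j.\<close>

lemma summable_residue_term:
  assumes w: "admissible (Re w)" and ud: "uniform_discrete {pole j l | j l. j \<in> {1..m}}" and j: "j \<in> {1..m}"
  shows "summable (residue_term (integrand w) pole j)"
proof -
  obtain d where d: "d > 0" "\<And>s t. s \<in> poles_b \<Longrightarrow> t \<in> poles_b \<Longrightarrow> dist s t < d \<Longrightarrow> s = t"
    using ud unfolding uniform_discrete_def poles_b_def by blast
  \<comment> \<open>At most half the mutual distance: the disc of radius 2 r about a pole contains
    no other point of \<open>poles_b\<close>, and its circle of radius r keeps distance r from all
    of them.\<close>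
  define r where "r = min d 1 / 2"
  have r: "r > 0" "2 * r \<le> d" "r \<le> 1" using d by (auto simp: r_def)
  define Y where "Y = \<bar>Im (b j) / \<beta> j\<bar> + 1"
  obtain \<eta> where \<eta>: "\<eta> > 0" "admissible (Re w + 2 * \<eta>)" using admissible_room[OF w] by blast
  obtain C X where C: "C > 0" "\<And>s. s \<in> strip_off_poles Y r \<Longrightarrow> Re s \<le> X \<Longrightarrow> norm (integrand w s) \<le> C * exp (\<eta> * Re s)"
  proof (rule integrand_bound[OF \<eta>(2,1) r(1), of Y])
    fix C X assume "C > 0" "\<And>w' s. w' \<in> cball w \<eta> \<Longrightarrow> s \<in> strip_off_poles Y r \<Longrightarrow> Re s \<le> X \<Longrightarrow>
       norm (integrand w' s) \<le> C * exp (\<eta> * Re s)"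
    then show ?thesis using that[of C X] \<eta>(1) by simp
  qed
  obtain B where B: "\<And>s. s \<in> poles_a \<Longrightarrow> B < Re s" using poles_a_bounded_below by blast
  have \<beta>: "\<beta> j > 0" by (rule beta_pos'[OF j])
  \<comment> \<open>The 2 in the premise leaves room for the disc of radius 2 r to the left of all
    points of \<open>poles_a\<close>, and for the circle in the range of the decay estimate.\<close>
  have res: "norm (residue (integrand w) (pole j l)) \<le> C * exp (\<eta> * (r - Re (b j) / \<beta> j)) * r * exp (- (\<eta> / \<beta> j)) ^ l"
    if far: "Re (pole j l) + 2 \<le> min B X" for l
  proof -
    define P where "P = pole j l"
    have P: "P \<in> poles_b" using j by (auto simp: P_def poles_b_def)
    have other: "2 * r \<le> dist t P" if "t \<in> poles_b" "t \<noteq> P" for t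
      using d(2)[OF that(1) P] that(2) r by (meson not_le order_trans)
    have hol: "integrand w holomorphic_on ball P (2 * r) - {P}"
    proof (rule holomorphic_on_subset[OF integrand_holomorphic], rule subsetI)
      fix s assume s: "s \<in> ball P (2 * r) - {P}"
      have "s \<notin> poles_b" using other[of s] s by (auto simp: dist_commute)
      moreover have "s \<notin> poles_a"
      proof
        assume "s \<in> poles_a"
        have "Re s - Re P \<le> dist P s" using abs_Re_le_cmod[of "P - s"] by (simp add: dist_norm)
        then show False using B[OF \<open>s \<in> poles_a\<close>] s r far by (auto simp: P_def)
      qed
      ultimately show "s \<in> - (poles_a \<union> poles_b)" by auto
    qed
    have "(integrand w has_contour_integral 2 * pi * \<i> * residue (integrand w) P) (circlepath P r)"
      using r by (intro base_residue[OF open_ball[of P "2 * r"] _ _ hol]) auto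
    moreover have "norm (integrand w s) \<le> C * exp (\<eta> * (Re P + r))" if s: "norm (s - P) = r" for s
    proof -
      have ReIm: "\<bar>Re s - Re P\<bar> \<le> r" "\<bar>Im s - Im P\<bar> \<le> r"
        using s abs_Re_le_cmod[of "s - P"] abs_Im_le_cmod[of "s - P"] by auto
      have "s \<in> strip_off_poles Y r"
        unfolding strip_off_poles_def
      proof (intro CollectI conjI ballI allI)
        show "\<bar>Im s\<bar> \<le> Y" using ReIm(2) r(3) unfolding P_def Im_pole Y_def by linarith
        fix j' l' assume "j' \<in> {1..m}"
        then have t: "pole j' l' \<in> poles_b" by (auto simp: poles_b_def)
        show "r \<le> dist s (pole j' l')"
        proof (cases "pole j' l' = P")
          case True then show ?thesis using s by (simp add: dist_norm)
        next
          case False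
          have "2 * r \<le> dist (pole j' l') P" by (rule other[OF t False])
          also have "\<dots> \<le> dist s (pole j' l') + dist s P" by (rule dist_triangle3)
          finally show ?thesis using s by (simp add: dist_norm)
        qed
      qed
      moreover have "Re s \<le> X" using ReIm(1) r(3) far unfolding P_def by linarith
      ultimately have "norm (integrand w s) \<le> C * exp (\<eta> * Re s)" by (rule C(2))
      also have "\<dots> \<le> C * exp (\<eta> * (Re P + r))" using ReIm(1) C(1) \<eta>(1) by simp
      finally show ?thesis .
    qed
    ultimately have "norm (2 * pi * \<i> * residue (integrand w) P) \<le> C * exp (\<eta> * (Re P + r)) * (2 * pi * r)"
      using C(1) r(1) by (intro has_contour_integral_bound_circlepath) auto
    then have "2 * pi * norm (residue (integrand w) P) \<le> 2 * pi * (C * exp (\<eta> * (Re P + r)) * r)"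
      by (simp add: norm_mult mult_ac)
    then have "norm (residue (integrand w) P) \<le> C * exp (\<eta> * (Re P + r)) * r"
      by (rule mult_left_le_imp_le) simp
    also have "exp (\<eta> * (Re P + r)) = exp (\<eta> * (r - Re (b j) / \<beta> j)) * exp (- (\<eta> / \<beta> j)) ^ l"
      unfolding P_def Re_pole exp_of_nat_mult[symmetric] exp_add[symmetric]
      by (simp add: add_divide_distrib algebra_simps)
    finally show ?thesis by (simp add: P_def mult_ac)
  qed
  have ev: "eventually (\<lambda>l. Re (pole j l) + 2 \<le> min B X) sequentially"
    unfolding Re_pole using \<beta> by real_asymp
  show ?thesis
  proof (rule summable_comparison_test_ev)
    show "eventually (\<lambda>l. norm (residue_term (integrand w) pole j l)
        \<le> C * exp (\<eta> * (r - Re (b j) / \<beta> j)) * r * exp (- (\<eta> / \<beta> j)) ^ l) sequentially"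
      using ev
    proof eventually_elim
      case (elim l)
      have "norm (residue_term (integrand w) pole j l) \<le> norm (residue (integrand w) (pole j l))"
        by (simp add: residue_term_def)
      then show ?case using res[OF elim] by (rule order_trans)
    qed
    show "summable (\<lambda>l. C * exp (\<eta> * (r - Re (b j) / \<beta> j)) * r * exp (- (\<eta> / \<beta> j)) ^ l)"
      using \<eta>(1) \<beta> by (intro summable_mult summable_geometric) auto
  qed
qed

end

section \<open>The residue expansion for left loops\<close>

text \<open>If the rows converge, their partial sums along \<open>K j\<close> converge to the same
  values because \<open>K j\<close> tends to infinity. Uniqueness of limits then identifies S with
  the iterated series.\<close>

lemma residue_double_seriesI:
  assumes lim: "(\<lambda>N. \<Sum>j=1..m. \<Sum>l<K j N. residue_term f pt j l) \<longlonglongrightarrow> S"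
    and K: "\<And>j. j \<in> {1..m} \<Longrightarrow> filterlim (K j) at_top sequentially"
    and summ: "\<And>j. uniform_discrete {pt j l | j l. j \<in> {1..m}} \<Longrightarrow> j \<in> {1..m} \<Longrightarrow> summable (residue_term f pt j)"
  shows "residue_double_series K f pt m S"
  unfolding residue_double_series_def
proof (intro conjI impI ballI)
  assume summable: "\<forall>j\<in>{1..m}. summable (residue_term f pt j)"
  have "(\<lambda>N. \<Sum>j=1..m. \<Sum>l<K j N. residue_term f pt j l) \<longlonglongrightarrow> (\<Sum>j=1..m. \<Sum>l. residue_term f pt j l)"
  proof (intro tendsto_sum)
    fix j assume j: "j \<in> {1..m}"
    then have "(\<lambda>n. \<Sum>l<n. residue_term f pt j l) \<longlonglongrightarrow> (\<Sum>l. residue_term f pt j l)"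
      using summable by (intro summable_LIMSEQ) auto
    then show "(\<lambda>N. \<Sum>l<K j N. residue_term f pt j l) \<longlonglongrightarrow> (\<Sum>l. residue_term f pt j l)"
      by (rule filterlim_compose[OF _ K[OF j]])
  qed
  then show "S = (\<Sum>j=1..m. \<Sum>l. residue_term f pt j l)"
    using lim LIMSEQ_unique by blast
qed (use lim summ in auto)

context fox
begin

text \<open>At abscissa - R the horizontal distance to a pole of row j is the distance of
  \<open>\<beta> j * R - Re (b j)\<close> from an integer, divided by \<open>\<beta> j\<close>. A
  suitable R is found in each window from N to N + 1.\<close>

lemma separating_abscissae:
  obtains \<epsilon> and R :: "nat \<Rightarrow> real" where "\<epsilon> > 0" "\<And>N. real N \<le> R N"
    "\<And>N j l s. j \<in> {1..m} \<Longrightarrow> Re s = - R N \<Longrightarrow> \<epsilon> \<le> dist s (pole j l)"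
proof -
  obtain \<epsilon> W' where \<epsilon>: "\<epsilon> > 0" "W' > 0" "\<And>x. \<exists>y. x \<le> y \<and> y + W' \<le> x + 1 \<and>
     (\<forall>R\<in>{y..y+W'}. \<forall>j\<in>{1..m}. \<forall>k::int. \<epsilon> \<le> \<bar>\<beta> j * R - Re (b j) - of_int k\<bar>)"
    using far_from_integers_subinterval[of "{1..m}" \<beta> 1 "\<lambda>j. Re (b j)"] beta_pos' by auto
  have "\<exists>y. real N \<le> y \<and> (\<forall>j\<in>{1..m}. \<forall>k::int. \<epsilon> \<le> \<bar>\<beta> j * y - Re (b j) - of_int k\<bar>)" for N
  proof -
    obtain y where "real N \<le> y \<and> y + W' \<le> real N + 1 \<and>
     (\<forall>R\<in>{y..y+W'}. \<forall>j\<in>{1..m}. \<forall>k::int. \<epsilon> \<le> \<bar>\<beta> j * R - Re (b j) - of_int k\<bar>)"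
      using \<epsilon>(3) by blast
    then show ?thesis using \<epsilon>(2) by (intro exI[of _ y]) auto
  qed
  then obtain R where R: "\<And>N. real N \<le> R N"
    "\<And>N j k. j \<in> {1..m} \<Longrightarrow> \<epsilon> \<le> \<bar>\<beta> j * R N - Re (b j) - of_int k\<bar>"
    by metis
  \<comment> \<open>A common bound for all \<open>\<beta> j\<close>, positive also for m =
    0.\<close>
  define B where "B = (\<Sum>j=1..m. \<beta> j) + 1"
  have B: "\<beta> j \<le> B" if "j \<in> {1..m}" for j
    unfolding B_def using member_le_sum[of j "{1..m}" \<beta>] beta_pos' that by (force simp: less_imp_le)
  have "B > 0" unfolding B_def using beta_pos' by (intro add_nonneg_pos sum_nonneg) (auto simp: less_imp_le)
  show ?thesis
  proof (rule that[of "\<epsilon> / B" R])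
    show "\<epsilon> / B > 0" using \<epsilon> \<open>B > 0\<close> by simp
    fix N j l s assume j: "j \<in> {1..m}" and s: "Re s = - R N"
    have \<beta>: "\<beta> j > 0" by (rule beta_pos'[OF j])
    have "\<epsilon> / B \<le> \<epsilon> / \<beta> j" using \<epsilon> \<beta> B[OF j] by (intro divide_left_mono) auto
    also have "\<dots> \<le> \<bar>\<beta> j * R N - Re (b j) - of_int (int l)\<bar> / \<beta> j"
      using R(2)[OF j, of N "int l"] \<beta> by (intro divide_right_mono) auto
    also have "\<dots> = \<bar>Re s - Re (pole j l)\<bar>"
    proof -
      have "Re s - Re (pole j l) = - ((\<beta> j * R N - Re (b j) - of_int (int l)) / \<beta> j)"
        using \<beta> by (simp add: s Re_pole field_simps)
      then show ?thesis using \<beta> by (simp only: abs_minus_cancel abs_divide abs_of_pos)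
    qed
    also have "\<dots> \<le> dist s (pole j l)" using abs_Re_le_cmod[of "s - pole j l"] by (simp add: dist_norm)
    finally show "\<epsilon> / B \<le> dist s (pole j l)" .
  qed (rule R(1))
qed

lemma fox_left_loop_poles:
  assumes "fox_left_loop m n a \<alpha> b \<beta> \<phi>1 \<phi>2 c g"
  shows "poles_b \<subseteq> left_loop_inside \<phi>1 \<phi>2 c g" "poles_a \<subseteq> left_loop_outside \<phi>1 \<phi>2 c g"
proof -
  show "poles_b \<subseteq> left_loop_inside \<phi>1 \<phi>2 c g"
  proof
    fix s assume "s \<in> poles_b"
    then obtain j l where j: "j \<in> {1..m}" and s: "s = pole j l" by (auto simp: poles_b_def)
    have "is_pole (\<lambda>s. Gamma (b j + of_real (\<beta> j) * s)) ((- of_nat l - b j) / of_real (\<beta> j))"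
      using beta_pos'[OF j] by (intro is_pole_Gamma_affine) auto
    also have "(- of_nat l - b j) / of_real (\<beta> j) = s"
      using beta_pos'[OF j] by (simp add: s fox_pole_b_def field_simps)
    finally show "s \<in> left_loop_inside \<phi>1 \<phi>2 c g" using assms j by (simp add: fox_left_loop_def)
  qed
  show "poles_a \<subseteq> left_loop_outside \<phi>1 \<phi>2 c g"
  proof
    fix s assume "s \<in> poles_a"
    then obtain i k where i: "i \<in> {1..n}" and s: "s = fox_pole_a a \<alpha> i k" by (auto simp: poles_a_def)
    have "is_pole (\<lambda>s. Gamma ((1 - a i) + (- of_real (\<alpha> i)) * s)) ((- of_nat k - (1 - a i)) / (- of_real (\<alpha> i)))"
      using alpha_pos'[OF i] by (intro is_pole_Gamma_affine) auto
    also have "(\<lambda>s. Gamma ((1 - a i) + (- of_real (\<alpha> i)) * s)) = (\<lambda>s. Gamma (1 - a i - of_real (\<alpha> i) * s))"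
      by simp
    also have "(- of_nat k - (1 - a i)) / (- of_real (\<alpha> i)) = s"
      using alpha_pos'[OF i] by (simp add: s fox_pole_a_def field_simps)
    finally show "s \<in> left_loop_outside \<phi>1 \<phi>2 c g" using assms i by (simp add: fox_left_loop_def)
  qed
qed

text \<open>Each row lies on one horizontal line. If this were the line of a half-line of the loop,
  the far members of the row would lie on the loop. So the heights differ, and there are finitely
  many rows.\<close>

lemma horizontal_distance:
  assumes off: "poles_b \<inter> left_loop_image \<phi>1 \<phi>2 c g = {}"
  obtains \<epsilon> where "\<epsilon> > 0" "\<And>s j l. Im s = \<phi>1 \<or> Im s = \<phi>2 \<Longrightarrow> j \<in> {1..m} \<Longrightarrow> \<epsilon> \<le> dist s (pole j l)"
proof -
  define D where "D = (\<lambda>t. \<bar>fst t + Im (b (snd t)) / \<beta> (snd t)\<bar>) ` ({\<phi>1, \<phi>2} \<times> {1..m})"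
  have fin: "finite D" unfolding D_def by auto
  have pos: "0 < x" if "x \<in> D" for x
  proof -
    obtain t where t: "t \<in> {\<phi>1, \<phi>2} \<times> {1..m}" "x = \<bar>fst t + Im (b (snd t)) / \<beta> (snd t)\<bar>"
      using \<open>x \<in> D\<close> unfolding D_def by blast
    obtain \<phi> j where \<phi>: "\<phi> = \<phi>1 \<or> \<phi> = \<phi>2" and j: "j \<in> {1..m}" and x: "x = \<bar>\<phi> + Im (b j) / \<beta> j\<bar>"
      by (rule that[of "fst t" "snd t"]) (use t in auto)
    have "\<phi> + Im (b j) / \<beta> j \<noteq> 0"
    proof
      assume eq: "\<phi> + Im (b j) / \<beta> j = 0"
      have \<beta>: "\<beta> j > 0" by (rule beta_pos'[OF j])
      obtain l :: nat where "- c * \<beta> j - Re (b j) \<le> real l" using real_arch_simple by blast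
      then have "Re (pole j l) \<le> c" using \<beta> unfolding Re_pole by (simp add: field_simps)
      moreover have "Im (pole j l) = \<phi>" using eq by (simp add: Im_pole)
      ultimately have "pole j l \<in> left_loop_image \<phi>1 \<phi>2 c g" using \<phi> by (auto simp: left_loop_image_def)
      then show False using off j by (auto simp: poles_b_def)
    qed
    then show ?thesis by (simp add: x)
  qed
  define \<epsilon> where "\<epsilon> = Min (insert 1 D)"
  show ?thesis
  proof (rule that[of \<epsilon>])
    show "\<epsilon> > 0" unfolding \<epsilon>_def using fin pos by simp
    fix s j l assume s: "Im s = \<phi>1 \<or> Im s = \<phi>2" and j: "j \<in> {1..m}"
    have "\<bar>Im s + Im (b j) / \<beta> j\<bar> \<in> D"
      unfolding D_def using s j by (intro image_eqI[of _ _ "(Im s, j)"]) auto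
    then have "\<epsilon> \<le> \<bar>Im s + Im (b j) / \<beta> j\<bar>" unfolding \<epsilon>_def using fin by (intro Min_le) auto
    also have "\<dots> = \<bar>Im (s - pole j l)\<bar>" by (simp add: Im_pole)
    also have "\<dots> \<le> dist s (pole j l)" unfolding dist_norm by (rule abs_Im_le_cmod)
    finally show "\<epsilon> \<le> dist s (pole j l)" .
  qed
qed

text \<open>\<open>K\<close> is chosen ahead of the loop and of w, as the abscissae behind it
  involve only the poles. One choice therefore serves every loop and every admissible w.\<close>

proposition left_loop_residue_expansion:
  obtains K where "\<And>j. j \<in> {1..m} \<Longrightarrow> filterlim (K j) at_top sequentially"
    "\<And>\<phi>1 \<phi>2 c g w. fox_left_loop m n a \<alpha> b \<beta> \<phi>1 \<phi>2 c g \<Longrightarrow> admissible (Re w) \<Longrightarrow>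
       left_loop_integrable \<phi>1 \<phi>2 c g (integrand w)"
    "\<And>\<phi>1 \<phi>2 c g w. fox_left_loop m n a \<alpha> b \<beta> \<phi>1 \<phi>2 c g \<Longrightarrow> admissible (Re w) \<Longrightarrow>
       residue_double_series K (integrand w) pole m
         (1 / (2 * of_real pi * \<i>) * left_loop_integral \<phi>1 \<phi>2 c g (integrand w))"
    "\<And>\<phi>1 \<phi>2 c g. fox_left_loop m n a \<alpha> b \<beta> \<phi>1 \<phi>2 c g \<Longrightarrow>
       (\<lambda>w. left_loop_integral \<phi>1 \<phi>2 c g (integrand w)) holomorphic_on {w. admissible (Re w)}"
proof -
  obtain \<epsilon>1 R where \<epsilon>1: "\<epsilon>1 > 0" and R: "\<And>N. real N \<le> R N"
    and vert: "\<And>N j l s. j \<in> {1..m} \<Longrightarrow> Re s = - R N \<Longrightarrow> \<epsilon>1 \<le> dist s (pole j l)"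
    using separating_abscissae by blast
  have R_lim: "filterlim R at_top sequentially"
    by (rule filterlim_at_top_mono[OF filterlim_real_sequentially]) (use R in auto)
  \<comment> \<open>The number of poles of row j to the right of - R N: for natural l, being below
    the ceiling means being below the real number itself. All rows are cut at the same abscissa,
    hence coinciding points are cut together.\<close>
  define K where "K j N = nat \<lceil>\<beta> j * R N - Re (b j)\<rceil>" for j N
  have less_K: "l < K j N \<longleftrightarrow> - R N < Re (pole j l)" if j: "j \<in> {1..m}" for j l N
  proof -
    have "l < K j N \<longleftrightarrow> real l < \<beta> j * R N - Re (b j)" unfolding K_def by linarith
    also have "\<dots> \<longleftrightarrow> - R N < Re (pole j l)"
      using beta_pos'[OF j] by (simp add: Re_pole field_simps)
    finally show ?thesis .
  qed
  have K_lim: "filterlim (K j) at_top sequentially" if j: "j \<in> {1..m}" for j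
  proof -
    have "filterlim (\<lambda>x. \<beta> j * x - Re (b j)) at_top at_top"
      using beta_pos'[OF j] by real_asymp
    then have lim: "filterlim (\<lambda>N. \<beta> j * R N - Re (b j)) at_top sequentially"
      by (rule filterlim_compose[OF _ R_lim])
    show ?thesis unfolding filterlim_at_top
    proof
      fix Z :: nat
      have "eventually (\<lambda>N. real Z \<le> \<beta> j * R N - Re (b j)) sequentially"
        using lim unfolding filterlim_at_top by blast
      then show "eventually (\<lambda>N. Z \<le> K j N) sequentially"
        by eventually_elim (simp add: K_def, linarith)
    qed
  qed
  show ?thesis
  proof (rule that[of K])
    fix \<phi>1 \<phi>2 c g assume loop: "fox_left_loop m n a \<alpha> b \<beta> \<phi>1 \<phi>2 c g"
    interpret left_loop \<phi>1 \<phi>2 c g using loop by unfold_locales (simp add: fox_left_loop_def)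
    note sides = fox_left_loop_poles[OF loop]
    define \<Omega> where "\<Omega> = - (poles_a \<union> poles_b)"
    have \<Omega>: "open \<Omega>" "\<And>w. integrand w holomorphic_on \<Omega>" "L \<subseteq> \<Omega>"
      unfolding \<Omega>_def using open_off_poles integrand_holomorphic sides left_loop_inside_subset left_loop_outside_subset
      by auto
    obtain \<epsilon>2 where \<epsilon>2: "\<epsilon>2 > 0" "\<And>s j l. Im s = \<phi>1 \<or> Im s = \<phi>2 \<Longrightarrow> j \<in> {1..m} \<Longrightarrow> \<epsilon>2 \<le> dist s (pole j l)"
      using horizontal_distance[of \<phi>1 \<phi>2 c g] \<Omega>(3) unfolding \<Omega>_def by blast
    define \<epsilon> where "\<epsilon> = min \<epsilon>1 \<epsilon>2"
    define Y where "Y = max \<bar>\<phi>1\<bar> \<bar>\<phi>2\<bar>"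
    have \<epsilon>: "\<epsilon> > 0" using \<epsilon>1 \<epsilon>2 by (simp add: \<epsilon>_def)
    have horiz_mem: "s \<in> strip_off_poles Y \<epsilon>" if "Im s = \<phi>1 \<or> Im s = \<phi>2" for s
      using that \<epsilon>2(2)[OF that] by (auto simp: strip_off_poles_def Y_def \<epsilon>_def min.coboundedI2)
    have vert_mem: "s \<in> strip_off_poles Y \<epsilon>" if "Re s = - R N" "\<phi>1 \<le> Im s" "Im s \<le> \<phi>2" for s N
      using that vert by (auto simp: strip_off_poles_def Y_def \<epsilon>_def min.coboundedI1)
    have "bounded (path_image g)" using valid_g by (simp add: bounded_path_image valid_path_imp_path)
    then obtain G where G: "\<And>s. s \<in> path_image g \<Longrightarrow> norm s \<le> G" by (auto simp: bounded_iff)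
    obtain A where A: "\<And>s. s \<in> poles_a \<Longrightarrow> A < Re s" using poles_a_bounded_below by blast
    let ?F = "\<lambda>w. left_loop_integral \<phi>1 \<phi>2 c g (integrand w)"

    have local_bound: "\<exists>\<eta> C X. \<eta> > 0 \<and> C > 0 \<and> cball w0 \<eta> \<subseteq> {w. admissible (Re w)} \<and> X \<le> c \<and>
        (\<forall>w\<in>cball w0 \<eta>. \<forall>s\<in>strip_off_poles Y \<epsilon>. Re s \<le> X \<longrightarrow> norm (integrand w s) \<le> C * exp (\<eta> * Re s))"
      if w0: "admissible (Re w0)" for w0
    proof -
      obtain \<eta> where \<eta>: "\<eta> > 0" "admissible (Re w0 + 2 * \<eta>)" using admissible_room[OF w0] by blast
      obtain C X where CX: "C > 0" "\<And>w s. w \<in> cball w0 \<eta> \<Longrightarrow> s \<in> strip_off_poles Y \<epsilon> \<Longrightarrow> Re s \<le> X \<Longrightarrow>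
         norm (integrand w s) \<le> C * exp (\<eta> * Re s)"
        using integrand_bound[OF \<eta>(2,1) \<epsilon>] by blast
      have "cball w0 \<eta> \<subseteq> {w. admissible (Re w)}" using cball_admissible[OF \<eta>(2)] by blast
      then show ?thesis
        using \<eta>(1) CX by (intro exI[of _ \<eta>] exI[of _ C] exI[of _ "min X c"]) auto
    qed
    have approx: "left_loop_integrable \<phi>1 \<phi>2 c g (integrand w)"
      "\<And>r. - r \<le> X \<Longrightarrow> - r < c \<Longrightarrow> norm (?F w - contour_integral (truncated_loop r) (integrand w)) \<le> 2 * (C * exp (- \<eta> * r) / \<eta>)"
      if "\<eta> > 0" "X \<le> c" "\<And>s. s \<in> strip_off_poles Y \<epsilon> \<Longrightarrow> Re s \<le> X \<Longrightarrow> norm (integrand w s) \<le> C * exp (\<eta> * Re s)"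
      for w \<eta> C X
      using left_loop_integral_approx[OF that(2) \<Omega>(1) \<Omega>(2) \<Omega>(3) that(1), of w C] that(3) horiz_mem by blast+

    show "left_loop_integrable \<phi>1 \<phi>2 c g (integrand w)" if w: "admissible (Re w)" for w
    proof -
      obtain \<eta> C X where *: "\<eta> > 0" "X \<le> c"
        "\<forall>w'\<in>cball w \<eta>. \<forall>s\<in>strip_off_poles Y \<epsilon>. Re s \<le> X \<longrightarrow> norm (integrand w' s) \<le> C * exp (\<eta> * Re s)"
        using local_bound[OF w] by blast
      then show ?thesis using approx(1)[of \<eta> X w C] by simp
    qed

    show "?F holomorphic_on {w. admissible (Re w)}"
    \<comment> \<open>No vertical segments occur here, so the abscissae need not avoid poles. Adding
      |c| keeps the cut to the left of c.\<close>
    proof (rule holomorphic_uniform_sequence[where f = "\<lambda>N w. contour_integral (truncated_loop (real N + \<bar>c\<bar>)) (integrand w)"])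
      show "open {w. admissible (Re w)}"
      proof (cases "fox_Delta p q \<alpha> \<beta> = 0")
        case True
        then show ?thesis by (simp add: admissible_def open_halfspace_Re_lt)
      qed (simp add: admissible_def)
      fix N
      have "path_image (truncated_loop (real N + \<bar>c\<bar>)) \<subseteq> \<Omega>"
        by (rule order_trans[OF path_image_truncated_subset \<Omega>(3)]) linarith
      then have "(\<lambda>w. contour_integral (truncated_loop (real N + \<bar>c\<bar>)) (integrand w)) holomorphic_on UNIV"
        unfolding fox_integrand_def using \<Omega>(1) kernel_holomorphic
        by (intro contour_integral_exp_entire[of \<Omega>]) (auto simp: \<Omega>_def)
      then show "(\<lambda>w. contour_integral (truncated_loop (real N + \<bar>c\<bar>)) (integrand w)) holomorphic_on {w. admissible (Re w)}"
        by (rule holomorphic_on_subset) simp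
    next
      fix w0 assume "w0 \<in> {w. admissible (Re w)}"
      then have "admissible (Re w0)" by simp
      from local_bound[OF this] obtain \<eta> C X where *: "\<eta> > 0" "C > 0" "cball w0 \<eta> \<subseteq> {w. admissible (Re w)}" "X \<le> c"
        "\<forall>w\<in>cball w0 \<eta>. \<forall>s\<in>strip_off_poles Y \<epsilon>. Re s \<le> X \<longrightarrow> norm (integrand w s) \<le> C * exp (\<eta> * Re s)"
        by blast
      have "uniform_limit (cball w0 \<eta>) (\<lambda>N w. contour_integral (truncated_loop (real N + \<bar>c\<bar>)) (integrand w)) ?F sequentially"
      proof (rule uniform_limitI)
        fix e :: real assume "e > 0"
        have "(\<lambda>N. 2 * (C * exp (- \<eta> * (real N + \<bar>c\<bar>)) / \<eta>)) \<longlonglongrightarrow> 0" using *(1) by real_asymp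
        then have "eventually (\<lambda>N. 2 * (C * exp (- \<eta> * (real N + \<bar>c\<bar>)) / \<eta>) < e) sequentially"
          using \<open>e > 0\<close> by (rule order_tendstoD)
        moreover have "eventually (\<lambda>N. - (real N + \<bar>c\<bar>) \<le> X) sequentially" by real_asymp
        moreover have "eventually (\<lambda>N. N > 0) sequentially" by (rule eventually_gt_at_top)
        ultimately show "\<forall>\<^sub>F N in sequentially. \<forall>w\<in>cball w0 \<eta>. dist (contour_integral (truncated_loop (real N + \<bar>c\<bar>)) (integrand w)) (?F w) < e"
        proof eventually_elim
          case (elim N)
          show ?case
          proof
            fix w assume "w \<in> cball w0 \<eta>"
            then have "norm (?F w - contour_integral (truncated_loop (real N + \<bar>c\<bar>)) (integrand w)) \<le> 2 * (C * exp (- \<eta> * (real N + \<bar>c\<bar>)) / \<eta>)"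
              using * elim by (intro approx(2)[of \<eta> X]) auto
            then show "dist (contour_integral (truncated_loop (real N + \<bar>c\<bar>)) (integrand w)) (?F w) < e"
              using elim(1) by (simp add: dist_norm norm_minus_commute)
          qed
        qed
      qed
      then show "\<exists>d>0. cball w0 d \<subseteq> {w. admissible (Re w)} \<and>
         uniform_limit (cball w0 d) (\<lambda>N w. contour_integral (truncated_loop (real N + \<bar>c\<bar>)) (integrand w)) ?F sequentially"
        using * by blast
    qed

    show "residue_double_series K (integrand w) pole m (1 / (2 * of_real pi * \<i>) * ?F w)"
      if w: "admissible (Re w)" for w
    proof (rule residue_double_seriesI)
      show "filterlim (K j) at_top sequentially" if "j \<in> {1..m}" for j by (rule K_lim[OF that])
      show "summable (residue_term (integrand w) pole j)"
        if "uniform_discrete {pole j l |j l. j \<in> {1..m}}" "j \<in> {1..m}" for j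
        by (rule summable_residue_term[OF w that])
      obtain \<eta> C X where *: "\<eta> > 0" "C > 0" "X \<le> c"
        "\<forall>w'\<in>cball w \<eta>. \<forall>s\<in>strip_off_poles Y \<epsilon>. Re s \<le> X \<longrightarrow> norm (integrand w' s) \<le> C * exp (\<eta> * Re s)"
        using local_bound[OF w] by blast
      then have bd: "norm (integrand w s) \<le> C * exp (\<eta> * Re s)" if "s \<in> strip_off_poles Y \<epsilon>" "Re s \<le> X" for s
        using that by simp
      define T where "T N = contour_integral (truncated_loop (R N)) (integrand w)" for N
      define V where "V N = contour_integral (linepath (Complex (- R N) \<phi>2) (Complex (- R N) \<phi>1)) (integrand w)" for N
      \<comment> \<open>The four thresholds put the cut in the range of the decay estimate, to the
        left of c, to the left of g, and to the left of all points of
        \<open>poles_a\<close>.\<close>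
      have ev: "eventually (\<lambda>N. R N > max (max (-X) (-c)) (max G (-A))) sequentially"
        using R_lim unfolding filterlim_at_top_dense by blast
      have T_lim: "T \<longlonglongrightarrow> ?F w"
      proof -
        have "eventually (\<lambda>N. norm (T N - ?F w) \<le> 2 * (C * exp (- \<eta> * R N) / \<eta>)) sequentially"
          using ev
        proof eventually_elim
          case (elim N)
          then have "norm (?F w - T N) \<le> 2 * (C * exp (- \<eta> * R N) / \<eta>)"
            unfolding T_def using * bd by (intro approx(2)[of \<eta> X]) auto
          then show ?case by (simp add: norm_minus_commute)
        qed
        moreover have "((\<lambda>x. 2 * (C * exp (- \<eta> * x) / \<eta>)) \<longlongrightarrow> 0) at_top" using *(1) by real_asymp
        then have "(\<lambda>N. 2 * (C * exp (- \<eta> * R N) / \<eta>)) \<longlonglongrightarrow> 0" by (rule filterlim_compose[OF _ R_lim])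
        ultimately have "(\<lambda>N. T N - ?F w) \<longlonglongrightarrow> 0" by (rule Lim_null_comparison)
        then show ?thesis by (rule LIM_zero_cancel)
      qed
      have V_lim: "V \<longlonglongrightarrow> 0"
      proof -
        have "eventually (\<lambda>N. norm (V N) \<le> C * exp (- \<eta> * R N) * (\<phi>2 - \<phi>1)) sequentially"
          using ev
        proof eventually_elim
          case (elim N)
          have mem: "s \<in> strip_off_poles Y \<epsilon>" "Re s = - R N"
            if "s \<in> closed_segment (Complex (- R N) \<phi>2) (Complex (- R N) \<phi>1)" for s
            using that heights vert_mem[of s N] by (auto simp: closed_segment_same_Re closed_segment_eq_real_ivl)
          have cont: "continuous_on (closed_segment (Complex (- R N) \<phi>2) (Complex (- R N) \<phi>1)) (integrand w)"
          proof (rule holomorphic_on_imp_continuous_on[OF holomorphic_on_subset[OF \<Omega>(2)]], rule subsetI)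
            fix s assume "s \<in> closed_segment (Complex (- R N) \<phi>2) (Complex (- R N) \<phi>1)"
            note mem = mem[OF this]
            have "s \<notin> poles_a" using A[of s] mem(2) elim by auto
            moreover have "s \<notin> poles_b"
            proof
              assume "s \<in> poles_b"
              then obtain j l where "j \<in> {1..m}" "s = pole j l" by (auto simp: poles_b_def)
              then have "\<epsilon> \<le> dist s s" using mem(1) unfolding strip_off_poles_def by blast
              then show False using \<epsilon> by simp
            qed
            ultimately show "s \<in> \<Omega>" by (simp add: \<Omega>_def)
          qed
          have "norm (V N) \<le> (C * exp (\<eta> * (- R N))) * norm (Complex (- R N) \<phi>1 - Complex (- R N) \<phi>2)"
            unfolding V_def
          proof (rule contour_integral_bound_linepath)
            show "integrand w contour_integrable_on linepath (Complex (- R N) \<phi>2) (Complex (- R N) \<phi>1)"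
              by (rule contour_integrable_continuous_linepath[OF cont])
            show "0 \<le> C * exp (\<eta> * (- R N))" using * by simp
            show "norm (integrand w s) \<le> C * exp (\<eta> * (- R N))"
              if "s \<in> closed_segment (Complex (- R N) \<phi>2) (Complex (- R N) \<phi>1)" for s
              using bd[OF mem(1)[OF that]] mem(2)[OF that] elim by simp
          qed
          also have "norm (Complex (- R N) \<phi>1 - Complex (- R N) \<phi>2) = \<phi>2 - \<phi>1"
            using heights by (simp add: cmod_def)
          finally show ?case by simp
        qed
        moreover have "((\<lambda>x. C * exp (- \<eta> * x) * (\<phi>2 - \<phi>1)) \<longlongrightarrow> 0) at_top" using *(1) by real_asymp
        then have "(\<lambda>N. C * exp (- \<eta> * R N) * (\<phi>2 - \<phi>1)) \<longlonglongrightarrow> 0" by (rule filterlim_compose[OF _ R_lim])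
        ultimately show ?thesis by (rule Lim_null_comparison)
      qed
      have "(\<lambda>N. 1 / (2 * of_real pi * \<i>) * (T N + V N)) \<longlonglongrightarrow> 1 / (2 * of_real pi * \<i>) * (?F w + 0)"
        by (intro tendsto_intros T_lim V_lim)
      then have lim: "(\<lambda>N. 1 / (2 * of_real pi * \<i>) * (T N + V N)) \<longlonglongrightarrow> 1 / (2 * of_real pi * \<i>) * ?F w"
        by simp
      have "eventually (\<lambda>N. 1 / (2 * of_real pi * \<i>) * (T N + V N) =
          (\<Sum>j=1..m. \<Sum>l<K j N. residue_term (integrand w) pole j l)) sequentially"
        using ev
      proof eventually_elim
        case (elim N)
        have set_eq: "{p. p \<in> poles_b \<and> - R N < Re p} = (\<Union>j\<in>{1..m}. pole j ` {..<K j N})"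
          using less_K by (auto simp: poles_b_def)
        have "T N + V N = 2 * pi * \<i> * (\<Sum>p | p \<in> poles_b \<and> - R N < Re p. residue (integrand w) p)"
          unfolding T_def V_def
        proof (rule residues_truncated_loop[where P = "poles_a \<union> poles_b"])
          show "finite {p \<in> poles_b. - R N < Re p}" unfolding set_eq by simp
          show "path_image g \<subseteq> {s. - R N < Re s}"
          proof
            fix s assume "s \<in> path_image g"
            then show "s \<in> {s. - R N < Re s}" using G[of s] abs_Re_le_cmod[of s] elim by auto
          qed
          show "Re s \<noteq> - R N" if s: "s \<in> poles_a \<union> poles_b" for s
          proof (cases "s \<in> poles_a")
            case True
            then show ?thesis using A[of s] elim by auto
          next
            case False
            then obtain j l where "j \<in> {1..m}" "s = pole j l" using s by (auto simp: poles_b_def)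
            then show ?thesis using vert[of j s N l] \<epsilon>1 by auto
          qed
          show "- R N < Re s" if "s \<in> poles_a \<union> poles_b - poles_b" for s
            using A[of s] that elim by auto
        qed (use integrand_holomorphic finite_poles sides in auto)
        also have "(\<Sum>p | p \<in> poles_b \<and> - R N < Re p. residue (integrand w) p) =
            (\<Sum>j=1..m. \<Sum>l<K j N. residue_term (integrand w) pole j l)"
          unfolding set_eq
        proof (rule sum_residue_term[symmetric])
          show "inj (pole j)" if "j \<in> {1..m}" for j by (rule inj_pole[OF that])
          show "l' < K j' N" if "j \<in> {1..m}" "j' \<in> {1..m}" "pole j l = pole j' l'" "l < K j N" for j j' l l'
            using that less_K by simp
        qed
        finally show ?case by simp
      qed
      from Lim_transform_eventually[OF lim this]
      show "(\<lambda>N. \<Sum>j=1..m. \<Sum>l<K j N. residue_term (integrand w) pole j l) \<longlonglongrightarrow> 1 / (2 * of_real pi * \<i>) * ?F w" .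
    qed
  qed (rule K_lim)
qed

end

section \<open>Reflection\<close>

lemma connected_component_uminus:
  fixes S :: "complex set"
  assumes "connected_component (- S) s t"
  shows "connected_component (- (uminus ` S)) (- s) (- t)"
proof -
  obtain T where T: "connected T" "T \<subseteq> - S" "s \<in> T" "t \<in> T"
    using assms by (auto simp: connected_component_def)
  have "connected (uminus ` T)"
    using T(1) by (intro connected_continuous_image continuous_intros)
  moreover have "uminus ` T \<subseteq> - (uminus ` S)" using T(2) by auto
  ultimately show ?thesis using T(3,4) unfolding connected_component_def by blast
qed

text \<open>Negation turns upwards into downwards, so the path is reversed to lead from the lower to
  the higher level again.\<close>

lemma loop_link_reflect:
  assumes "loop_link \<phi>1 \<phi>2 c g"
  shows "loop_link (- \<phi>2) (- \<phi>1) (- c) (reversepath (uminus \<circ> g))"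
  using assms
  by (auto simp: loop_link_def valid_path_negatepath pathstart_compose pathfinish_compose complex_eq_iff)

lemma left_loop_image_reflect:
  "left_loop_image (- \<phi>2) (- \<phi>1) (- c) (reversepath (uminus \<circ> g)) = uminus ` right_loop_image \<phi>1 \<phi>2 c g"
proof -
  have "{s. Im s \<in> {- \<phi>2, - \<phi>1} \<and> Re s \<le> - c} = uminus ` {s. Im s \<in> {\<phi>1, \<phi>2} \<and> c \<le> Re s}"
  proof (intro equalityI subsetI)
    fix s assume "s \<in> {s. Im s \<in> {- \<phi>2, - \<phi>1} \<and> Re s \<le> - c}"
    then show "s \<in> uminus ` {s. Im s \<in> {\<phi>1, \<phi>2} \<and> c \<le> Re s}"
      by (intro image_eqI[of _ _ "- s"]) auto
  qed auto
  then show ?thesis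
    by (simp add: left_loop_image_def right_loop_image_def path_image_compose image_Un)
qed

lemma right_loop_inside_reflect:
  assumes "s \<in> right_loop_inside \<phi>1 \<phi>2 c g"
  shows "- s \<in> left_loop_inside (- \<phi>2) (- \<phi>1) (- c) (reversepath (uminus \<circ> g))"
proof -
  obtain X where X: "\<And>t. X < Re t \<Longrightarrow> \<phi>1 < Im t \<Longrightarrow> Im t < \<phi>2 \<Longrightarrow>
      connected_component (- right_loop_image \<phi>1 \<phi>2 c g) s t"
    using assms unfolding right_loop_inside_def by blast
  have "connected_component (- (uminus ` right_loop_image \<phi>1 \<phi>2 c g)) (- s) t"
    if "Re t < - X" "- \<phi>2 < Im t" "Im t < - \<phi>1" for t
    using connected_component_uminus[OF X[of "- t"]] that by simp
  then show ?thesis unfolding left_loop_inside_def left_loop_image_reflect by blast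
qed

lemma right_loop_outside_reflect:
  assumes "s \<in> right_loop_outside \<phi>1 \<phi>2 c g"
  shows "- s \<in> left_loop_outside (- \<phi>2) (- \<phi>1) (- c) (reversepath (uminus \<circ> g))"
proof -
  obtain X where X: "\<And>t. Re t < X \<Longrightarrow> connected_component (- right_loop_image \<phi>1 \<phi>2 c g) s t"
    using assms unfolding right_loop_outside_def by blast
  have "connected_component (- (uminus ` right_loop_image \<phi>1 \<phi>2 c g)) (- s) t" if "- X < Re t" for t
    using connected_component_uminus[OF X[of "- t"]] that by simp
  then show ?thesis unfolding left_loop_outside_def left_loop_image_reflect by blast
qed

lemma is_pole_reflect:
  assumes "is_pole f (s :: complex)"
  shows "is_pole (\<lambda>x. f (- x)) (- s)"
proof (rule is_pole_compose[OF assms])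
  show "uminus \<midarrow>- s\<rightarrow> s" by (rule tendsto_eq_intros refl | simp)+
  show "\<forall>\<^sub>F x in at (- s). - x \<noteq> s"
    using eventually_neq_at_within[of "- s" "- s"] by eventually_elim auto
qed

lemma fox_left_loop_reflect:
  assumes "fox_right_loop m n a \<alpha> b \<beta> \<phi>1 \<phi>2 c g"
  shows "fox_left_loop n m (\<lambda>j. 1 - b j) \<beta> (\<lambda>i. 1 - a i) \<alpha> (- \<phi>2) (- \<phi>1) (- c) (reversepath (uminus \<circ> g))"
  unfolding fox_left_loop_def
proof (intro conjI ballI allI impI)
  show "loop_link (- \<phi>2) (- \<phi>1) (- c) (reversepath (uminus \<circ> g))"
    using assms by (intro loop_link_reflect) (simp add: fox_right_loop_def)
next
  fix i s assume i: "i \<in> {1..n}" and "is_pole (\<lambda>s. Gamma (1 - a i + of_real (\<alpha> i) * s)) s"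
  then have "is_pole (\<lambda>s. Gamma (1 - a i - of_real (\<alpha> i) * s)) (- s)"
    using is_pole_reflect[of "\<lambda>s. Gamma (1 - a i + of_real (\<alpha> i) * s)" s] by simp
  then have "- s \<in> right_loop_inside \<phi>1 \<phi>2 c g" using assms i by (simp add: fox_right_loop_def)
  from right_loop_inside_reflect[OF this]
  show "s \<in> left_loop_inside (- \<phi>2) (- \<phi>1) (- c) (reversepath (uminus \<circ> g))" by simp
next
  fix j s assume j: "j \<in> {1..m}" and "is_pole (\<lambda>s. Gamma (1 - (1 - b j) - of_real (\<beta> j) * s)) s"
  then have "is_pole (\<lambda>s. Gamma (b j + of_real (\<beta> j) * s)) (- s)"
    using is_pole_reflect[of "\<lambda>s. Gamma (1 - (1 - b j) - of_real (\<beta> j) * s)" s] by simp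
  then have "- s \<in> right_loop_outside \<phi>1 \<phi>2 c g" using assms j by (simp add: fox_right_loop_def)
  from right_loop_outside_reflect[OF this]
  show "s \<in> left_loop_outside (- \<phi>2) (- \<phi>1) (- c) (reversepath (uminus \<circ> g))" by simp
qed

text \<open>No sign appears: the change from ds to - ds is compensated by the reversed direction of
  the loop.\<close>

lemma right_loop_integral_reflect:
  assumes g: "valid_path g"
    and int: "left_loop_integrable (- \<phi>2) (- \<phi>1) (- c) (reversepath (uminus \<circ> g)) (\<lambda>s. f (- s))"
  shows "right_loop_integrable \<phi>1 \<phi>2 c g f"
    and "right_loop_integral \<phi>1 \<phi>2 c g f =
      left_loop_integral (- \<phi>2) (- \<phi>1) (- c) (reversepath (uminus \<circ> g)) (\<lambda>s. f (- s))"
proof -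
  have half: "(\<lambda>x. f (Complex x y)) integrable_on {c..} \<and>
     integral {c..} (\<lambda>x. f (Complex x y)) = integral {..- c} (\<lambda>x. f (- Complex x (- y)))"
    if "(\<lambda>x. f (- Complex x (- y))) integrable_on {..- c}" for y
  proof -
    have "((\<lambda>x. f (- Complex (- x) (- y))) has_integral integral {..- c} (\<lambda>x. f (- Complex x (- y)))) {x. - x \<in> {..- c}}"
      using that by (intro has_integral_reflect_set integrable_integral)
    moreover have "- Complex (- x) (- y) = Complex x y" for x by (simp add: complex_eq_iff)
    moreover have "{x. - x \<in> {..- c}} = {c..}" by auto
    ultimately have "((\<lambda>x. f (Complex x y)) has_integral integral {..- c} (\<lambda>x. f (- Complex x (- y)))) {c..}" by simp
    then show ?thesis by (auto simp: has_integral_iff)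
  qed
  have path: "f contour_integrable_on g \<and>
     contour_integral g f = contour_integral (reversepath (uminus \<circ> g)) (\<lambda>s. f (- s))"
  proof -
    have neg: "uminus \<circ> (uminus \<circ> g) = g" by auto
    have v: "valid_path (uminus \<circ> g)" using g by (rule valid_path_negatepath)
    have "(\<lambda>s. f (- s)) contour_integrable_on (uminus \<circ> g)"
      using int v by (simp add: left_loop_integrable_def contour_integrable_reversepath_eq)
    from contour_integrable_negatepath[OF v this] have "f contour_integrable_on g" unfolding neg .
    moreover have "contour_integral g f = - contour_integral (uminus \<circ> g) (\<lambda>s. f (- s))"
      using contour_integral_negatepath[OF v, of f] unfolding neg .
    ultimately show ?thesis using v by (simp add: contour_integral_reversepath)
  qed
  have h: "(\<lambda>x. f (- Complex x (- \<phi>1))) integrable_on {..- c}" "(\<lambda>x. f (- Complex x (- \<phi>2))) integrable_on {..- c}"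
    using int by (auto simp: left_loop_integrable_def)
  show "right_loop_integrable \<phi>1 \<phi>2 c g f"
    using half[OF h(1)] half[OF h(2)] path by (simp add: right_loop_integrable_def)
  show "right_loop_integral \<phi>1 \<phi>2 c g f =
      left_loop_integral (- \<phi>2) (- \<phi>1) (- c) (reversepath (uminus \<circ> g)) (\<lambda>s. f (- s))"
    using half[OF h(1)] half[OF h(2)] path by (simp add: right_loop_integral_def left_loop_integral_def)
qed

text \<open>Negation maps a circle about p to the circle about - p with the same orientation, only
  started half a turn later, while ds changes its sign. This is the origin of the minus sign in the
  expansion of part (B).\<close>

lemma residue_reflect:
  assumes r: "r > 0" and f: "f holomorphic_on ball p r - {p}"
  shows "residue (\<lambda>s. f (- s)) (- p) = - residue f p"
proof -
  define \<rho> where "\<rho> = r / 2"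
  have \<rho>: "\<rho> > 0" "\<rho> < r" using r by (auto simp: \<rho>_def)
  have "(\<lambda>s. f (- s)) holomorphic_on ball (- p) r - {- p}"
  proof -
    have "(f \<circ> uminus) holomorphic_on ball (- p) r - {- p}"
    proof (rule holomorphic_on_compose_gen[OF _ f])
      show "uminus ` (ball (- p) r - {- p}) \<subseteq> ball p r - {p}"
        by (auto simp: dist_norm norm_minus_commute add.commute)
    qed (intro holomorphic_intros)
    then show ?thesis by (simp add: o_def)
  qed
  then have "((\<lambda>s. f (- s)) has_contour_integral 2 * pi * \<i> * residue (\<lambda>s. f (- s)) (- p)) (circlepath (- p) \<rho>)"
    using r \<rho> by (intro base_residue[OF open_ball[of "- p" r]]) auto
  then have 1: "contour_integral (circlepath (- p) \<rho>) (\<lambda>s. f (- s)) = 2 * pi * \<i> * residue (\<lambda>s. f (- s)) (- p)"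
    by (rule contour_integral_unique)
  have "(f has_contour_integral 2 * pi * \<i> * residue f p) (circlepath p \<rho>)"
    using r \<rho> by (intro base_residue[OF open_ball[of p r] _ _ f]) auto
  then have 2: "contour_integral (circlepath p \<rho>) f = 2 * pi * \<i> * residue f p"
    by (rule contour_integral_unique)
  have "uminus \<circ> circlepath p \<rho> = shiftpath (1/2) (circlepath (- p) \<rho>)"
  proof
    fix x
    have "(uminus \<circ> circlepath p \<rho>) x = circlepath (- p) (- \<rho>) x" by (simp add: circlepath)
    also have "\<dots> = circlepath (- p) \<rho> (x + 1/2)" by (rule circlepath_minus)
    also have "\<dots> = shiftpath (1/2) (circlepath (- p) \<rho>) x"
      using circlepath_add_half[of "- p" \<rho> x] by (simp add: shiftpath_def add.commute)
    finally show "(uminus \<circ> circlepath p \<rho>) x = shiftpath (1/2) (circlepath (- p) \<rho>) x" .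
  qed
  then have "contour_integral (circlepath (- p) \<rho>) (\<lambda>s. f (- s)) = contour_integral (uminus \<circ> circlepath p \<rho>) (\<lambda>s. f (- s))"
    by (simp add: contour_integral_shiftpath)
  also have "\<dots> = - contour_integral (circlepath p \<rho>) f"
    by (subst contour_integral_negatepath) auto
  finally have "2 * pi * \<i> * residue (\<lambda>s. f (- s)) (- p) = 2 * pi * \<i> * (- residue f p)"
    unfolding 1 2 by simp
  then show ?thesis by (simp only: mult_cancel_left) simp
qed

text \<open>Negation preserves distances and coincidences of the points, so the same terms are
  suppressed and the same rows converge. Each term merely changes its sign.\<close>

lemma residue_double_series_reflect:
  assumes series: "residue_double_series K h (\<lambda>j l. - pt j l) n S"
    and res: "\<And>j l. j \<in> {1..n} \<Longrightarrow> residue f (pt j l) = - residue h (- pt j l)"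
  shows "residue_double_series K f pt n (- S)"
proof -
  have terms: "residue_term f pt j = (\<lambda>l. - residue_term h (\<lambda>j l. - pt j l) j l)" if "j \<in> {1..n}" for j
    using res[OF that] by (auto simp: residue_term_def)
  have ud: "uniform_discrete {- pt j l | j l. j \<in> {1..n}}" if unif: "uniform_discrete {pt j l | j l. j \<in> {1..n}}"
  proof -
    obtain e where e: "e > 0" "\<And>x y. x \<in> {pt j l | j l. j \<in> {1..n}} \<Longrightarrow> y \<in> {pt j l | j l. j \<in> {1..n}} \<Longrightarrow> dist x y < e \<Longrightarrow> x = y"
      using unif unfolding uniform_discrete_def by blast
    have "pt j l = pt j' l'" if "j \<in> {1..n}" "j' \<in> {1..n}" "dist (pt j l) (pt j' l') < e" for j j' l l'
      by (rule e(2)) (use that in blast)+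
    then show ?thesis using e(1) unfolding uniform_discrete_def
      by (intro exI[of _ e]) (auto simp: dist_minus)
  qed
  have "(\<lambda>N. - (\<Sum>j=1..n. \<Sum>l<K j N. residue_term h (\<lambda>j l. - pt j l) j l)) \<longlonglongrightarrow> - S"
    using series by (intro tendsto_minus) (simp add: residue_double_series_def)
  moreover have "(\<Sum>j=1..n. \<Sum>l<K j N. residue_term f pt j l) =
      - (\<Sum>j=1..n. \<Sum>l<K j N. residue_term h (\<lambda>j l. - pt j l) j l)" for N
    by (simp add: terms sum_negf cong: sum.cong_simp)
  moreover have "- S = (\<Sum>j=1..n. \<Sum>l. residue_term f pt j l)" if "\<forall>j\<in>{1..n}. summable (residue_term f pt j)"
  proof -
    have s: "summable (residue_term h (\<lambda>j l. - pt j l) j)" if "j \<in> {1..n}" for j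
    proof -
      have "summable (residue_term f pt j)"
        using \<open>\<forall>j\<in>{1..n}. summable (residue_term f pt j)\<close> that by blast
      then show ?thesis using terms[OF that] by (simp add: summable_minus_iff)
    qed
    then have "S = (\<Sum>j=1..n. \<Sum>l. residue_term h (\<lambda>j l. - pt j l) j l)"
      using series by (simp add: residue_double_series_def)
    also have "\<dots> = (\<Sum>j=1..n. - (\<Sum>l. residue_term f pt j l))"
      using s by (intro sum.cong refl) (simp add: terms suminf_minus[OF s])
    finally show ?thesis by (simp add: sum_negf)
  qed
  moreover have "summable (residue_term f pt j)" if "uniform_discrete {pt j l | j l. j \<in> {1..n}}" "j \<in> {1..n}" for j
    using series ud[OF that(1)] that(2) by (simp add: residue_double_series_def terms summable_minus_iff)
  ultimately show ?thesis unfolding residue_double_series_def by auto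
qed

lemma fox_kernel_reflect:
  "fox_kernel n m q p (\<lambda>j. 1 - b j) \<beta> (\<lambda>i. 1 - a i) \<alpha> s = fox_kernel m n p q a \<alpha> b \<beta> (- s)"
  by (simp add: fox_kernel_def mult_ac)

text \<open>Replacing w by - w means replacing z by 1/z. As \<Delta> becomes - \<Delta> and \<delta>
  becomes 1/\<delta>, the domain of part (B) turns into that of part (A) for the reflected
  parameters.\<close>

lemma fox_integrand_reflect:
  "fox_integrand n m q p (\<lambda>j. 1 - b j) \<beta> (\<lambda>i. 1 - a i) \<alpha> (- w) = (\<lambda>s. fox_integrand m n p q a \<alpha> b \<beta> w (- s))"
  by (simp add: fox_integrand_def fox_kernel_reflect)

lemma fox_delta_pos:
  assumes "\<And>i. i \<in> {1..p} \<Longrightarrow> \<alpha> i > 0" "\<And>j. j \<in> {1..q} \<Longrightarrow> \<beta> j > 0"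
  shows "fox_delta p q \<alpha> \<beta> > 0"
  unfolding fox_delta_def using assms by (intro mult_pos_pos prod_pos) (auto simp: less_imp_neq[symmetric])

lemma fox_delta_swap: "fox_delta q p \<beta> \<alpha> = inverse (fox_delta p q \<alpha> \<beta>)"
proof -
  have "(\<Prod>i\<in>A. inverse (f i)) = inverse (prod f A)" for A :: "nat set" and f :: "nat \<Rightarrow> real"
    using prod_inversef[of f A] by (simp add: o_def)
  then show ?thesis by (simp add: fox_delta_def powr_minus mult.commute)
qed

lemma fox_Delta_swap: "fox_Delta q p \<beta> \<alpha> = - fox_Delta p q \<alpha> \<beta>"
  by (simp add: fox_Delta_def)

text \<open>Whether or not s is a pole, the remaining poles form a closed set that does not contain
  it.\<close>

lemma (in fox) integrand_isolated:
  obtains r where "r > 0" "integrand w holomorphic_on ball s r - {s}"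
proof -
  let ?P = "poles_a \<union> poles_b - {s}"
  have "finite (?P \<inter> cball 0 M)" for M by (rule finite_subset[OF _ finite_poles[of M]]) auto
  then have "open (- ?P)" by (intro open_Compl closed_finite_in_balls)
  then obtain r where r: "r > 0" "ball s r \<subseteq> - ?P" using openE[of "- ?P" s] by auto
  have "integrand w holomorphic_on ball s r - {s}"
    by (rule holomorphic_on_subset[OF integrand_holomorphic]) (use r in auto)
  then show ?thesis using r that by blast
qed

section \<open>Both expansions along branches of log z\<close>

theorem theorem2:
  fixes m n p q :: nat
    and a b :: "nat \<Rightarrow> complex"
    and \<alpha> \<beta> :: "nat \<Rightarrow> real"
  assumes "m \<le> q" and "n \<le> p"
    and "\<And>i. i \<in> {1..p} \<Longrightarrow> \<alpha> i > 0"
    and "\<And>j. j \<in> {1..q} \<Longrightarrow> \<beta> j > 0"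
    and "\<And>i j k l. i \<in> {1..n} \<Longrightarrow> j \<in> {1..m} \<Longrightarrow>
           of_real (\<beta> j) * (a i - 1 - of_nat k) \<noteq> of_real (\<alpha> i) * (b j + of_nat l)"
  shows
    "(\<forall>D. fox_Delta p q \<alpha> \<beta> > 0 \<and> D = {z. z \<noteq> 0} \<or>
          fox_Delta p q \<alpha> \<beta> = 0 \<and> D = {z. 0 < norm z \<and> norm z < fox_delta p q \<alpha> \<beta>} \<longrightarrow>
       (\<exists>K. (\<forall>j\<in>{1..m}. filterlim (K j) at_top sequentially) \<and>
         (\<forall>\<phi>1 \<phi>2 c g U L.
            fox_left_loop m n a \<alpha> b \<beta> \<phi>1 \<phi>2 c g \<and> open U \<and> U \<subseteq> D \<and> log_branch_on U L \<longrightarrow>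
              (\<forall>z\<in>U. left_loop_integrable \<phi>1 \<phi>2 c g (fox_integrand m n p q a \<alpha> b \<beta> (L z))) \<and>
              fox_H_left m n p q a \<alpha> b \<beta> \<phi>1 \<phi>2 c g L analytic_on U \<and>
              (\<forall>z\<in>U. residue_double_series K (fox_integrand m n p q a \<alpha> b \<beta> (L z))
                       (fox_pole_b b \<beta>) m
                       (fox_H_left m n p q a \<alpha> b \<beta> \<phi>1 \<phi>2 c g L z)))))
     \<and>
     (\<forall>D. fox_Delta p q \<alpha> \<beta> < 0 \<and> D = {z. z \<noteq> 0} \<or>
          fox_Delta p q \<alpha> \<beta> = 0 \<and> D = {z. norm z > fox_delta p q \<alpha> \<beta>} \<longrightarrow>
       (\<exists>K. (\<forall>i\<in>{1..n}. filterlim (K i) at_top sequentially) \<and>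
         (\<forall>\<phi>1 \<phi>2 c g U L.
            fox_right_loop m n a \<alpha> b \<beta> \<phi>1 \<phi>2 c g \<and> open U \<and> U \<subseteq> D \<and> log_branch_on U L \<longrightarrow>
              (\<forall>z\<in>U. right_loop_integrable \<phi>1 \<phi>2 c g (fox_integrand m n p q a \<alpha> b \<beta> (L z))) \<and>
              fox_H_right m n p q a \<alpha> b \<beta> \<phi>1 \<phi>2 c g L analytic_on U \<and>
              (\<forall>z\<in>U. residue_double_series K (fox_integrand m n p q a \<alpha> b \<beta> (L z))
                       (fox_pole_a a \<alpha>) n
                       (- fox_H_right m n p q a \<alpha> b \<beta> \<phi>1 \<phi>2 c g L z)))))"
proof -
  interpret fox m n p q a b \<alpha> \<beta> using assms(1-4) by unfold_locales auto
  interpret refl: fox n m q p "\<lambda>j. 1 - b j" "\<lambda>i. 1 - a i" \<beta> \<alpha>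
    using assms(1-4) by unfold_locales auto
  have \<delta>: "fox_delta p q \<alpha> \<beta> > 0" using alpha_pos beta_pos by (rule fox_delta_pos)
  \<comment> \<open>The real part of every branch is ln |z|, so admissibility depends on |z| only
    and not on the branch.\<close>
  have Re_log: "exp (Re (L z)) = norm z" if "log_branch_on U L" "z \<in> U" for U :: "complex set" and L z
    using that norm_exp_eq_Re[of "L z"] by (simp add: log_branch_on_def)
  show ?thesis
  proof (intro conjI allI impI)
    fix D :: "complex set" assume D: "fox_Delta p q \<alpha> \<beta> > 0 \<and> D = {z. z \<noteq> 0} \<or>
          fox_Delta p q \<alpha> \<beta> = 0 \<and> D = {z. 0 < norm z \<and> norm z < fox_delta p q \<alpha> \<beta>}"
    obtain K where K: "\<And>j. j \<in> {1..m} \<Longrightarrow> filterlim (K j) at_top sequentially"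
      and int: "\<And>\<phi>1 \<phi>2 c g w. fox_left_loop m n a \<alpha> b \<beta> \<phi>1 \<phi>2 c g \<Longrightarrow> admissible (Re w) \<Longrightarrow>
         left_loop_integrable \<phi>1 \<phi>2 c g (integrand w)"
      and series: "\<And>\<phi>1 \<phi>2 c g w. fox_left_loop m n a \<alpha> b \<beta> \<phi>1 \<phi>2 c g \<Longrightarrow> admissible (Re w) \<Longrightarrow>
         residue_double_series K (integrand w) pole m
           (1 / (2 * of_real pi * \<i>) * left_loop_integral \<phi>1 \<phi>2 c g (integrand w))"
      and hol: "\<And>\<phi>1 \<phi>2 c g. fox_left_loop m n a \<alpha> b \<beta> \<phi>1 \<phi>2 c g \<Longrightarrow>
         (\<lambda>w. left_loop_integral \<phi>1 \<phi>2 c g (integrand w)) holomorphic_on {w. admissible (Re w)}"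
      using left_loop_residue_expansion by blast
    show "\<exists>K. (\<forall>j\<in>{1..m}. filterlim (K j) at_top sequentially) \<and>
         (\<forall>\<phi>1 \<phi>2 c g U L.
            fox_left_loop m n a \<alpha> b \<beta> \<phi>1 \<phi>2 c g \<and> open U \<and> U \<subseteq> D \<and> log_branch_on U L \<longrightarrow>
              (\<forall>z\<in>U. left_loop_integrable \<phi>1 \<phi>2 c g (fox_integrand m n p q a \<alpha> b \<beta> (L z))) \<and>
              fox_H_left m n p q a \<alpha> b \<beta> \<phi>1 \<phi>2 c g L analytic_on U \<and>
              (\<forall>z\<in>U. residue_double_series K (fox_integrand m n p q a \<alpha> b \<beta> (L z))
                       (fox_pole_b b \<beta>) m
                       (fox_H_left m n p q a \<alpha> b \<beta> \<phi>1 \<phi>2 c g L z)))"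
    proof (intro exI[of _ K] conjI ballI allI impI; (elim conjE)?)
      fix \<phi>1 \<phi>2 c :: real and g :: "real \<Rightarrow> complex" and U :: "complex set" and L :: "complex \<Rightarrow> complex"
      assume loop: "fox_left_loop m n a \<alpha> b \<beta> \<phi>1 \<phi>2 c g" and U: "open U" "U \<subseteq> D" and L: "log_branch_on U L"
      have adm: "admissible (Re (L z))" if "z \<in> U" for z
      proof -
        have "Re (L z) < ln (fox_delta p q \<alpha> \<beta>)" if "norm z < fox_delta p q \<alpha> \<beta>"
          using that Re_log[OF L \<open>z \<in> U\<close>] \<delta> by (metis exp_ln exp_less_cancel_iff)
        then show ?thesis using D U(2) \<open>z \<in> U\<close> by (auto simp: admissible_def)
      qed
      show "left_loop_integrable \<phi>1 \<phi>2 c g (integrand (L z))" if "z \<in> U" for z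
        by (rule int[OF loop adm[OF that]])
      show "residue_double_series K (integrand (L z)) pole m (fox_H_left m n p q a \<alpha> b \<beta> \<phi>1 \<phi>2 c g L z)"
        if "z \<in> U" for z
        unfolding fox_H_left_def by (rule series[OF loop adm[OF that]])
      have "((\<lambda>w. left_loop_integral \<phi>1 \<phi>2 c g (integrand w)) \<circ> L) holomorphic_on U"
        using L adm by (intro holomorphic_on_compose_gen[OF _ hol[OF loop]]) (auto simp: log_branch_on_def)
      then have "fox_H_left m n p q a \<alpha> b \<beta> \<phi>1 \<phi>2 c g L holomorphic_on U"
        unfolding fox_H_left_def o_def by (intro holomorphic_intros)
      then show "fox_H_left m n p q a \<alpha> b \<beta> \<phi>1 \<phi>2 c g L analytic_on U"
        using U(1) by (simp add: analytic_on_open)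
    qed (rule K)
  next
    fix D :: "complex set" assume D: "fox_Delta p q \<alpha> \<beta> < 0 \<and> D = {z. z \<noteq> 0} \<or>
          fox_Delta p q \<alpha> \<beta> = 0 \<and> D = {z. norm z > fox_delta p q \<alpha> \<beta>}"
    obtain K where K: "\<And>i. i \<in> {1..n} \<Longrightarrow> filterlim (K i) at_top sequentially"
      and int: "\<And>\<phi>1 \<phi>2 c g w. fox_left_loop n m (\<lambda>j. 1 - b j) \<beta> (\<lambda>i. 1 - a i) \<alpha> \<phi>1 \<phi>2 c g \<Longrightarrow> refl.admissible (Re w) \<Longrightarrow>
         left_loop_integrable \<phi>1 \<phi>2 c g (refl.integrand w)"
      and series: "\<And>\<phi>1 \<phi>2 c g w. fox_left_loop n m (\<lambda>j. 1 - b j) \<beta> (\<lambda>i. 1 - a i) \<alpha> \<phi>1 \<phi>2 c g \<Longrightarrow> refl.admissible (Re w) \<Longrightarrow>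
         residue_double_series K (refl.integrand w) refl.pole n
           (1 / (2 * of_real pi * \<i>) * left_loop_integral \<phi>1 \<phi>2 c g (refl.integrand w))"
      and hol: "\<And>\<phi>1 \<phi>2 c g. fox_left_loop n m (\<lambda>j. 1 - b j) \<beta> (\<lambda>i. 1 - a i) \<alpha> \<phi>1 \<phi>2 c g \<Longrightarrow>
         (\<lambda>w. left_loop_integral \<phi>1 \<phi>2 c g (refl.integrand w)) holomorphic_on {w. refl.admissible (Re w)}"
      using refl.left_loop_residue_expansion by blast
    have refl_pole: "refl.pole = (\<lambda>i k. - fox_pole_a a \<alpha> i k)"
      by (simp add: fun_eq_iff fox_pole_a_def fox_pole_b_def)
    show "\<exists>K. (\<forall>i\<in>{1..n}. filterlim (K i) at_top sequentially) \<and>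
         (\<forall>\<phi>1 \<phi>2 c g U L.
            fox_right_loop m n a \<alpha> b \<beta> \<phi>1 \<phi>2 c g \<and> open U \<and> U \<subseteq> D \<and> log_branch_on U L \<longrightarrow>
              (\<forall>z\<in>U. right_loop_integrable \<phi>1 \<phi>2 c g (fox_integrand m n p q a \<alpha> b \<beta> (L z))) \<and>
              fox_H_right m n p q a \<alpha> b \<beta> \<phi>1 \<phi>2 c g L analytic_on U \<and>
              (\<forall>z\<in>U. residue_double_series K (fox_integrand m n p q a \<alpha> b \<beta> (L z))
                       (fox_pole_a a \<alpha>) n
                       (- fox_H_right m n p q a \<alpha> b \<beta> \<phi>1 \<phi>2 c g L z)))"
    proof (intro exI[of _ K] conjI ballI allI impI; (elim conjE)?)
      fix \<phi>1 \<phi>2 c :: real and g :: "real \<Rightarrow> complex" and U :: "complex set" and L :: "complex \<Rightarrow> complex"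
      assume loop: "fox_right_loop m n a \<alpha> b \<beta> \<phi>1 \<phi>2 c g" and U: "open U" "U \<subseteq> D" and L: "log_branch_on U L"
      note loop' = fox_left_loop_reflect[OF loop]
      have g: "valid_path g" using loop by (simp add: fox_right_loop_def loop_link_def)
      have adm: "refl.admissible (Re (- L z))" if "z \<in> U" for z
      proof -
        have "ln (fox_delta p q \<alpha> \<beta>) < Re (L z)" if "norm z > fox_delta p q \<alpha> \<beta>"
          using that Re_log[OF L \<open>z \<in> U\<close>] \<delta> by (metis exp_ln exp_less_cancel_iff)
        then show ?thesis using D U(2) \<open>z \<in> U\<close> \<delta>
          by (auto simp: refl.admissible_def fox_Delta_swap[of q p] fox_delta_swap[of q p] ln_inverse)
      qed
      have integrable: "left_loop_integrable (- \<phi>2) (- \<phi>1) (- c) (reversepath (uminus \<circ> g)) (\<lambda>s. integrand (L z) (- s))"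
        if "z \<in> U" for z
        using int[OF loop' adm[OF that]] by (simp add: fox_integrand_reflect)
      \<comment> \<open>This carries over both the expansion and the holomorphy from the reflected
        left loop.\<close>
      have right_eq: "right_loop_integral \<phi>1 \<phi>2 c g (integrand (L z)) =
          left_loop_integral (- \<phi>2) (- \<phi>1) (- c) (reversepath (uminus \<circ> g)) (refl.integrand (- L z))"
        if "z \<in> U" for z
        using right_loop_integral_reflect(2)[OF g integrable[OF that]] by (simp add: fox_integrand_reflect)
      show "right_loop_integrable \<phi>1 \<phi>2 c g (integrand (L z))" if "z \<in> U" for z
        by (rule right_loop_integral_reflect(1)[OF g integrable[OF that]])
      show "residue_double_series K (integrand (L z)) (fox_pole_a a \<alpha>) n (- fox_H_right m n p q a \<alpha> b \<beta> \<phi>1 \<phi>2 c g L z)"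
        if z: "z \<in> U" for z
        unfolding fox_H_right_def right_eq[OF z]
      proof (rule residue_double_series_reflect)
        show "residue_double_series K (refl.integrand (- L z)) (\<lambda>j l. - fox_pole_a a \<alpha> j l) n
          (1 / (2 * of_real pi * \<i>) * left_loop_integral (- \<phi>2) (- \<phi>1) (- c) (reversepath (uminus \<circ> g)) (refl.integrand (- L z)))"
          using series[OF loop' adm[OF z]] unfolding refl_pole .
        fix i k
        obtain r where "r > 0" "integrand (L z) holomorphic_on ball (fox_pole_a a \<alpha> i k) r - {fox_pole_a a \<alpha> i k}"
          using integrand_isolated by blast
        from residue_reflect[OF this]
        show "residue (integrand (L z)) (fox_pole_a a \<alpha> i k) = - residue (refl.integrand (- L z)) (- fox_pole_a a \<alpha> i k)"
          by (simp add: fox_integrand_reflect)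
      qed
      have "((\<lambda>w. left_loop_integral (- \<phi>2) (- \<phi>1) (- c) (reversepath (uminus \<circ> g)) (refl.integrand w)) \<circ> (\<lambda>z. - L z)) holomorphic_on U"
        using L adm by (intro holomorphic_on_compose_gen[OF _ hol[OF loop']] holomorphic_intros) (auto simp: log_branch_on_def)
      then have "(\<lambda>z. 1 / (2 * of_real pi * \<i>) * left_loop_integral (- \<phi>2) (- \<phi>1) (- c) (reversepath (uminus \<circ> g)) (refl.integrand (- L z))) holomorphic_on U"
        unfolding o_def by (intro holomorphic_intros)
      then have "fox_H_right m n p q a \<alpha> b \<beta> \<phi>1 \<phi>2 c g L holomorphic_on U"
        by (rule holomorphic_transform) (simp add: fox_H_right_def right_eq)
      then show "fox_H_right m n p q a \<alpha> b \<beta> \<phi>1 \<phi>2 c g L analytic_on U"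
        using U(1) by (simp add: analytic_on_open)
    qed (rule K)
  qed
qed

end
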